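(* Let $\mathcal{H}$ be a complex Hilbert space, let $A$ and $B$ be positive operators on $\mathcal{H}$, let $\nu\in[0,1]$, and let $r=\min\{\nu,1-\nu\}$. Then $$(1-\nu)A+\nu B \;\geq\; A\sharp_{\nu}B+2r\left(\frac{A+B}{2}-A\sharp_{1/2}B\right)\;\geq\; A\sharp_{\nu}B$$ $$\geq\;\left\{A^{-1}\sharp_{\nu}B^{-1}+2r\left(\frac{A^{-1}+B^{-1}}{2}-A^{-1}\sharp_{1/2}B^{-1}\right)\right\}^{-1}\;\geq\;\left\{(1-\nu)A^{-1}+\nu B^{-1}\right\}^{-1},$$ where $A\sharp_{\nu}B := A^{1/2}\left(A^{-1/2}BA^{-1/2}\right)^{\nu}A^{1/2}$ for $\nu\in[0,1]$.
   Context: Operators are bounded operators on a complex Hilbert space $\mathcal{H}$. An operator $A$ is self-adjoint if $A^*=A$; a self-adjoint operator $A$ is called positive if $\langle x, Ax\rangle\geq 0$ for all $x\in\mathcal{H}$ (invertibility is not required). For self-adjoint $A,B$, $A\geq B$ means $A-B\geq 0$, i.e. $A-B$ is positive. Powers of positive operators are given by the standard operational (functional) calculus. When an operator whose inverse appears is not invertible, the expressions are understood by continuity: the operator is replaced by the invertible positive operator obtained by adding $\epsilon I$ (e.g. $A_\epsilon=A+\epsilon I$, $\epsilon>0$, $I$ the identity), and the limit $\epsilon\to 0$ is taken. *)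

theory Defs
  imports "HOL-Analysis.Analysis" "HOL-Computational_Algebra.Polynomial"
begin

section \<open>Complex Hilbert spaces\<close>

text \<open>
  The real part of the complex inner product is the inner product of the superclass
  \<^class>\<open>real_inner\<close>, so that \<open>norm x = sqrt (Re (cinner x x))\<close> and the library's metric
  and topological notions are those of the Hilbert space. The inner product is linear in its
  second argument.
\<close>

class complex_inner = real_inner +
  fixes scaleC :: "complex \<Rightarrow> 'a \<Rightarrow> 'a" (infixr "*\<^sub>C" 75)
    and cinner :: "'a \<Rightarrow> 'a \<Rightarrow> complex"
  assumes scaleC_add_right: "c *\<^sub>C (x + y) = c *\<^sub>C x + c *\<^sub>C y"
    and scaleC_add_left: "(c + d) *\<^sub>C x = c *\<^sub>C x + d *\<^sub>C x"
    and scaleC_scaleC: "c *\<^sub>C (d *\<^sub>C x) = (c * d) *\<^sub>C x"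
    and scaleR_scaleC: "t *\<^sub>R x = complex_of_real t *\<^sub>C x"
    and cinner_commute: "cinner x y = cnj (cinner y x)"
    and cinner_add_right: "cinner x (y + z) = cinner x y + cinner x z"
    and cinner_scaleC_right: "cinner x (c *\<^sub>C y) = c * cinner x y"
    and Re_cinner: "Re (cinner x y) = inner x y"

class chilbert_space = complex_inner + complete_space

instantiation complex :: chilbert_space
begin

definition scaleC_complex :: "complex \<Rightarrow> complex \<Rightarrow> complex" where
  "scaleC_complex c x = c * x"

definition cinner_complex :: "complex \<Rightarrow> complex \<Rightarrow> complex" where
  "cinner_complex x y = cnj x * y"

instance
  by standard
    (auto simp: scaleC_complex_def cinner_complex_def inner_complex_def algebra_simps
      scaleR_conv_of_real)

end


section \<open>Bounded operators\<close>

text \<open>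
  Elements of \<open>'a \<Rightarrow>\<^sub>L 'a\<close> are bounded but only real-linear; the bounded operators on the
  complex Hilbert space are those that satisfy \<open>complex_linear\<close>.
\<close>

definition complex_linear :: "('a::complex_inner \<Rightarrow>\<^sub>L 'a) \<Rightarrow> bool" where
  "complex_linear A \<longleftrightarrow> (\<forall>c x. blinfun_apply A (c *\<^sub>C x) = c *\<^sub>C blinfun_apply A x)"

definition is_adjoint :: "('a::complex_inner \<Rightarrow>\<^sub>L 'a) \<Rightarrow> ('a \<Rightarrow>\<^sub>L 'a) \<Rightarrow> bool" where
  "is_adjoint A B \<longleftrightarrow> (\<forall>x y. cinner (blinfun_apply B x) y = cinner x (blinfun_apply A y))"

definition self_adjoint :: "('a::complex_inner \<Rightarrow>\<^sub>L 'a) \<Rightarrow> bool" where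
  "self_adjoint A \<longleftrightarrow> complex_linear A \<and> is_adjoint A A"

definition positive_op :: "('a::complex_inner \<Rightarrow>\<^sub>L 'a) \<Rightarrow> bool" where
  "positive_op A \<longleftrightarrow> self_adjoint A \<and> (\<forall>x. cinner x (blinfun_apply A x) \<in> \<real>\<^sub>\<ge>\<^sub>0)"

definition op_ge :: "('a::complex_inner \<Rightarrow>\<^sub>L 'a) \<Rightarrow> ('a \<Rightarrow>\<^sub>L 'a) \<Rightarrow> bool" (infix "\<succeq>" 50) where
  "A \<succeq> B \<longleftrightarrow> positive_op (A - B)"

definition is_inverse_op :: "('a::real_normed_vector \<Rightarrow>\<^sub>L 'a) \<Rightarrow> ('a \<Rightarrow>\<^sub>L 'a) \<Rightarrow> bool" where
  "is_inverse_op A B \<longleftrightarrow> A o\<^sub>L B = id_blinfun \<and> B o\<^sub>L A = id_blinfun"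

definition invertible_op :: "('a::real_normed_vector \<Rightarrow>\<^sub>L 'a) \<Rightarrow> bool" where
  "invertible_op A \<longleftrightarrow> (\<exists>B. is_inverse_op A B)"

definition inverse_op :: "('a::real_normed_vector \<Rightarrow>\<^sub>L 'a) \<Rightarrow> ('a \<Rightarrow>\<^sub>L 'a)" where
  "inverse_op A = (THE B. is_inverse_op A B)"


section \<open>Functional calculus and powers\<close>

text \<open>
  The inverse of a complex-linear operator is complex-linear, so for such operators this is the
  spectrum in the algebra of bounded operators on the complex Hilbert space.
\<close>

definition op_spectrum :: "('a::complex_inner \<Rightarrow>\<^sub>L 'a) \<Rightarrow> complex set" where
  "op_spectrum A = {c. \<not> invertible_op (A - Blinfun (\<lambda>x. c *\<^sub>C x))}"

definition poly_op :: "real poly \<Rightarrow> ('a::real_normed_vector \<Rightarrow>\<^sub>L 'a) \<Rightarrow> ('a \<Rightarrow>\<^sub>L 'a)" where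
  "poly_op p A = (\<Sum>i\<le>degree p. coeff p i *\<^sub>R (((o\<^sub>L) A ^^ i) id_blinfun))"

text \<open>
  Continuous functional calculus of a self-adjoint operator \<open>A\<close> (whose spectrum is real) for a
  real function \<open>f\<close> continuous on the spectrum: the norm limit of \<open>p\<^sub>n(A)\<close> for any polynomials
  \<open>p\<^sub>n\<close> that converge to \<open>f\<close> uniformly on the spectrum.
\<close>

definition fun_calc :: "(real \<Rightarrow> real) \<Rightarrow> ('a::complex_inner \<Rightarrow>\<^sub>L 'a) \<Rightarrow> ('a \<Rightarrow>\<^sub>L 'a)" where
  "fun_calc f A = (THE T. \<exists>p :: nat \<Rightarrow> real poly.
     uniform_limit (complex_of_real -` op_spectrum A) (\<lambda>n. poly (p n)) f sequentially \<and>
     (\<lambda>n. poly_op (p n) A) \<longlonglongrightarrow> T)"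

text \<open>
  The case distinction gives \<open>A\<^sup>0 = I\<close> also when \<open>0\<close> is in the spectrum, since \<open>0 powr 0 = 0\<close>.
  Negative exponents are meaningful for invertible \<open>A\<close> only.
\<close>

definition op_powr :: "('a::complex_inner \<Rightarrow>\<^sub>L 'a) \<Rightarrow> real \<Rightarrow> ('a \<Rightarrow>\<^sub>L 'a)" where
  "op_powr A s = fun_calc (\<lambda>t. if s = 0 then 1 else t powr s) A"


section \<open>Expressions understood by continuity\<close>

definition regularize :: "real \<Rightarrow> ('a::real_normed_vector \<Rightarrow>\<^sub>L 'a) \<Rightarrow> ('a \<Rightarrow>\<^sub>L 'a)" where
  "regularize e A = (if invertible_op A then A else A + e *\<^sub>R id_blinfun)"

text \<open>
  The limit is taken in the strong operator topology: in infinite dimension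
  \<open>(A + \<epsilon>I) \<sharp> B\<close> need not converge in norm as \<open>\<epsilon>\<close> tends to \<open>0\<close>.
\<close>

definition strong_lim0 :: "(real \<Rightarrow> ('a::real_normed_vector \<Rightarrow>\<^sub>L 'a)) \<Rightarrow> ('a \<Rightarrow>\<^sub>L 'a)" where
  "strong_lim0 F = (THE T. \<forall>x.
     ((\<lambda>e. blinfun_apply (F e) x) \<longlongrightarrow> blinfun_apply T x) (at_right 0))"

text \<open>
  If all operators whose inverses appear are invertible, the families below are constant and the
  limits are the plain values of the expressions.
\<close>

definition by_continuity ::
    "(('a::real_normed_vector \<Rightarrow>\<^sub>L 'a) \<Rightarrow> ('a \<Rightarrow>\<^sub>L 'a)) \<Rightarrow> ('a \<Rightarrow>\<^sub>L 'a) \<Rightarrow> ('a \<Rightarrow>\<^sub>L 'a)" where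
  "by_continuity E A = strong_lim0 (\<lambda>e. E (regularize e A))"

definition by_continuity2 ::
    "(('a::real_normed_vector \<Rightarrow>\<^sub>L 'a) \<Rightarrow> ('a \<Rightarrow>\<^sub>L 'a) \<Rightarrow> ('a \<Rightarrow>\<^sub>L 'a))
     \<Rightarrow> ('a \<Rightarrow>\<^sub>L 'a) \<Rightarrow> ('a \<Rightarrow>\<^sub>L 'a) \<Rightarrow> ('a \<Rightarrow>\<^sub>L 'a)" where
  "by_continuity2 E A B = strong_lim0 (\<lambda>e. E (regularize e A) (regularize e B))"

definition geom_mean ::
    "('a::complex_inner \<Rightarrow>\<^sub>L 'a) \<Rightarrow> real \<Rightarrow> ('a \<Rightarrow>\<^sub>L 'a) \<Rightarrow> ('a \<Rightarrow>\<^sub>L 'a)"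
    ("(_ \<sharp>\<^bsub>_\<^esub>/ _)" [71, 0, 71] 70) where
  "A \<sharp>\<^bsub>\<nu>\<^esub> B = by_continuity (\<lambda>X.
     op_powr X (1/2)
       o\<^sub>L op_powr (op_powr X (-1/2) o\<^sub>L B o\<^sub>L op_powr X (-1/2)) \<nu>
       o\<^sub>L op_powr X (1/2)) A"

end

theory Submission
  imports Defs "HOL-Computational_Algebra.Fundamental_Theorem_Algebra"
begin

text \<open>
  All expressions of the theorem are homogeneous in \<open>(A, B)\<close> and are treated as functions of the single
  operator \<open>P = H\<^sup>-\<^sup>1\<^sup>/\<^sup>2 A H\<^sup>-\<^sup>1\<^sup>/\<^sup>2\<close> with \<open>H = A + B\<close>: if \<open>A\<close> is invertible, then
  \<open>A\<^sup>1\<^sup>/\<^sup>2 f(A\<^sup>-\<^sup>1\<^sup>/\<^sup>2 B A\<^sup>-\<^sup>1\<^sup>/\<^sup>2) A\<^sup>1\<^sup>/\<^sup>2 = H\<^sup>1\<^sup>/\<^sup>2 \<phi>(P) H\<^sup>1\<^sup>/\<^sup>2\<close> with \<open>\<phi>(x) = x f((1 - x)/x)\<close>, and \<open>\<phi>\<close> is continuous on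
  \<open>[0, 1]\<close> for every mean that occurs. Replacing \<open>A, B\<close> by \<open>A + a\<epsilon>, B + b\<epsilon>\<close> turns \<open>P\<close> into operators
  \<open>P\<^sub>\<epsilon>\<close> between \<open>0\<close> and \<open>1\<close> that converge strongly as \<open>\<epsilon> \<rightarrow> 0\<close>; the limit depends on \<open>a, b\<close> only on the
  kernel of \<open>H\<close>, where \<open>H\<^sup>1\<^sup>/\<^sup>2\<close> vanishes. Hence all the limits exist, they are \<open>H\<^sup>1\<^sup>/\<^sup>2 \<phi>(P) H\<^sup>1\<^sup>/\<^sup>2\<close> with one
  and the same \<open>P\<close> whichever of the operators are regularized, and the four inequalities
  reduce to inequalities between functions \<open>\<phi>\<close> on \<open>[0, 1]\<close>, which follow from the refined Young inequality
  \<open>(1 - \<nu>) x + \<nu> y \<ge> x\<^sup>1\<^sup>-\<^sup>\<nu> y\<^sup>\<nu> + r (\<surd>x - \<surd>y)\<^sup>2\<close>.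
\<close>

\<comment> \<open>The variable is \<open>P\<close> and not A^(-1/2) B A^(-1/2), because the latter
  may become unbounded when the regularization is removed, while the regularized versions of
  \<open>P\<close> stay between 0 and 1, where one polynomial approximation of \<phi> serves them
  all. The obstacle is that (H + d)^(-1/2) may be unbounded as d tends to 0, so \<open>P\<close>
  cannot be obtained from a limit of this factor. The operators (H + d)^(-1/2) A^(1/2), however, are
  contractions because A \<le> H, and they converge strongly by monotonicity.
  \<open>fun_calc\<close> asks for convergence of the polynomials on the spectrum only, not on an
  interval around it. Its value is unique because the norm of p(A) is bounded by the supremum of |p|
  on the spectrum, and this bound rests on a factorization of polynomials over the complex numbers.
  Most of the work concerns real-linear operators that are symmetric for the real inner product.
  Complex linearity is commutation with the scalar multiplications, which functional calculi and
  strong limits inherit.\<close>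
subclass (in chilbert_space) banach ..

section \<open>Polynomials in an operator\<close>

lemma poly_op_altdef:
  assumes "degree p \<le> n"
  shows "poly_op p A = (\<Sum>i\<le>n. coeff p i *\<^sub>R (((o\<^sub>L) A ^^ i) id_blinfun))"
  unfolding poly_op_def
  by (rule sum.mono_neutral_left) (use assms in \<open>auto simp: coeff_eq_0 not_le\<close>)

interpretation blinfun_compose: bounded_bilinear "(o\<^sub>L)"
  by (rule bounded_bilinear_blinfun_compose)

lemma blinfun_compose_assoc: "A o\<^sub>L B o\<^sub>L C = A o\<^sub>L (B o\<^sub>L C)"
  by (rule blinfun_eqI) simp

lemma blinfun_compose_id [simp]: "A o\<^sub>L id_blinfun = A" "id_blinfun o\<^sub>L A = A"
  by (auto intro: blinfun_eqI)

lemma poly_op_0 [simp]: "poly_op 0 A = 0"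
  by (simp add: poly_op_def)

lemma poly_op_pCons: "poly_op (pCons a p) A = a *\<^sub>R id_blinfun + (A o\<^sub>L poly_op p A)"
proof -
  have "poly_op (pCons a p) A
      = (\<Sum>i\<le>Suc (degree p). coeff (pCons a p) i *\<^sub>R (((o\<^sub>L) A ^^ i) id_blinfun))"
    by (rule poly_op_altdef) (simp add: degree_pCons_le)
  also have "\<dots> = a *\<^sub>R id_blinfun + (A o\<^sub>L poly_op p A)"
    by (simp add: sum.atMost_Suc_shift poly_op_def blinfun_compose.sum_right
        blinfun_compose.scaleR_right del: sum.atMost_Suc)
  finally show ?thesis .
qed

lemma poly_op_const [simp]: "poly_op [:a:] A = a *\<^sub>R id_blinfun"
  by (simp add: poly_op_pCons blinfun_compose.zero_right)

lemma poly_op_smult: "poly_op (smult c p) A = c *\<^sub>R poly_op p A"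
  by (induction p) (auto simp: poly_op_pCons algebra_simps blinfun_compose.scaleR_right)

lemma poly_op_add: "poly_op (p + q) A = poly_op p A + poly_op q A"
  by (induction p q rule: poly_induct2)
    (auto simp: poly_op_pCons algebra_simps blinfun_compose.add_right)

lemma poly_op_diff: "poly_op (p - q) A = poly_op p A - poly_op q A"
  using poly_op_add[of p "- q" A] poly_op_smult[of "-1" q A] by simp

lemma poly_op_mult: "poly_op (p * q) A = poly_op p A o\<^sub>L poly_op q A"
  by (induction p)
    (auto simp: poly_op_pCons poly_op_add poly_op_smult blinfun_compose_assoc
      blinfun_compose.add_left blinfun_compose.scaleR_left blinfun_compose.zero_left)

text \<open>Two operators and an intertwiner \<open>S\<close>, rather than one operator and its
  commutant, because later uses compare different operators: there \<open>S\<close> is H^(-1/2)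
  X^(1/2) or the projection \<open>id_blinfun - Q\<close>.\<close>

lemma poly_op_intertwine:
  assumes "A o\<^sub>L S = S o\<^sub>L B"
  shows "poly_op p A o\<^sub>L S = S o\<^sub>L poly_op p B"
proof (induction p)
  case 0
  show ?case by (simp add: blinfun_compose.zero_left blinfun_compose.zero_right)
next
  case (pCons a p)
  have "A o\<^sub>L poly_op p A o\<^sub>L S = S o\<^sub>L B o\<^sub>L poly_op p B"
    using pCons(2) assms by (metis blinfun_compose_assoc)
  then show ?case
    by (simp add: poly_op_pCons blinfun_compose.add_left blinfun_compose.add_right
        blinfun_compose.scaleR_left blinfun_compose.scaleR_right blinfun_compose_assoc)
qed

section \<open>Symmetric operators\<close>

definition symmetric_op :: "('a::real_inner \<Rightarrow>\<^sub>L 'a) \<Rightarrow> bool" where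
  "symmetric_op A \<longleftrightarrow> (\<forall>x y. inner (A x) y = inner x (A y))"

text \<open>This is m I \<le> A \<le> M I in terms of quadratic forms. The interval
  \<open>{m..M}\<close> contains the real spectrum and is the domain on which functions of
  \<open>A\<close> have to be continuous.\<close>

definition op_between :: "real \<Rightarrow> ('a::real_inner \<Rightarrow>\<^sub>L 'a) \<Rightarrow> real \<Rightarrow> bool" where
  "op_between m A M \<longleftrightarrow>
     symmetric_op A \<and> (\<forall>x. m * inner x x \<le> inner x (A x) \<and> inner x (A x) \<le> M * inner x x)"

lemma op_betweenD:
  assumes "op_between m A M"
  shows "symmetric_op A" "m * inner x x \<le> inner x (A x)" "inner x (A x) \<le> M * inner x x"
  using assms by (auto simp: op_between_def)

lemma symmetric_opD: "symmetric_op A \<Longrightarrow> inner (A x) y = inner x (A y)"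
  by (simp add: symmetric_op_def)

lemma symmetric_op_id [simp]: "symmetric_op id_blinfun"
  by (simp add: symmetric_op_def)

lemma symmetric_op_0 [simp]: "symmetric_op 0"
  by (simp add: symmetric_op_def)

lemma symmetric_op_add: "symmetric_op A \<Longrightarrow> symmetric_op B \<Longrightarrow> symmetric_op (A + B)"
  by (simp add: symmetric_op_def blinfun.bilinear_simps inner_add)

lemma symmetric_op_diff: "symmetric_op A \<Longrightarrow> symmetric_op B \<Longrightarrow> symmetric_op (A - B)"
  by (simp add: symmetric_op_def blinfun.bilinear_simps inner_diff)

lemma symmetric_op_scaleR: "symmetric_op A \<Longrightarrow> symmetric_op (c *\<^sub>R A)"
  by (simp add: symmetric_op_def blinfun.bilinear_simps)

lemma symmetric_op_compose:
  "symmetric_op A \<Longrightarrow> symmetric_op B \<Longrightarrow> A o\<^sub>L B = B o\<^sub>L A \<Longrightarrow> symmetric_op (A o\<^sub>L B)"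
  unfolding symmetric_op_def by (metis blinfun_apply_blinfun_compose)

lemma symmetric_op_congruence:
  "symmetric_op A \<Longrightarrow> symmetric_op B \<Longrightarrow> symmetric_op (B o\<^sub>L A o\<^sub>L B)"
  by (simp add: symmetric_op_def)

lemma symmetric_op_poly_op: "symmetric_op A \<Longrightarrow> symmetric_op (poly_op p A)"
proof (induction p)
  case (pCons a p)
  have "A o\<^sub>L poly_op p A = poly_op p A o\<^sub>L A"
    by (rule poly_op_intertwine[symmetric]) simp
  with pCons show ?case
    by (auto simp: poly_op_pCons intro!: symmetric_op_add symmetric_op_scaleR symmetric_op_compose)
qed simp

text \<open>The quadratic polynomial t \<mapsto> <x + t y, A (x + t y)> has no negative value. It is
  evaluated at its minimum or, if it is affine and not constant, at the point where it would be
  -1.\<close>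

lemma positive_Cauchy_Schwarz:
  assumes "symmetric_op A" and pos: "\<And>x. 0 \<le> inner x (A x)"
  shows "(inner x (A y))\<^sup>2 \<le> inner x (A x) * inner y (A y)"
proof -
  let ?a = "inner y (A y)" and ?b = "inner x (A y)" and ?c = "inner x (A x)"
  have *: "0 \<le> ?c + 2 * t * ?b + t\<^sup>2 * ?a" for t
    using pos[of "x + t *\<^sub>R y"] symmetric_opD[OF assms(1), of y x]
    by (simp add: blinfun.bilinear_simps inner_add power2_eq_square inner_commute algebra_simps)
  show ?thesis
  proof (cases "?a = 0")
    case True
    have "?b = 0"
    proof (rule ccontr)
      assume "?b \<noteq> 0"
      then show False using *[of "- (?c + 1) / (2 * ?b)"] True by (simp add: field_simps)
    qed
    with True show ?thesis by simp
  next
    case False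
    with pos[of y] have "?a > 0" by simp
    then show ?thesis using *[of "- ?b / ?a"] by (simp add: field_simps power2_eq_square)
  qed
qed

text \<open>Polarization and the parallelogram law turn the bound on the form into 2 <T x, y> \<le>
  M (|x|^2 + |y|^2). The best \<open>y\<close> is the multiple of \<open>T x\<close> that has the
  norm of \<open>x\<close>.\<close>

lemma norm_le_of_op_between:
  assumes T: "op_between (- M) T M" and "0 \<le> M"
  shows "norm T \<le> M"
proof (rule norm_blinfun_bound[OF assms(2)])
  fix x
  have *: "2 * inner (T x) y \<le> M * (inner x x + inner y y)" for y
  proof -
    have "inner (x + y) (T (x + y)) - inner (x - y) (T (x - y)) = 4 * inner (T x) y"
      using symmetric_opD[OF op_betweenD(1)[OF T], of x y]
      by (simp add: blinfun.bilinear_simps inner_add inner_diff inner_commute)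
    moreover have "M * inner (x + y) (x + y) + M * inner (x - y) (x - y)
        = 2 * M * (inner x x + inner y y)"
      by (simp add: inner_add inner_diff inner_commute algebra_simps)
    ultimately show ?thesis
      using op_betweenD(3)[OF T, of "x + y"] op_betweenD(2)[OF T, of "x - y"] by simp
  qed
  show "norm (T x) \<le> M * norm x"
  proof (cases "T x = 0")
    case False
    define y where "y = (norm x / norm (T x)) *\<^sub>R T x"
    have "inner y y = inner x x"
      using False unfolding y_def by (simp add: dot_square_norm power2_eq_square)
    moreover have "inner (T x) y = norm x * norm (T x)"
      using False unfolding y_def by (simp add: dot_square_norm power2_eq_square)
    ultimately have "2 * (norm x * norm (T x)) \<le> 2 * (M * (norm x)\<^sup>2)"
      using *[of y] by (simp add: dot_square_norm)
    then have "norm x * norm (T x) \<le> norm x * (M * norm x)" 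
      by (simp add: power2_eq_square algebra_simps)
    moreover have "norm x > 0" using False by (auto simp: blinfun.bilinear_simps)
    ultimately show ?thesis by simp
  qed (use assms(2) in simp)
qed

lemma op_between_norm:
  assumes "symmetric_op A" shows "op_between (- norm A) A (norm A)"
  unfolding op_between_def
proof (intro conjI allI assms)
  fix x
  have "\<bar>inner x (A x)\<bar> \<le> norm x * (norm A * norm x)"
    by (meson Cauchy_Schwarz_ineq2 mult_left_mono norm_blinfun norm_ge_zero order_trans)
  then have "\<bar>inner x (A x)\<bar> \<le> norm A * inner x x"
    by (simp add: dot_square_norm power2_eq_square algebra_simps)
  then show "- norm A * inner x x \<le> inner x (A x)" "inner x (A x) \<le> norm A * inner x x" by auto
qed

text \<open>The Cauchy-Schwarz inequality for the form of \<open>T\<close> is applied to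
  \<open>T x\<close> and \<open>x\<close>, and a factor |T x|^2 is cancelled. In particular <x, T x>
  = 0 forces T x = 0.\<close>

lemma norm_apply_le_of_positive:
  assumes "op_between 0 T M" "0 \<le> M"
  shows "(norm (T x))\<^sup>2 \<le> M * inner x (T x)"
proof -
  have T: "symmetric_op T" "\<And>x. 0 \<le> inner x (T x)"
    using op_betweenD[OF assms(1)] by auto
  have "(inner (T x) (T x))\<^sup>2 \<le> inner (T x) (T (T x)) * inner x (T x)"
    by (rule positive_Cauchy_Schwarz[OF T])
  also have "\<dots> \<le> (M * inner (T x) (T x)) * inner x (T x)"
    by (intro mult_right_mono op_betweenD(3)[OF assms(1)] T)
  finally have "inner (T x) (T x) * inner (T x) (T x) \<le> inner (T x) (T x) * (M * inner x (T x))"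
    by (simp add: power2_eq_square algebra_simps)
  then have "inner (T x) (T x) \<le> M * inner x (T x)"
    using assms(2) T(2)[of x] by (cases "inner (T x) (T x) = 0") auto
  then show ?thesis by (simp add: dot_square_norm)
qed

section \<open>Invertibility\<close>

lemma is_inverse_op_unique:
  assumes "is_inverse_op A B" "is_inverse_op A C" shows "B = C"
  using assms unfolding is_inverse_op_def by (metis blinfun_compose_assoc blinfun_compose_id)

lemma inverse_op_eqI: "is_inverse_op A B \<Longrightarrow> inverse_op A = B"
  unfolding inverse_op_def by (rule the_equality) (auto dest: is_inverse_op_unique)

lemma is_inverse_op_compose:
  assumes "is_inverse_op A A'" "is_inverse_op B B'"
  shows "is_inverse_op (A o\<^sub>L B) (B' o\<^sub>L A')"
  using assms unfolding is_inverse_op_def by (metis blinfun_compose_assoc blinfun_compose_id(1))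

lemma invertible_op_compose: "invertible_op A \<Longrightarrow> invertible_op B \<Longrightarrow> invertible_op (A o\<^sub>L B)"
  unfolding invertible_op_def using is_inverse_op_compose by blast

lemma invertible_op_scaleR:
  assumes "c \<noteq> 0" shows "invertible_op (c *\<^sub>R id_blinfun)"
  unfolding invertible_op_def is_inverse_op_def
  by (rule exI[of _ "(1/c) *\<^sub>R id_blinfun"])
    (use assms in \<open>auto intro!: blinfun_eqI simp: blinfun.bilinear_simps\<close>)

lemma coercive_bound:
  assumes "\<And>x. c * inner x x \<le> inner x (T x)"
  shows "c * norm x \<le> norm (T x)"
proof (cases "x = 0")
  case False
  have "c * (norm x * norm x) \<le> norm x * norm (T x)"
    using assms[of x] norm_cauchy_schwarz[of x "T x"] by (simp add: dot_square_norm power2_eq_square)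
  with False show ?thesis by (simp add: algebra_simps)
qed simp

text \<open>Solving \<open>T x = y\<close> amounts to finding a fixed point of \<open>x \<mapsto> x - (T x - y) / M\<close>,
  which is a contraction when \<open>M\<close> bounds \<open>T\<close> from above.\<close>

lemma invertible_op_coercive:
  fixes T :: "'a::{real_inner,banach} \<Rightarrow>\<^sub>L 'a"
  assumes T: "symmetric_op T" and "0 < c" and c: "\<And>x. c * inner x x \<le> inner x (T x)"
  shows "invertible_op T"
proof -
  define M where "M = norm T + c"
  have M: "c \<le> M" "0 < M" using \<open>0 < c\<close> by (auto simp: M_def add_nonneg_pos)
  define k where "k = 1 - c / M"
  have k: "0 \<le> k" "k < 1" using M \<open>0 < c\<close> by (auto simp: k_def field_simps)
  define S where "S = id_blinfun - (1/M) *\<^sub>R T"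
  have S_apply: "S x = x - (1/M) *\<^sub>R T x" for x by (simp add: S_def blinfun.bilinear_simps)
  have "op_between (- k) S k"
    unfolding op_between_def
  proof (intro conjI allI)
    show "symmetric_op S" using T by (simp add: S_def symmetric_op_diff symmetric_op_scaleR)
    fix x
    have "inner x (T x) \<le> M * inner x x"
      using op_betweenD(3)[OF op_between_norm[OF T], of x] \<open>0 < c\<close>
      by (simp add: M_def distrib_right add_increasing2)
    then have "inner x (T x) / M \<le> inner x x" using M by (simp add: field_simps)
    moreover have "c / M * inner x x \<le> inner x (T x) / M"
      using c[of x] M by (simp add: field_simps)
    moreover have "0 \<le> k * inner x x" using k by simp
    ultimately show "- k * inner x x \<le> inner x (S x)" "inner x (S x) \<le> k * inner x x"
      by (auto simp: S_apply inner_diff k_def algebra_simps)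
  qed
  then have normS: "norm S \<le> k" using k by (intro norm_le_of_op_between)
  have ex: "\<exists>x. T x = y" for y
  proof -
    have "\<exists>!x\<in>UNIV. (x - (1/M) *\<^sub>R (T x - y)) = x"
    proof (rule Banach_fix)
      show "complete (UNIV :: 'a set)" by (rule complete_UNIV)
      fix u v :: 'a
      have "dist (u - (1/M) *\<^sub>R (T u - y)) (v - (1/M) *\<^sub>R (T v - y)) = norm (S (u - v))"
        by (simp add: dist_norm S_apply blinfun.bilinear_simps algebra_simps)
      also have "\<dots> \<le> k * dist u v"
        using norm_blinfun[of S "u - v"] normS
        by (metis dist_norm mult_right_mono norm_ge_zero order_trans)
      finally show "dist (u - (1/M) *\<^sub>R (T u - y)) (v - (1/M) *\<^sub>R (T v - y)) \<le> k * dist u v" .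
    qed (use k in auto)
    then show ?thesis using M by auto
  qed
  have bound: "c * norm x \<le> norm (T x)" for x by (rule coercive_bound[OF c])
  have inj: "x = y" if "T x = T y" for x y
  proof -
    have "c * norm (x - y) \<le> 0" using bound[of "x - y"] that by (simp add: blinfun.bilinear_simps)
    with \<open>0 < c\<close> show ?thesis by (simp add: mult_le_0_iff)
  qed
  define g where "g y = (SOME x. T x = y)" for y
  have g: "T (g y) = y" for y
    unfolding g_def by (rule someI_ex[OF ex])
  have g': "g (T x) = x" for x by (rule inj) (rule g)
  have bl: "bounded_linear g"
  proof (rule bounded_linear_intro)
    show "norm (g x) \<le> norm x * (1 / c)" for x
      using bound[of "g x"] g \<open>0 < c\<close> by (simp add: field_simps)
    show "g (x + y) = g x + g y" for x y by (rule inj) (simp add: g blinfun.bilinear_simps)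
    show "g (r *\<^sub>R x) = r *\<^sub>R g x" for r x by (rule inj) (simp add: g blinfun.bilinear_simps)
  qed
  show ?thesis
    unfolding invertible_op_def is_inverse_op_def
    by (rule exI[of _ "Blinfun g"])
      (auto intro!: blinfun_eqI simp: bounded_linear_Blinfun_apply[OF bl] g g')
qed

text \<open>The inverse gives |x| \<le> K |A x|, and positivity gives |A x|^2 \<le> N <x, A x>. So a
  positive operator that is invertible falls under the same coercive calculus as a regularized
  one.\<close>

lemma invertible_op_lower_bound:
  fixes A :: "'a::real_inner \<Rightarrow>\<^sub>L 'a"
  assumes A: "op_between 0 A M" and inv: "invertible_op A"
  shows "\<exists>c>0. op_between c A M"
proof -
  obtain B where "B o\<^sub>L A = id_blinfun"
    using inv by (auto simp: invertible_op_def is_inverse_op_def)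
  then have B: "B (A x) = x" for x by (metis blinfun_apply_blinfun_compose blinfun_apply_id_blinfun id_apply)
  define K where "K = norm B + 1"
  have K: "0 < K" by (simp add: K_def add_nonneg_pos)
  have K2: "norm x \<le> K * norm (A x)" for x
    using norm_blinfun[of B "A x"] B[of x] norm_ge_zero[of "A x"]  by (simp add: K_def distrib_right add_increasing2)
  define N where "N = max M 1"
  have N: "0 < N" by (simp add: N_def)
  have A': "op_between 0 A N" unfolding op_between_def
  proof (intro conjI allI)
    fix x show "inner x (A x) \<le> N * inner x x"
      using op_betweenD(3)[OF A, of x] mult_right_mono[of M N "inner x x"] by (simp add: N_def)
  qed (use op_betweenD[OF A] in auto)
  have "1 / (K\<^sup>2 * N) * inner x x \<le> inner x (A x)" for x
  proof -
    have "inner x x \<le> K\<^sup>2 * (norm (A x))\<^sup>2"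
      using power_mono[OF K2[of x], of 2] by (simp add: dot_square_norm power_mult_distrib)
    also have "\<dots> \<le> K\<^sup>2 * (N * inner x (A x))"
      using norm_apply_le_of_positive[OF A', of x] N by (intro mult_left_mono) auto
    finally show ?thesis using K N by (simp add: field_simps)
  qed
  then show ?thesis using K N op_betweenD[OF A]
    by (intro exI[of _ "1 / (K\<^sup>2 * N)"]) (auto simp: op_between_def)
qed

section \<open>The spectral bound for polynomials\<close>

definition real_spectrum :: "('a::real_normed_vector \<Rightarrow>\<^sub>L 'a) \<Rightarrow> real set" where
  "real_spectrum A = {t. \<not> invertible_op (A - t *\<^sub>R id_blinfun)}"

lemma vimage_op_spectrum: "complex_of_real -` op_spectrum A = real_spectrum A"
proof -
  have "Blinfun ((*\<^sub>C) (complex_of_real t)) = t *\<^sub>R (id_blinfun :: 'a \<Rightarrow>\<^sub>L 'a)" for t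
    unfolding scaleR_scaleC[symmetric]
    by (rule blinfun_eqI) (simp add: bounded_linear_Blinfun_apply bounded_linear_scaleR_right
        blinfun.bilinear_simps)
  then show ?thesis by (auto simp: op_spectrum_def real_spectrum_def)
qed

lemma real_spectrum_subset:
  fixes A :: "'a::{real_inner,banach} \<Rightarrow>\<^sub>L 'a"
  assumes A: "op_between m A M"
  shows "real_spectrum A \<subseteq> {m..M}"
proof
  fix t assume t: "t \<in> real_spectrum A"
  note sym = op_betweenD(1)[OF A]
  have "m \<le> t"
  proof (rule ccontr)
    assume "\<not> m \<le> t"
    then have "invertible_op (A - t *\<^sub>R id_blinfun)"
      using op_betweenD(2)[OF A]
      by (intro invertible_op_coercive[of _ "m - t"] symmetric_op_diff symmetric_op_scaleR sym)
        (auto simp: blinfun.bilinear_simps inner_diff algebra_simps)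
    with t show False by (simp add: real_spectrum_def)
  qed
  moreover have "t \<le> M"
  proof (rule ccontr)
    assume "\<not> t \<le> M"
    then have "invertible_op (t *\<^sub>R id_blinfun - A)"
      using op_betweenD(3)[OF A]
      by (intro invertible_op_coercive[of _ "t - M"] symmetric_op_diff symmetric_op_scaleR sym)
        (auto simp: blinfun.bilinear_simps inner_diff algebra_simps)
    then have "invertible_op (((-1) *\<^sub>R id_blinfun) o\<^sub>L (t *\<^sub>R id_blinfun - A))"
      by (intro invertible_op_compose invertible_op_scaleR) auto
    moreover have "((-1) *\<^sub>R id_blinfun) o\<^sub>L (t *\<^sub>R id_blinfun - A) = A - t *\<^sub>R id_blinfun"
      by (rule blinfun_eqI) (simp add: blinfun.bilinear_simps)
    ultimately show False using t by (simp add: real_spectrum_def)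
  qed
  ultimately show "t \<in> {m..M}" by simp
qed

lemma nontrivial_ex_nonzero:
  assumes "(id_blinfun :: 'a::real_normed_vector \<Rightarrow>\<^sub>L 'a) \<noteq> 0"
  shows "\<exists>x::'a. x \<noteq> 0"
proof (rule ccontr)
  assume "\<nexists>x::'a. x \<noteq> 0"
  then have "blinfun_apply (id_blinfun :: 'a \<Rightarrow>\<^sub>L 'a) x = blinfun_apply 0 x" for x by auto
  with assms show False using blinfun_eqI by blast
qed

text \<open>Otherwise T^2 - N^2 with N = |T| has a bounded inverse \<open>R\<close>. Expanding |T^2
  x - N^2 x|^2 and using |T^2 x| \<le> N |T x| gives, for N \<noteq> 0, |T x|^2 \<le> (N^2 - d)
  |x|^2 with a fixed d > 0, against the definition of the norm. On the zero space all spectra are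
  empty, hence the assumption \<open>nontriv\<close>.\<close>

lemma norm_in_real_spectrum:
  fixes T :: "'a::{real_inner,banach} \<Rightarrow>\<^sub>L 'a"
  assumes T: "symmetric_op T" and nontriv: "(id_blinfun :: 'a \<Rightarrow>\<^sub>L 'a) \<noteq> 0"
  shows "norm T \<in> real_spectrum T \<or> - norm T \<in> real_spectrum T"
proof (rule ccontr)
  let ?N = "norm T"
  assume "\<not> ?thesis"
  then have "invertible_op ((T - ?N *\<^sub>R id_blinfun) o\<^sub>L (T - (- ?N) *\<^sub>R id_blinfun))"
    by (intro invertible_op_compose) (auto simp: real_spectrum_def)
  then obtain R where "R o\<^sub>L ((T - ?N *\<^sub>R id_blinfun) o\<^sub>L (T - (- ?N) *\<^sub>R id_blinfun)) = id_blinfun"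
    by (auto simp: invertible_op_def is_inverse_op_def)
  then have "R ((T - ?N *\<^sub>R id_blinfun) ((T - (- ?N) *\<^sub>R id_blinfun) x)) = x" for x
    by (metis blinfun_apply_blinfun_compose blinfun_apply_id_blinfun id_apply)
  then have R: "R (T (T x) - (?N)\<^sup>2 *\<^sub>R x) = x" for x
    by (simp add: blinfun.bilinear_simps algebra_simps power2_eq_square)
  define K where "K = norm R"
  have "K \<noteq> 0"
  proof
    assume "K = 0"
    then have "x = 0" for x :: 'a using R[of x] by (simp add: K_def)
    with nontriv show False using nontrivial_ex_nonzero by blast
  qed
  then have K: "0 < K" by (simp add: K_def)
  have step: "(norm x)\<^sup>2 \<le> K\<^sup>2 * (?N\<^sup>2 * (?N\<^sup>2 * (norm x)\<^sup>2 - (norm (T x))\<^sup>2))" for x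
  proof -
    have "(norm x)\<^sup>2 \<le> (K * norm (T (T x) - ?N\<^sup>2 *\<^sub>R x))\<^sup>2"
      using norm_blinfun[of R "T (T x) - ?N\<^sup>2 *\<^sub>R x"] R[of x] by (intro power_mono) (auto simp: K_def)
    also have "\<dots> = K\<^sup>2 * ((norm (T (T x)))\<^sup>2 - 2 * ?N\<^sup>2 * (norm (T x))\<^sup>2 + ?N^4 * (norm x)\<^sup>2)"
    proof -
      have "inner (T (T x)) x = inner (T x) (T x)" using symmetric_opD[OF T, of "T x" x] by simp
      then have "(norm (T (T x) - ?N\<^sup>2 *\<^sub>R x))\<^sup>2
          = (norm (T (T x)))\<^sup>2 - 2 * ?N\<^sup>2 * (norm (T x))\<^sup>2 + (?N\<^sup>2)\<^sup>2 * (norm x)\<^sup>2"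
        unfolding power2_norm_eq_inner
        by (simp add: inner_diff inner_commute algebra_simps power2_eq_square)
      then show ?thesis by (simp add: power_mult_distrib)
    qed
    also have "\<dots> \<le> K\<^sup>2 * (?N\<^sup>2 * (norm (T x))\<^sup>2 - 2 * ?N\<^sup>2 * (norm (T x))\<^sup>2 + ?N^4 * (norm x)\<^sup>2)"
      using power_mono[OF norm_blinfun[of T "T x"], of 2]
      by (intro mult_left_mono add_right_mono diff_right_mono) (auto simp: power_mult_distrib)
    finally show ?thesis by (simp add: algebra_simps power4_eq_xxxx power2_eq_square)
  qed
  show False
  proof (cases "?N = 0")
    case True
    then have "x = 0" for x :: 'a using step[of x] by simp
    with nontriv show False using nontrivial_ex_nonzero by blast
  next
    case False
    define d where "d = 1 / (K\<^sup>2 * ?N\<^sup>2)"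
    have d: "0 < d" using K False by (simp add: d_def)
    have sq: "(norm (T x))\<^sup>2 \<le> (?N\<^sup>2 - d) * (norm x)\<^sup>2" for x
      using step[of x] K False by (simp add: d_def field_simps)
    have nn: "0 \<le> ?N\<^sup>2 - d"
    proof -
      obtain x :: 'a where "x \<noteq> 0" using nontrivial_ex_nonzero[OF nontriv] by blast
      then have "0 < (norm x)\<^sup>2" by simp
      with sq[of x] show ?thesis
        by (meson zero_le_mult_iff order_trans zero_le_power2 not_less)
    qed
    have "norm T \<le> sqrt (?N\<^sup>2 - d)"
    proof (rule norm_blinfun_bound)
      fix x
      show "norm (T x) \<le> sqrt (?N\<^sup>2 - d) * norm x"
        using real_sqrt_le_mono[OF sq[of x]] by (simp add: real_sqrt_mult)
    qed (use nn in simp)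
    then have "?N\<^sup>2 \<le> ?N\<^sup>2 - d" using nn real_le_rsqrt power_mono[of ?N "sqrt (?N\<^sup>2 - d)" 2] by simp
    with d show False by simp
  qed
qed

text \<open>The quadratic is (t - z) (t - cnj z). Division by it leaves a remainder a + b t with
  real \<open>a\<close> and \<open>b\<close> that vanishes at \<open>z\<close>, so b Im z = 0 and
  then a = 0.\<close>

lemma nonreal_root_dvd:
  fixes q :: "real poly"
  assumes root: "poly (map_poly complex_of_real q) z = 0" and "Im z \<noteq> 0"
  shows "[:(Re z)\<^sup>2 + (Im z)\<^sup>2, - 2 * Re z, 1:] dvd q"
proof -
  let ?w = "[:(Re z)\<^sup>2 + (Im z)\<^sup>2, - 2 * Re z, 1:]"
  let ?c = "map_poly complex_of_real"
  have hom: "?c (a * b) = ?c a * ?c b" "?c (a + b) = ?c a + ?c b" for a b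
    by (auto intro!: poly_eqI simp: coeff_map_poly coeff_mult)
  have w: "poly (?c ?w) z = 0"
    by (simp add: map_poly_pCons complex_eq_iff power2_eq_square algebra_simps)
  have "q mod ?w = 0 \<or> degree (q mod ?w) < degree ?w" by (rule degree_mod_less) simp
  then have "degree (q mod ?w) \<le> 1" by auto
  define a b where "a = coeff (q mod ?w) 0" and "b = coeff (q mod ?w) 1"
  have ab: "q mod ?w = [:a, b:]"
  proof (rule poly_eqI)
    fix n show "coeff (q mod ?w) n = coeff [:a, b:] n"
      using \<open>degree (q mod ?w) \<le> 1\<close> coeff_eq_0[of "q mod ?w" n]
      by (cases n rule: nat.exhaust; cases "n = 1")
        (auto simp: a_def b_def coeff_pCons split: nat.split)
  qed
  have "?c q = ?c ?w * ?c (q div ?w) + ?c (q mod ?w)"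
    by (simp only: hom[symmetric] mult_div_mod_eq)
  then have "poly (?c q) z = poly (?c (q mod ?w)) z"
    by (simp only: poly_add poly_mult w mult_zero_left add_0)
  then have "complex_of_real a + z * complex_of_real b = 0"
    using root ab by (simp add: map_poly_pCons)
  then have "b = 0" "a = 0" using \<open>Im z \<noteq> 0\<close> by (auto simp: complex_eq_iff)
  then show ?thesis using ab by (simp add: mod_eq_0_iff_dvd)
qed

text \<open>Induction on the degree, splitting off the factor of a complex root z. For z not real
  this factor at \<open>A\<close> is (A - Re z)^2 + (Im z)^2, which is coercive and hence
  invertible; for real z it is invertible unless z is the point sought. The cofactor is then not
  invertible and has smaller degree.\<close>

lemma spectral_mapping_root:
  fixes A :: "'a::{real_inner,banach} \<Rightarrow>\<^sub>L 'a"
  assumes A: "symmetric_op A" and q: "\<not> invertible_op (poly_op q A)"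
  shows "\<exists>t\<in>real_spectrum A. poly q t = 0"
  using q
proof (induction "degree q" arbitrary: q rule: less_induct)
  case less
  have nontriv: "(id_blinfun :: 'a \<Rightarrow>\<^sub>L 'a) \<noteq> 0"
  proof
    assume 0: "(id_blinfun :: 'a \<Rightarrow>\<^sub>L 'a) = 0"
    then have "x = 0" for x :: 'a by (metis blinfun_apply_id_blinfun blinfun.zero_left id_apply)
    then have "is_inverse_op (poly_op q A) 0"
      unfolding is_inverse_op_def by (intro conjI blinfun_eqI) metis+
    with less.prems show False by (auto simp: invertible_op_def)
  qed
  show ?case
  proof (cases "degree q = 0")
    case True
    then obtain a where a: "q = [:a:]" by (rule degree_eq_zeroE)
    \<comment> \<open>The zero polynomial vanishes everywhere, so any point of the spectrum will do,
      and the spectrum is not empty.\<close>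
    with less.prems have "a = 0" using invertible_op_scaleR[of a] by auto
    then show ?thesis using a norm_in_real_spectrum[OF A nontriv] by auto
  next
    case False
    have "degree (map_poly complex_of_real q) \<noteq> 0" using False by (simp add: degree_map_poly)
    then obtain z where z: "poly (map_poly complex_of_real q) z = 0"
      using fundamental_theorem_of_algebra[of "map_poly complex_of_real q"]
      by (auto simp: constant_degree)
    have factor: "\<exists>t\<in>real_spectrum A. poly q t = 0"
      if "q = w * s" "invertible_op (poly_op w A)" "degree w \<noteq> 0" for w s
    proof -
      have "\<not> invertible_op (poly_op s A)"
        using less.prems that(1,2) by (auto simp: poly_op_mult intro: invertible_op_compose)
      moreover have "degree s < degree q"
        using that False by (cases "w = 0 \<or> s = 0") (auto simp: degree_mult_eq)
      ultimately show ?thesis using less.hyps that(1) by fastforce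
    qed
    show ?thesis
    proof (cases "Im z = 0")
      case True
      then have zr: "z = complex_of_real (Re z)" by (simp add: complex_eq_iff)
      have "complex_of_real (poly q (Re z)) = poly (map_poly complex_of_real q) (complex_of_real (Re z))"
        by (induction q) (auto simp: map_poly_pCons)
      then have root: "poly q (Re z) = 0" using z zr by simp
      then obtain s where s: "q = [:- Re z, 1:] * s" by (auto simp: poly_eq_0_iff_dvd elim: dvdE)
      have w: "poly_op [:- Re z, 1:] A = A - Re z *\<^sub>R id_blinfun"
        by (simp add: poly_op_pCons blinfun_compose.zero_right)
      show ?thesis
      proof (cases "invertible_op (A - Re z *\<^sub>R id_blinfun)")
        case True
        then show ?thesis using factor[OF s] w by simp
      next
        case False
        then show ?thesis using root by (auto simp: real_spectrum_def)
      qed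
    next
      case False
      let ?w = "[:(Re z)\<^sup>2 + (Im z)\<^sup>2, - 2 * Re z, 1:]"
      obtain s where s: "q = ?w * s" using nonreal_root_dvd[OF z False] by (rule dvdE)
      have w: "poly_op ?w A x = A (A x) - (2 * Re z) *\<^sub>R A x + ((Re z)\<^sup>2 + (Im z)\<^sup>2) *\<^sub>R x" for x
        by (simp add: poly_op_pCons blinfun.bilinear_simps algebra_simps)
      have "invertible_op (poly_op ?w A)"
      proof (rule invertible_op_coercive[of _ "(Im z)\<^sup>2"])
        fix x
        have "0 \<le> inner (A x - Re z *\<^sub>R x) (A x - Re z *\<^sub>R x)" by simp
        then show "(Im z)\<^sup>2 * inner x x \<le> inner x (poly_op ?w A x)"
          using symmetric_opD[OF A, of x "A x"] unfolding w
          by (simp add: inner_diff inner_add inner_commute algebra_simps power2_eq_square)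
      qed (use A False in \<open>auto intro: symmetric_op_poly_op\<close>)
      then show ?thesis using factor[OF s] by simp
    qed
  qed
qed

text \<open>The norm of the symmetric operator p(A) is |s| for some s in its spectrum, and the
  spectral mapping property for p - s shows that s is a value of p on the spectrum of
  \<open>A\<close>.\<close>

lemma norm_poly_op_le:
  fixes A :: "'a::{real_inner,banach} \<Rightarrow>\<^sub>L 'a"
  assumes A: "symmetric_op A" and "0 \<le> K" and K: "\<And>t. t \<in> real_spectrum A \<Longrightarrow> \<bar>poly p t\<bar> \<le> K"
  shows "norm (poly_op p A) \<le> K"
proof (cases "(id_blinfun :: 'a \<Rightarrow>\<^sub>L 'a) = 0")
  case True
  then have "poly_op p A = 0" by (metis blinfun_compose_id(2) blinfun_compose.zero_left)
  then show ?thesis using \<open>0 \<le> K\<close> by simp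
next
  case False
  obtain s where s: "s \<in> real_spectrum (poly_op p A)" "\<bar>s\<bar> = norm (poly_op p A)"
    using norm_in_real_spectrum[OF symmetric_op_poly_op[OF A] False, of p] by fastforce
  have "poly_op (p - [:s:]) A = poly_op p A - s *\<^sub>R id_blinfun" by (simp only: poly_op_diff poly_op_const)
  with s(1) obtain t where "t \<in> real_spectrum A" "poly (p - [:s:]) t = 0"
    using spectral_mapping_root[OF A, of "p - [:s:]"] by (auto simp: real_spectrum_def)
  then show ?thesis using K[of t] s(2) by simp
qed

section \<open>Continuous functional calculus\<close>

lemma Weierstrass_poly:
  fixes f :: "real \<Rightarrow> real"
  assumes "continuous_on {m..M} f" "0 < e"
  shows "\<exists>p. \<forall>t\<in>{m..M}. \<bar>poly p t - f t\<bar> < e"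
proof -
  obtain g where g: "real_polynomial_function g" "\<And>x. x \<in> {m..M} \<Longrightarrow> \<bar>f x - g x\<bar> < e"
    using Stone_Weierstrass_real_polynomial_function[OF compact_Icc assms] by blast
  obtain a n where an: "g = (\<lambda>x. \<Sum>i\<le>n. a i * x ^ i)"
    using g(1) by (auto simp: real_polynomial_function_iff_sum)
  have "poly (\<Sum>i\<le>n. monom (a i) i) t = g t" for t
    by (simp add: an poly_sum poly_monom)
  then show ?thesis using g(2) by (metis abs_minus_commute)
qed

text \<open>This is what makes the \<open>THE\<close> in \<open>fun_calc\<close> meaningful. The two
  sequences are comparable on the spectrum only, so a bound by values on an enclosing interval would
  not suffice.\<close>

lemma poly_op_limit_unique:
  fixes A :: "'a::chilbert_space \<Rightarrow>\<^sub>L 'a"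
  assumes A: "symmetric_op A"
    and p: "uniform_limit (real_spectrum A) (\<lambda>n. poly (p n)) f sequentially"
      "(\<lambda>n. poly_op (p n) A) \<longlonglongrightarrow> T"
    and q: "uniform_limit (real_spectrum A) (\<lambda>n. poly (q n)) f sequentially"
      "(\<lambda>n. poly_op (q n) A) \<longlonglongrightarrow> S"
  shows "S = T"
proof -
  have "(\<lambda>n. poly_op (p n) A - poly_op (q n) A) \<longlonglongrightarrow> 0"
  proof (rule LIMSEQ_I)
    fix e :: real assume "0 < e"
    then have "\<forall>\<^sub>F n in sequentially. \<forall>x\<in>real_spectrum A. dist (poly (p n - q n) x) 0 < e / 2"
      using uniform_limitD[OF uniform_limit_minus[OF p(1) q(1)], of "e / 2"] by simp
    then have "\<forall>\<^sub>F n in sequentially. norm (poly_op (p n - q n) A) \<le> e / 2"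
    proof eventually_elim
      case (elim n)
      show ?case
        using elim \<open>0 < e\<close> by (intro norm_poly_op_le A) (auto simp del: poly_diff intro: less_imp_le)
    qed
    then have "\<forall>\<^sub>F n in sequentially. norm (poly_op (p n) A - poly_op (q n) A - 0) < e"
      by eventually_elim (use \<open>0 < e\<close> in \<open>simp add: poly_op_diff\<close>)
    then show "\<exists>no. \<forall>n\<ge>no. norm (poly_op (p n) A - poly_op (q n) A - 0) < e"
      by (simp add: eventually_sequentially)
  qed
  from LIMSEQ_unique[OF this tendsto_diff[OF p(2) q(2)]] show ?thesis by simp
qed

lemma fun_calc_eqI:
  fixes A :: "'a::chilbert_space \<Rightarrow>\<^sub>L 'a"
  assumes A: "op_between m A M" 
    and p: "uniform_limit {m..M} (\<lambda>n. poly (p n)) f sequentially"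
      "(\<lambda>n. poly_op (p n) A) \<longlonglongrightarrow> T"
  shows "fun_calc f A = T"
proof -
  have p1: "uniform_limit (real_spectrum A) (\<lambda>n. poly (p n)) f sequentially"
    by (rule uniform_limit_on_subset[OF p(1) real_spectrum_subset[OF A]])
  show ?thesis
    unfolding fun_calc_def vimage_op_spectrum
    using p1 p(2) poly_op_limit_unique[OF op_betweenD(1)[OF A] p1 p(2)]
    by (intro the_equality) blast+
qed

lemma poly_op_tendsto_fun_calc:
  fixes A :: "'a::chilbert_space \<Rightarrow>\<^sub>L 'a"
  assumes A: "op_between m A M" and unif: "uniform_limit {m..M} (\<lambda>n. poly (p n)) f sequentially"
  shows "(\<lambda>n. poly_op (p n) A) \<longlonglongrightarrow> fun_calc f A"
proof -
  have "Cauchy (\<lambda>n. poly_op (p n) A)"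
  proof (rule metric_CauchyI)
    fix e :: real assume e: "0 < e"
    then obtain N where N: "\<And>n t. n \<ge> N \<Longrightarrow> t \<in> {m..M} \<Longrightarrow> dist (poly (p n) t) (f t) < e / 4"
      using uniform_limitD[OF unif, of "e / 4"] unfolding eventually_sequentially by fastforce
    have "dist (poly_op (p i) A) (poly_op (p j) A) < e" if "i \<ge> N" "j \<ge> N" for i j
    proof -
      have "norm (poly_op (p i - p j) A) \<le> e / 2"
      proof (rule norm_poly_op_le[OF op_betweenD(1)[OF A]])
        fix t assume "t \<in> real_spectrum A"
        then have "t \<in> {m..M}" using real_spectrum_subset[OF A] by blast
        from N[OF that(1) this] N[OF that(2) this]
        show "\<bar>poly (p i - p j) t\<bar> \<le> e / 2"
          by (simp only: dist_real_def poly_diff)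
      qed (use e in simp)
      then show ?thesis using e by (simp add: dist_norm poly_op_diff)
    qed
    then show "\<exists>N. \<forall>i\<ge>N. \<forall>j\<ge>N. dist (poly_op (p i) A) (poly_op (p j) A) < e" by blast
  qed
  then obtain T where T: "(\<lambda>n. poly_op (p n) A) \<longlonglongrightarrow> T"
    by (auto simp: Cauchy_convergent_iff convergent_def)
  then have "fun_calc f A = T" by (rule fun_calc_eqI[OF A unif])
  with T show ?thesis by simp
qed

lemma Weierstrass_poly_sequence:
  fixes f :: "real \<Rightarrow> real"
  assumes "continuous_on {m..M} f"
  obtains p where "uniform_limit {m..M} (\<lambda>n. poly (p n)) f sequentially"
proof -
  have "\<forall>n. \<exists>p. \<forall>t\<in>{m..M}. \<bar>poly p t - f t\<bar> < inverse (real (Suc n))"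
    by (intro allI Weierstrass_poly assms) simp
  then obtain p where p: "\<And>n t. t \<in> {m..M} \<Longrightarrow> \<bar>poly (p n) t - f t\<bar> < inverse (real (Suc n))"
    by metis
  have "uniform_limit {m..M} (\<lambda>n. poly (p n)) f sequentially"
  proof (rule uniform_limitI)
    fix e :: real assume "0 < e"
    then have "\<forall>\<^sub>F n in sequentially. inverse (real (Suc n)) < e"
      by (rule order_tendstoD(2)[OF LIMSEQ_inverse_real_of_nat])
    then show "\<forall>\<^sub>F n in sequentially. \<forall>x\<in>{m..M}. dist (poly (p n) x) (f x) < e"
    proof eventually_elim
      case (elim n)
      show ?case using p[of _ n] elim unfolding dist_real_def by (meson less_trans)
    qed
  qed
  with that show ?thesis by blast
qed

lemma fun_calc_limit:
  fixes A :: "'a::chilbert_space \<Rightarrow>\<^sub>L 'a"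
  assumes A: "op_between m A M" and f: "continuous_on {m..M} f"
  obtains p where "uniform_limit {m..M} (\<lambda>n. poly (p n)) f sequentially"
    "(\<lambda>n. poly_op (p n) A) \<longlonglongrightarrow> fun_calc f A"
  using Weierstrass_poly_sequence[OF f] poly_op_tendsto_fun_calc[OF A] by metis

context
  fixes A :: "'a::chilbert_space \<Rightarrow>\<^sub>L 'a" and m M :: real
  assumes A: "op_between m A M"
begin

lemma fun_calc_cong:
  assumes "continuous_on {m..M} f" "\<And>t. t \<in> {m..M} \<Longrightarrow> f t = g t"
  shows "fun_calc f A = fun_calc g A"
proof -
  obtain p where p: "uniform_limit {m..M} (\<lambda>n. poly (p n)) f sequentially"
    "(\<lambda>n. poly_op (p n) A) \<longlonglongrightarrow> fun_calc f A" by (rule fun_calc_limit[OF A assms(1)])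
  have "uniform_limit {m..M} (\<lambda>n. poly (p n)) g sequentially"
    using p(1) assms(2) uniform_limit_cong'[of "{m..M}" "\<lambda>n. poly (p n)" "\<lambda>n. poly (p n)" f g] by simp
  from fun_calc_eqI[OF A this p(2)] show ?thesis by simp
qed

lemma fun_calc_poly: "fun_calc (poly p) A = poly_op p A"
  by (rule fun_calc_eqI[OF A, of "\<lambda>_. p"]) (auto intro: uniform_limit_const)

lemma fun_calc_const: "fun_calc (\<lambda>t. c) A = c *\<^sub>R id_blinfun"
  using fun_calc_poly[of "[:c:]"] by (simp add: poly_pCons[abs_def])

lemma fun_calc_ident: "fun_calc (\<lambda>t. t) A = A"
  using fun_calc_poly[of "[:0, 1:]"] by (simp add: poly_op_pCons poly_pCons[abs_def])

lemma fun_calc_add: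
  assumes "continuous_on {m..M} f" "continuous_on {m..M} g"
  shows "fun_calc (\<lambda>t. f t + g t) A = fun_calc f A + fun_calc g A"
proof -
  obtain p q where "uniform_limit {m..M} (\<lambda>n. poly (p n)) f sequentially"
    "(\<lambda>n. poly_op (p n) A) \<longlonglongrightarrow> fun_calc f A"
    "uniform_limit {m..M} (\<lambda>n. poly (q n)) g sequentially"
    "(\<lambda>n. poly_op (q n) A) \<longlonglongrightarrow> fun_calc g A"
    using fun_calc_limit[OF A assms(1)] fun_calc_limit[OF A assms(2)] by metis
  then show ?thesis
    by (intro fun_calc_eqI[OF A, of "\<lambda>n. p n + q n"])
      (auto simp: poly_op_add poly_add[abs_def] intro!: tendsto_add uniform_limit_add)
qed

lemma fun_calc_mult:
  assumes "continuous_on {m..M} f" "continuous_on {m..M} g"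
  shows "fun_calc (\<lambda>t. f t * g t) A = fun_calc f A o\<^sub>L fun_calc g A"
proof -
  obtain p q where "uniform_limit {m..M} (\<lambda>n. poly (p n)) f sequentially"
    "(\<lambda>n. poly_op (p n) A) \<longlonglongrightarrow> fun_calc f A"
    "uniform_limit {m..M} (\<lambda>n. poly (q n)) g sequentially"
    "(\<lambda>n. poly_op (q n) A) \<longlonglongrightarrow> fun_calc g A"
    using fun_calc_limit[OF A assms(1)] fun_calc_limit[OF A assms(2)] by metis
  moreover have "bounded (f ` {m..M})" "bounded (g ` {m..M})"
    using assms by (auto intro!: compact_imp_bounded compact_continuous_image)
  ultimately show ?thesis
    by (intro fun_calc_eqI[OF A, of "\<lambda>n. p n * q n"])
      (auto simp: poly_op_mult poly_mult[abs_def] intro!: uniform_lim_mult blinfun_compose.tendsto)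
qed

lemma fun_calc_scaleR:
  assumes "continuous_on {m..M} f"
  shows "fun_calc (\<lambda>t. c * f t) A = c *\<^sub>R fun_calc f A"
  using fun_calc_mult[OF continuous_on_const[of _ c] assms]
  by (simp add: fun_calc_const blinfun_compose.scaleR_left)

lemma fun_calc_diff:
  assumes "continuous_on {m..M} f" "continuous_on {m..M} g"
  shows "fun_calc (\<lambda>t. f t - g t) A = fun_calc f A - fun_calc g A"
  using fun_calc_add[OF assms(1) continuous_on_mult[OF continuous_on_const[of _ "-1"] assms(2)]]
    fun_calc_scaleR[OF assms(2), of "-1"] by simp

lemma symmetric_op_fun_calc:
  assumes "continuous_on {m..M} f" shows "symmetric_op (fun_calc f A)"
proof -
  obtain p where p: "(\<lambda>n. poly_op (p n) A) \<longlonglongrightarrow> fun_calc f A" by (rule fun_calc_limit[OF A assms])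
  show ?thesis unfolding symmetric_op_def
  proof (intro allI)
    fix x y
    have "(\<lambda>n. inner (poly_op (p n) A x) y) \<longlonglongrightarrow> inner (fun_calc f A x) y"
      by (intro tendsto_intros p)
    moreover have "inner (poly_op (p n) A x) y = inner x (poly_op (p n) A y)" for n
      using symmetric_op_poly_op[OF op_betweenD(1)[OF A]] by (rule symmetric_opD)
    moreover have "(\<lambda>n. inner x (poly_op (p n) A y)) \<longlonglongrightarrow> inner x (fun_calc f A y)"
      by (intro tendsto_intros p)
    ultimately show "inner (fun_calc f A x) y = inner x (fun_calc f A y)"
      by (simp add: LIMSEQ_unique)
  qed
qed

text \<open>f(A) is the square of the symmetric operator (sqrt f)(A). Monotonicity and the norm
  bound for f(A) follow from this.\<close>

lemma fun_calc_nonneg: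
  assumes f: "continuous_on {m..M} f" "\<And>t. t \<in> {m..M} \<Longrightarrow> 0 \<le> f t"
  shows "0 \<le> inner x (fun_calc f A x)"
proof -
  have c: "continuous_on {m..M} (\<lambda>t. sqrt (f t))" by (intro continuous_intros f)
  have "fun_calc f A = fun_calc (\<lambda>t. sqrt (f t) * sqrt (f t)) A"
    by (rule fun_calc_cong) (use f in auto)
  then have "fun_calc f A = fun_calc (\<lambda>t. sqrt (f t)) A o\<^sub>L fun_calc (\<lambda>t. sqrt (f t)) A"
    using fun_calc_mult[OF c c] by simp
  then show ?thesis by (simp flip: symmetric_opD[OF symmetric_op_fun_calc[OF c], of x])
qed

lemma fun_calc_mono:
  assumes "continuous_on {m..M} f" "continuous_on {m..M} g" "\<And>t. t \<in> {m..M} \<Longrightarrow> f t \<le> g t"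
  shows "inner x (fun_calc f A x) \<le> inner x (fun_calc g A x)"
  using fun_calc_nonneg[of "\<lambda>t. g t - f t" x] assms
  by (simp add: fun_calc_diff continuous_on_diff blinfun.bilinear_simps inner_diff)

lemma op_between_fun_calc:
  assumes f: "continuous_on {m..M} f" and b: "\<And>t. t \<in> {m..M} \<Longrightarrow> a \<le> f t \<and> f t \<le> b"
  shows "op_between a (fun_calc f A) b"
  unfolding op_between_def
proof (intro conjI allI symmetric_op_fun_calc f)
  fix x
  show "a * inner x x \<le> inner x (fun_calc f A x)"
    using fun_calc_mono[OF continuous_on_const[of _ a] f, of x] b
    by (simp add: fun_calc_const blinfun.bilinear_simps)
  show "inner x (fun_calc f A x) \<le> b * inner x x"
    using fun_calc_mono[OF f continuous_on_const[of _ b], of x] b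
    by (simp add: fun_calc_const blinfun.bilinear_simps)
qed

lemma norm_fun_calc_le:
  assumes f: "continuous_on {m..M} f" "\<And>t. t \<in> {m..M} \<Longrightarrow> \<bar>f t\<bar> \<le> K" and "0 \<le> K"
  shows "norm (fun_calc f A) \<le> K"
  using assms(3) f(2) by (intro norm_le_of_op_between op_between_fun_calc f(1)) (fastforce simp: abs_le_iff)+

text \<open>For polynomials in place of f this is multiplicativity, by induction. The general case
  is a norm limit, for which \<open>{a..b}\<close> has to bound g(A) and to contain the values of
  g.\<close>

lemma fun_calc_compose:
  assumes g: "continuous_on {m..M} g" and gA: "op_between a (fun_calc g A) b"
    and f: "continuous_on {a..b} f" and gab: "\<And>t. t \<in> {m..M} \<Longrightarrow> g t \<in> {a..b}"
  shows "fun_calc f (fun_calc g A) = fun_calc (\<lambda>t. f (g t)) A"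
proof -
  obtain p where p: "uniform_limit {a..b} (\<lambda>n. poly (p n)) f sequentially"
    "(\<lambda>n. poly_op (p n) (fun_calc g A)) \<longlonglongrightarrow> fun_calc f (fun_calc g A)"
    by (rule fun_calc_limit[OF gA f])
  have pg: "continuous_on {m..M} (\<lambda>t. poly q (g t))" for q by (intro continuous_intros g)
  have fg: "continuous_on {m..M} (\<lambda>t. f (g t))"
    by (rule continuous_on_compose2[OF f g]) (use gab in auto)
  have poly: "poly_op q (fun_calc g A) = fun_calc (\<lambda>t. poly q (g t)) A" for q
  proof (induction q)
    case 0
    then show ?case using fun_calc_const[of 0] by simp
  next
    case (pCons c q)
    then show ?case
      by (simp add: poly_op_pCons fun_calc_add fun_calc_const fun_calc_mult g pg
          continuous_on_mult)
  qed
  have "(\<lambda>n. fun_calc (\<lambda>t. poly (p n) (g t)) A) \<longlonglongrightarrow> fun_calc (\<lambda>t. f (g t)) A"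
  proof (rule LIMSEQ_I)
    fix e :: real assume e: "0 < e"
    then have "\<forall>\<^sub>F n in sequentially. \<forall>x\<in>{a..b}. dist (poly (p n) x) (f x) < e / 2"
      using uniform_limitD[OF p(1), of "e / 2"] by simp
    then have "\<forall>\<^sub>F n in sequentially.
        norm (fun_calc (\<lambda>t. poly (p n) (g t)) A - fun_calc (\<lambda>t. f (g t)) A) < e"
    proof eventually_elim
      case (elim n)
      have "norm (fun_calc (\<lambda>t. poly (p n) (g t) - f (g t)) A) \<le> e / 2"
        using elim gab e by (intro norm_fun_calc_le continuous_on_diff pg fg)
          (auto simp: dist_real_def intro: less_imp_le)
      then show ?case using e by (simp add: fun_calc_diff pg fg)
    qed
    then show "\<exists>no. \<forall>n\<ge>no.
        norm (fun_calc (\<lambda>t. poly (p n) (g t)) A - fun_calc (\<lambda>t. f (g t)) A) < e"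
      by (simp add: eventually_sequentially)
  qed
  with p(2) show ?thesis by (simp add: poly LIMSEQ_unique)
qed

text \<open>On the kernel of \<open>A\<close> a polynomial p(A) multiplies by p(0), and this passes
  to the limit. It controls functions of H where H is not injective.\<close>

lemma fun_calc_kernel:
  assumes f: "continuous_on {m..M} f" and "0 \<in> {m..M}" and x: "A x = 0"
  shows "fun_calc f A x = f 0 *\<^sub>R x"
proof -
  obtain p where p: "uniform_limit {m..M} (\<lambda>n. poly (p n)) f sequentially"
    "(\<lambda>n. poly_op (p n) A) \<longlonglongrightarrow> fun_calc f A" by (rule fun_calc_limit[OF A f])
  have poly: "poly_op q A x = poly q 0 *\<^sub>R x" for q
  proof (cases q)
    case (pCons c r)
    have "A (poly_op r A x) = poly_op r A (A x)"
      using poly_op_intertwine[of A A A r] by (metis blinfun_apply_blinfun_compose)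
    then show ?thesis using pCons x by (simp add: poly_op_pCons blinfun.bilinear_simps)
  qed
  have "(\<lambda>n. poly (p n) 0 *\<^sub>R x) \<longlonglongrightarrow> f 0 *\<^sub>R x"
    by (intro tendsto_intros tendsto_uniform_limitI[OF p(1)] assms(2))
  moreover have "(\<lambda>n. poly_op (p n) A x) \<longlonglongrightarrow> fun_calc f A x"
    by (intro tendsto_intros p(2))
  ultimately show ?thesis by (simp add: poly LIMSEQ_unique)
qed

end

lemma fun_calc_intertwine:
  fixes A B S :: "'a::chilbert_space \<Rightarrow>\<^sub>L 'a"
  assumes A: "op_between m A M" and B: "op_between m B M"
    and f: "continuous_on {m..M} f" and S: "A o\<^sub>L S = S o\<^sub>L B"
  shows "fun_calc f A o\<^sub>L S = S o\<^sub>L fun_calc f B"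
proof -
  obtain p where p: "uniform_limit {m..M} (\<lambda>n. poly (p n)) f sequentially"
    by (rule Weierstrass_poly_sequence[OF f])
  have "(\<lambda>n. poly_op (p n) A o\<^sub>L S) \<longlonglongrightarrow> (fun_calc f A o\<^sub>L S)"
    by (intro blinfun_compose.tendsto poly_op_tendsto_fun_calc[OF A] p tendsto_const)
  moreover have "(\<lambda>n. S o\<^sub>L poly_op (p n) B) \<longlonglongrightarrow> (S o\<^sub>L fun_calc f B)"
    by (intro blinfun_compose.tendsto poly_op_tendsto_fun_calc[OF B] p tendsto_const)
  ultimately show ?thesis by (simp add: poly_op_intertwine[OF S] LIMSEQ_unique)
qed

section \<open>Powers of coercive operators\<close>

lemma op_between_mono:
  fixes A :: "'a::real_inner \<Rightarrow>\<^sub>L 'a"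
  assumes "op_between m A M" "m' \<le> m" "M \<le> M'" shows "op_between m' A M'"
  unfolding op_between_def
proof (intro conjI allI)
  fix x :: 'a
  have "m' * inner x x \<le> m * inner x x" "M * inner x x \<le> M' * inner x x"
    using assms(2,3) by (auto intro: mult_right_mono)
  with op_betweenD(2,3)[OF assms(1), of x]
  show "m' * inner x x \<le> inner x (A x)" "inner x (A x) \<le> M' * inner x x" by linarith+
qed (use op_betweenD(1)[OF assms(1)] in simp)

lemma op_between_norm_upper:
  assumes "op_between m A M" shows "op_between m A (norm A)"
  using op_betweenD(3)[OF op_between_norm[OF op_betweenD(1)[OF assms]]] op_betweenD[OF assms]
  by (auto simp: op_between_def)

lemma op_between_add:
  "op_between m A M \<Longrightarrow> op_between m' B M' \<Longrightarrow> op_between (m + m') (A + B) (M + M')"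
  unfolding op_between_def
  by (auto simp: symmetric_op_add blinfun.bilinear_simps inner_add distrib_right add_mono)

lemma op_between_scaled_id: "op_between c (c *\<^sub>R id_blinfun) c"
  by (auto simp: op_between_def symmetric_op_scaleR blinfun.bilinear_simps)

lemma inverse_op_unique_left:
  assumes "is_inverse_op A B" "A o\<^sub>L C = id_blinfun" shows "C = B"
  using assms unfolding is_inverse_op_def by (metis blinfun_compose_assoc blinfun_compose_id)

context
  fixes X :: "'a::chilbert_space \<Rightarrow>\<^sub>L 'a" and c M :: real
  assumes X: "op_between c X M" and c: "0 < c"
begin

lemma op_powr_eq_fun_calc: "op_powr X s = fun_calc (\<lambda>t. t powr s) X"
  unfolding op_powr_def
  by (rule fun_calc_cong[OF X, symmetric]) (use c in \<open>auto intro!: continuous_intros\<close>)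

lemma continuous_on_powr_coercive: "continuous_on {c..M} (\<lambda>t. t powr s)"
  using c by (auto intro!: continuous_intros)

lemma symmetric_op_op_powr: "symmetric_op (op_powr X s)"
  unfolding op_powr_eq_fun_calc by (rule symmetric_op_fun_calc[OF X continuous_on_powr_coercive])

lemma op_powr_add: "op_powr X (s + t) = op_powr X s o\<^sub>L op_powr X t"
  unfolding op_powr_eq_fun_calc powr_add
  by (rule fun_calc_mult[OF X continuous_on_powr_coercive continuous_on_powr_coercive])

lemma op_powr_0: "op_powr X 0 = id_blinfun"
  using fun_calc_const[OF X, of 1] by (simp add: op_powr_def)

lemma op_powr_1: "op_powr X 1 = X"
proof -
  have "fun_calc (\<lambda>t. t powr 1) X = fun_calc (\<lambda>t. t) X"
    by (rule fun_calc_cong[OF X continuous_on_powr_coercive]) (use c in auto)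
  then show ?thesis by (simp add: op_powr_eq_fun_calc fun_calc_ident[OF X])
qed

lemma op_powr_half:
  "op_powr X (1/2) o\<^sub>L op_powr X (1/2) = X"
  "op_powr X (1/2) o\<^sub>L op_powr X (- (1/2)) = id_blinfun"
  "op_powr X (- (1/2)) o\<^sub>L op_powr X (1/2) = id_blinfun"
  "op_powr X (- (1/2)) o\<^sub>L op_powr X (- (1/2)) = op_powr X (-1)"
  "op_powr X (-1) o\<^sub>L X = id_blinfun"
  "X o\<^sub>L op_powr X (-1) = id_blinfun"
  using op_powr_add[of "1/2" "1/2"] op_powr_add[of "1/2" "- (1/2)"] op_powr_add[of "- (1/2)" "1/2"]
    op_powr_add[of "- (1/2)" "- (1/2)"] op_powr_add[of "-1" 1] op_powr_add[of 1 "-1"]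
  by (simp_all add: op_powr_0 op_powr_1)

lemma op_powr_half_apply:
  "op_powr X (1/2) (op_powr X (1/2) x) = X x"
  "op_powr X (1/2) (op_powr X (- (1/2)) x) = x"
  "op_powr X (- (1/2)) (op_powr X (1/2) x) = x"
  "op_powr X (- (1/2)) (op_powr X (- (1/2)) x) = op_powr X (-1) x"
  "op_powr X (-1) (X x) = x"
  "X (op_powr X (-1) x) = x"
  using op_powr_half[THEN arg_cong[of _ _ "\<lambda>T. blinfun_apply T x"]] by simp_all

lemma inverse_op_coercive: "is_inverse_op X (op_powr X (-1))" "inverse_op X = op_powr X (-1)"
  using op_powr_half(5,6) by (auto simp: is_inverse_op_def intro!: inverse_op_eqI)

lemma op_between_inverse: "op_between (1 / M) (op_powr X (-1)) (1 / c)"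
  unfolding op_powr_eq_fun_calc
  by (rule op_between_fun_calc[OF X continuous_on_powr_coercive])
    (use c in \<open>auto simp: powr_minus_divide intro!: divide_left_mono\<close>)

lemma op_powr_inverse:
  assumes "0 < M"
  shows "op_powr (op_powr X (-1)) s = op_powr X (- s)"
proof -
  have "continuous_on {1 / M..1 / c} (\<lambda>t. t powr s)"
    using assms c by (auto intro!: continuous_intros)
  then have "fun_calc (\<lambda>t. t powr s) (fun_calc (\<lambda>t. t powr -1) X) = fun_calc (\<lambda>t. (t powr -1) powr s) X"
    by (rule fun_calc_compose[OF X continuous_on_powr_coercive
          op_between_inverse[unfolded op_powr_eq_fun_calc]])
      (use c in \<open>auto simp: powr_minus_divide intro!: divide_left_mono\<close>)
  moreover have "op_powr (op_powr X (-1)) s = fun_calc (\<lambda>t. t powr s) (op_powr X (-1))"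
    unfolding op_powr_def[of "op_powr X (-1)"]
    by (rule fun_calc_cong[OF op_between_inverse, symmetric])
      (use assms c in \<open>auto intro!: continuous_intros\<close>)
  ultimately show ?thesis unfolding op_powr_eq_fun_calc powr_powr by simp
qed

end

section \<open>Operator means and their homogeneous form\<close>

text \<open>The operator perspective of f. For \<open>pw s\<close> it is the geometric mean, and as
  it is linear in suitable f, each expression of the theorem without outer inverse is a single
  \<open>op_mean\<close> on coercive operators.\<close>

definition op_mean ::
    "(real \<Rightarrow> real) \<Rightarrow> ('a::complex_inner \<Rightarrow>\<^sub>L 'a) \<Rightarrow> ('a \<Rightarrow>\<^sub>L 'a) \<Rightarrow> ('a \<Rightarrow>\<^sub>L 'a)" where
  "op_mean f X Y = op_powr X (1/2)
     o\<^sub>L fun_calc f (op_powr X (-1/2) o\<^sub>L Y o\<^sub>L op_powr X (-1/2)) o\<^sub>L op_powr X (1/2)"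

text \<open>Since X^(-1) \<ge> 1 / M, a lower bound of \<open>Y\<close> passes to the congruence
  with the factor 1 / M; coercivity of \<open>Y\<close> is thus preserved.\<close>

lemma op_between_congruence_inv_sqrt:
  fixes X Y :: "'a::chilbert_space \<Rightarrow>\<^sub>L 'a"
  assumes X: "op_between c X M" "0 < c" and "0 < M" and Y: "op_between y Y N" "0 \<le> y"
  shows "op_between (y / M) (op_powr X (-1/2) o\<^sub>L Y o\<^sub>L op_powr X (-1/2))
    (norm (op_powr X (-1/2) o\<^sub>L Y o\<^sub>L op_powr X (-1/2)))" (is "op_between _ ?T _")
proof -
  let ?R = "op_powr X (-1/2)"
  have R: "symmetric_op ?R" by (rule symmetric_op_op_powr[OF X])
  have sym: "symmetric_op ?T"
    by (intro symmetric_op_congruence R op_betweenD(1)[OF Y(1)])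
  have "y / M * inner x x \<le> inner x (?T x)" for x
  proof -
    have "y * (1 / M * inner x x) \<le> y * inner x (op_powr X (-1) x)"
      by (intro mult_left_mono Y op_betweenD(2)[OF op_between_inverse[OF X]])
    also have "inner x (op_powr X (-1) x) = inner (?R x) (?R x)"
      by (simp only: symmetric_opD[OF R]) (simp add: op_powr_half_apply[OF X])
    also have "y * inner (?R x) (?R x) \<le> inner (?R x) (Y (?R x))"
      by (rule op_betweenD(2)[OF Y(1)])
    also have "\<dots> = inner x (?T x)" by (simp only: symmetric_opD[OF R] blinfun_apply_blinfun_compose)
    finally show ?thesis by simp
  qed
  then show ?thesis
    using sym op_betweenD(3)[OF op_between_norm[OF sym]] by (auto simp: op_between_def)
qed

lemma op_mean_algebra:
  fixes X Y :: "'a::chilbert_space \<Rightarrow>\<^sub>L 'a"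
  assumes X: "op_between c X M" "0 < c" and Y: "op_between 0 Y N"
  shows "op_mean (\<lambda>t. 1) X Y = X" "op_mean (\<lambda>t. t) X Y = Y"
    "continuous_on {0..} f \<Longrightarrow> continuous_on {0..} g \<Longrightarrow>
      op_mean (\<lambda>t. f t + g t) X Y = op_mean f X Y + op_mean g X Y"
    "continuous_on {0..} f \<Longrightarrow> continuous_on {0..} g \<Longrightarrow>
      op_mean (\<lambda>t. f t - g t) X Y = op_mean f X Y - op_mean g X Y"
    "continuous_on {0..} f \<Longrightarrow> op_mean (\<lambda>t. a * f t) X Y = a *\<^sub>R op_mean f X Y"
proof -
  define T where "T = op_powr X (-1/2) o\<^sub>L Y o\<^sub>L op_powr X (-1/2)"
  have mean: "op_mean f X Y = op_powr X (1/2) o\<^sub>L fun_calc f T o\<^sub>L op_powr X (1/2)" for f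
    by (simp add: op_mean_def T_def)
  have X': "op_between c X (max M 1)" by (rule op_between_mono[OF X(1)]) auto
  have T: "op_between 0 T (norm T)"
    using op_between_congruence_inv_sqrt[OF X' X(2) _ Y] by (simp add: T_def)
  have sub: "continuous_on {0..norm T} f" if "continuous_on {0..} f" for f :: "real \<Rightarrow> real"
    using that by (rule continuous_on_subset) auto
  show "op_mean (\<lambda>t. 1) X Y = X"
    using fun_calc_const[OF T, of 1] by (simp add: mean op_powr_half[OF X])
  show "op_mean (\<lambda>t. t) X Y = Y"
    unfolding mean fun_calc_ident[OF T]
    by (rule blinfun_eqI) (simp add: T_def op_powr_half_apply[OF X])
  show "op_mean (\<lambda>t. f t + g t) X Y = op_mean f X Y + op_mean g X Y"
    if "continuous_on {0..} f" "continuous_on {0..} g"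
    by (simp add: mean fun_calc_add[OF T sub sub] that blinfun_compose.add_left
        blinfun_compose.add_right)
  show "op_mean (\<lambda>t. f t - g t) X Y = op_mean f X Y - op_mean g X Y"
    if "continuous_on {0..} f" "continuous_on {0..} g"
    by (simp add: mean fun_calc_diff[OF T sub sub] that blinfun_compose.diff_left
        blinfun_compose.diff_right)
  show "op_mean (\<lambda>t. a * f t) X Y = a *\<^sub>R op_mean f X Y" if "continuous_on {0..} f"
    by (simp add: mean fun_calc_scaleR[OF T sub] that blinfun_compose.scaleR_left
        blinfun_compose.scaleR_right)
qed

text \<open>With \<open>S = (X + Y)\<^sup>-\<^sup>1\<^sup>/\<^sup>2 X\<^sup>1\<^sup>/\<^sup>2\<close> one has \<open>P = S S\<^sup>*\<close> and \<open>S\<^sup>* S = (1 + T)\<^sup>-\<^sup>1\<close>,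
  so that \<open>S\<close> intertwines the functional calculi of \<open>(1 + T)\<^sup>-\<^sup>1\<close> and \<open>P\<close>.\<close>

lemma op_mean_homogeneous_aux:
  fixes X Y :: "'a::chilbert_space \<Rightarrow>\<^sub>L 'a"
  defines "T \<equiv> op_powr X (-1/2) o\<^sub>L Y o\<^sub>L op_powr X (-1/2)"
    and "P \<equiv> op_powr (X + Y) (-1/2) o\<^sub>L X o\<^sub>L op_powr (X + Y) (-1/2)"
  assumes X: "op_between c X M" "0 < c" and H: "op_between c (X + Y) N"
    and T: "op_between d T D" "0 \<le> d" and P: "op_between a P b"
    and h: "continuous_on {a..b} h" and range: "\<And>t. t \<in> {d..D} \<Longrightarrow> 1 / (1 + t) \<in> {a..b}"
    and f: "\<And>t. t \<in> {d..D} \<Longrightarrow> f t = h (1 / (1 + t))"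
  shows "op_mean f X Y
    = op_powr (X + Y) (1/2) o\<^sub>L fun_calc (\<lambda>x. x * h x) P o\<^sub>L op_powr (X + Y) (1/2)"
proof -
  note H = H X(2)
  let ?R = "op_powr X (1/2)" and ?Ri = "op_powr X (-1/2)"
  let ?K = "op_powr (X + Y) (1/2)"
  let ?Ki = "op_powr (X + Y) (- (1/2))"
  define g where "g t = 1 / (1 + t)" for t :: real
  define C where "C = ?R o\<^sub>L op_powr (X + Y) (-1) o\<^sub>L ?R"
  have g: "continuous_on {d..D} g" unfolding g_def using T(2) by (auto intro!: continuous_intros)
  have CT: "C ((id_blinfun + T) x) = x" for x
  proof -
    have "X (?Ri x) = ?R x"
      by (simp add: op_powr_half_apply[OF X] flip: op_powr_half_apply(1)[OF X])
    then have "?R ((id_blinfun + T) x) = (X + Y) (?Ri x)"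
      by (simp add: T_def blinfun.add_left blinfun.add_right op_powr_half_apply[OF X])
    then show ?thesis
      by (simp add: C_def op_powr_half_apply[OF X] op_powr_half_apply[OF H] del: blinfun.add_left)
  qed
  have gT: "(id_blinfun + T) (fun_calc g T x) = x" for x
  proof -
    have id: "fun_calc (\<lambda>t. 1 + t) T = id_blinfun + T"
      using fun_calc_add[OF T(1), of "\<lambda>t. 1" "\<lambda>t. t"]
      by (simp add: fun_calc_const[OF T(1)] fun_calc_ident[OF T(1)])
    have "fun_calc (\<lambda>t. (1 + t) * g t) T = fun_calc (\<lambda>t. 1) T"
      by (rule fun_calc_cong[OF T(1), symmetric]) (use T(2) in \<open>auto simp: g_def\<close>)
    then have "(id_blinfun + T) o\<^sub>L fun_calc g T = id_blinfun"
      by (subst id[symmetric], subst fun_calc_mult[OF T(1), symmetric])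
        (auto intro!: continuous_intros g simp: fun_calc_const[OF T(1)])
    then show ?thesis by (metis blinfun_apply_blinfun_compose blinfun_apply_id_blinfun id_apply)
  qed
  have C: "C = fun_calc g T"
  proof (rule blinfun_eqI)
    fix x show "C x = fun_calc g T x" using CT[of "fun_calc g T x"] gT[of x] by simp
  qed
  have Cb: "op_between a C b"
    unfolding C using range by (intro op_between_fun_calc[OF T(1) g]) (auto simp: g_def)
  have hC: "fun_calc f T = fun_calc h C"
  proof -
    have "fun_calc h C = fun_calc (\<lambda>t. h (g t)) T"
      unfolding C by (rule fun_calc_compose[OF T(1) g Cb[unfolded C] h]) (use range g_def in auto)
    also have "\<dots> = fun_calc f T"
      by (rule fun_calc_cong[OF T(1)])
        (use range in \<open>auto simp: f g_def intro!: continuous_on_compose2[OF h g[unfolded g_def]]\<close>)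
    finally show ?thesis by simp
  qed
  have PS: "P o\<^sub>L (?Ki o\<^sub>L ?R) = (?Ki o\<^sub>L ?R) o\<^sub>L C"
    by (rule blinfun_eqI)
      (simp add: P_def C_def op_powr_half_apply[OF H] flip: op_powr_half_apply(1)[OF X]
        op_powr_half_apply(4)[OF H])
  have hPS: "fun_calc h P (?Ki (?R x)) = ?Ki (?R (fun_calc h C x))" for x
    using fun_calc_intertwine[OF P Cb h PS] by (metis blinfun_apply_blinfun_compose)
  have hP: "fun_calc (\<lambda>x. x * h x) P = fun_calc h P o\<^sub>L P"
    using fun_calc_mult[OF P h continuous_on_id] by (simp add: fun_calc_ident[OF P] mult.commute)
  show ?thesis
  proof (rule blinfun_eqI)
    fix x
    \<comment> \<open>P H^(1/2) = H^(-1/2) X exhibits the intertwiner H^(-1/2) X^(1/2), through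
      which h(P) turns into h(C) = f(T). The outer H^(1/2) then cancels H^(-1/2).\<close>
    have "P (?K x) = ?Ki (?R (?R x))"
      by (simp add: P_def op_powr_half_apply[OF H] op_powr_half_apply[OF X])
    then have "fun_calc (\<lambda>x. x * h x) P (?K x) = ?Ki (?R (fun_calc h C (?R x)))"
      by (simp add: hP hPS)
    then show "op_mean f X Y x = (?K o\<^sub>L fun_calc (\<lambda>x. x * h x) P o\<^sub>L ?K) x"
      unfolding op_mean_def T_def[symmetric] hC by (simp add: op_powr_half_apply[OF H])
  qed
qed

text \<open>The variable \<open>x\<close> of \<open>\<phi>\<close> stands for \<open>X / (X + Y)\<close>; \<open>x = 1\<close> is attained only if \<open>Y\<close> is not
  invertible, and then \<open>f\<close> has to be continuous at \<open>0\<close>.\<close>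

lemma op_mean_homogeneous:
  fixes X Y :: "'a::chilbert_space \<Rightarrow>\<^sub>L 'a"
  defines "P \<equiv> op_powr (X + Y) (-1/2) o\<^sub>L X o\<^sub>L op_powr (X + Y) (-1/2)"
  assumes X: "op_between c X M" "0 < c" and Y: "op_between y Y N" "0 \<le> y"
    and f: "continuous_on (if y = 0 then {0..} else {0<..}) f"
    and \<phi>: "continuous_on {0..1} \<phi>"
    and \<phi>_eq: "\<And>x. 0 < x \<Longrightarrow> x \<le> 1 \<Longrightarrow> y = 0 \<or> x < 1 \<Longrightarrow> \<phi> x = x * f ((1 - x) / x)"
  shows "op_mean f X Y = op_powr (X + Y) (1/2) o\<^sub>L fun_calc \<phi> P o\<^sub>L op_powr (X + Y) (1/2)"
    and "op_between 0 P 1"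
proof -
  let ?T = "op_powr X (-1/2) o\<^sub>L Y o\<^sub>L op_powr X (-1/2)"
  let ?Ki = "op_powr (X + Y) (-1/2)"
  \<comment> \<open>\<open>N1\<close> bounds \<open>X + Y\<close> and is taken at least c and larger
    than y, so that c / N1 \<le> 1 and y / N1 < 1 are usable as bounds for \<open>P\<close> and for
    its complement.\<close>
  define M1 N1 where "M1 = max M 1" and "N1 = max (M + N) 1 + y + c"
  have M1: "0 < M1" "op_between c X M1"
    using op_between_mono[OF X(1), of c "max M 1"] by (auto simp: M1_def)
  have N1: "0 < N1" "y < N1" "c \<le> N1" using Y(2) X(2) by (auto simp: N1_def)
  have H: "op_between c (X + Y) N1"
    by (rule op_between_mono[OF op_between_add[OF X(1) Y(1)]]) (use Y X in \<open>auto simp: N1_def\<close>)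
  have T: "op_between (y / M1) ?T (norm ?T)"
    by (rule op_between_congruence_inv_sqrt[OF M1(2) X(2) M1(1) Y])
  have P0: "op_between (c / N1) P (norm P)"
    unfolding P_def
    using op_between_congruence_inv_sqrt[OF H X(2) N1(1) X(1)] X(2) by simp
  have P1: "op_between (y / N1) (?Ki o\<^sub>L Y o\<^sub>L ?Ki) (norm (?Ki o\<^sub>L Y o\<^sub>L ?Ki))"
    by (rule op_between_congruence_inv_sqrt[OF H X(2) N1(1) Y])
  \<comment> \<open>The two congruences add up to the identity, so a lower bound for that of
    \<open>Y\<close> is an upper bound for \<open>P\<close>.\<close>
  have sum: "P + (?Ki o\<^sub>L Y o\<^sub>L ?Ki) = id_blinfun"
  proof (rule blinfun_eqI)
    fix x
    have "(P + (?Ki o\<^sub>L Y o\<^sub>L ?Ki)) x = ?Ki ((X + Y) (?Ki x))"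
      by (simp add: P_def blinfun.bilinear_simps)
    also have "\<dots> = ?Ki (op_powr (X + Y) (1/2) (op_powr (X + Y) (1/2) (?Ki x)))"
      by (simp only: op_powr_half_apply(1)[OF H X(2)])
    also have "\<dots> = x" by (simp add: op_powr_half_apply(2,3)[OF H X(2)])
    finally show "(P + (?Ki o\<^sub>L Y o\<^sub>L ?Ki)) x = id_blinfun x" by simp
  qed
  have P: "op_between (c / N1) P (1 - y / N1)"
    unfolding op_between_def
  proof (intro conjI allI)
    fix x
    have "inner x (P x) + inner x ((?Ki o\<^sub>L Y o\<^sub>L ?Ki) x) = inner x x"
      using arg_cong[OF sum, of "\<lambda>S. inner x (blinfun_apply S x)"]
      by (simp only: blinfun.add_left inner_add_right blinfun_apply_id_blinfun id_apply)
    then show "inner x (P x) \<le> (1 - y / N1) * inner x x"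
      using op_betweenD(2)[OF P1, of x] unfolding left_diff_distrib mult_1 by linarith
  qed (use op_betweenD[OF P0] in auto)
  show "op_between 0 P 1"
    by (rule op_between_mono[OF P]) (use N1 Y X in auto)
  \<comment> \<open>One interval has to contain the bounds of \<open>P\<close> and the values 1 / (1
    + t) for t in the interval of \<open>?T\<close>. It avoids 0, and also 1 if y > 0, so x
    \<mapsto> f((1 - x) / x) is continuous on it.\<close>
  define a b where "a = min (c / N1) (1 / (1 + norm ?T))" and "b = max (1 - y / N1) (1 / (1 + y / M1))"
  have a: "0 < a" using X(2) N1 by (auto simp: a_def add_pos_nonneg)
  have b: "b \<le> 1" "0 < y \<Longrightarrow> b < 1" using Y(2) N1 M1 by (auto simp: b_def add_pos_nonneg)
  have Pab: "op_between a P b" by (rule op_between_mono[OF P]) (auto simp: a_def b_def)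
  have sub: "x \<in> {a..b} \<Longrightarrow> 0 < x \<and> x \<le> 1 \<and> (y = 0 \<or> x < 1)" for x
    using a b Y(2) by force
  have h: "continuous_on {a..b} (\<lambda>x. f ((1 - x) / x))"
    by (rule continuous_on_compose2[OF f]) (use sub in \<open>fastforce intro!: continuous_intros\<close>)+
  have "op_mean f X Y = op_powr (X + Y) (1/2)
      o\<^sub>L fun_calc (\<lambda>x. x * f ((1 - x) / x)) P o\<^sub>L op_powr (X + Y) (1/2)"
    unfolding P_def
  proof (rule op_mean_homogeneous_aux[OF X H T _ Pab[unfolded P_def] h])
    show "0 \<le> y / M1" using Y M1 by simp
    fix t assume t: "t \<in> {y / M1..norm ?T}"
    moreover have "0 \<le> y / M1" using Y M1 by simp
    ultimately have t0: "0 \<le> t" by simp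
    have "1 / (1 + norm ?T) \<le> 1 / (1 + t)" "1 / (1 + t) \<le> 1 / (1 + y / M1)"
      using t t0 \<open>0 \<le> y / M1\<close> by (auto intro!: divide_left_mono mult_pos_pos add_pos_nonneg)
    then show "1 / (1 + t) \<in> {a..b}" by (auto simp: a_def b_def)
    have "1 - 1 / (1 + t) = t / (1 + t)" using t0 by (simp add: field_simps)
    then show "f t = f ((1 - 1 / (1 + t)) / (1 / (1 + t)))" using t0 by simp
  qed
  also have "fun_calc (\<lambda>x. x * f ((1 - x) / x)) P = fun_calc \<phi> P"
    by (rule fun_calc_cong[OF Pab]) (use h sub \<phi>_eq in \<open>auto intro!: continuous_intros\<close>)
  finally show "op_mean f X Y
      = op_powr (X + Y) (1/2) o\<^sub>L fun_calc \<phi> P o\<^sub>L op_powr (X + Y) (1/2)" .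
qed

text \<open>With T = X^(-1/2) Y X^(-1/2), the corresponding operator of the inverses is X^(1/2)
  Y^(-1) X^(1/2) = T^(-1). Their mean is therefore X^(-1/2) f(T^(-1)) X^(-1/2), which is inverted
  factor by factor.\<close>

lemma inverse_op_mean:
  fixes X Y :: "'a::chilbert_space \<Rightarrow>\<^sub>L 'a"
  assumes X: "op_between c X M" "0 < c" and Y: "op_between y Y N" "0 < y"
    and f: "continuous_on {0<..} f" and f_pos: "\<And>t. 0 < t \<Longrightarrow> 0 < f t"
  shows "inverse_op (op_mean f (inverse_op X) (inverse_op Y)) = op_mean (\<lambda>t. 1 / f (1 / t)) X Y"
proof -
  let ?R = "op_powr X (1/2)" and ?Ri = "op_powr X (-1/2)"
  let ?T = "?Ri o\<^sub>L Y o\<^sub>L ?Ri" and ?T' = "?R o\<^sub>L op_powr Y (-1) o\<^sub>L ?R"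
  define M1 where "M1 = max M 1"
  have M1: "0 < M1" "op_between c X M1"
    using op_between_mono[OF X(1), of c "max M 1"] by (auto simp: M1_def)
  define d D where "d = y / M1" and "D = max (norm ?T) d"
  have d: "0 < d" "d \<le> D" using Y M1 by (auto simp: d_def D_def)
  have T: "op_between d ?T D"
    using op_between_mono[OF op_between_congruence_inv_sqrt[OF M1(2) X(2) M1(1) Y(1)]] Y(2)
    by (auto simp: d_def D_def)
  have "?T o\<^sub>L ?T' = id_blinfun"
    by (rule blinfun_eqI) (simp add: op_powr_half_apply[OF X] op_powr_half_apply(6)[OF Y])
  then have T': "?T' = op_powr ?T (-1)"
    by (rule inverse_op_unique_left[OF inverse_op_coercive(1)[OF T d(1)]])
  have T'_calc: "?T' = fun_calc (\<lambda>t. 1 / t) ?T"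
    unfolding T' op_powr_eq_fun_calc[OF T d(1)]
    by (rule fun_calc_cong[OF T continuous_on_powr_coercive[OF T d(1)]])
      (use d in \<open>auto simp: powr_minus_divide\<close>)
  have T'b: "op_between (1 / D) ?T' (1 / d)"
    unfolding T' by (rule op_between_inverse[OF T d(1)])
  have powr: "op_powr (inverse_op X) s = op_powr X (- s)" for s
    using op_powr_inverse[OF M1(2) X(2) M1(1)] by (simp add: inverse_op_coercive[OF X])
  have inv: "continuous_on {d..D} (\<lambda>t. 1 / t)" using d by (auto intro!: continuous_intros)
  have f': "continuous_on {d..D} (\<lambda>t. f (1 / t))"
    by (rule continuous_on_compose2[OF f inv]) (use d in auto)
  have f'_nz: "f (1 / t) \<noteq> 0" if "t \<in> {d..D}" for t
    using f_pos[of "1 / t"] that d by auto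
  have fT': "fun_calc f ?T' = fun_calc (\<lambda>t. f (1 / t)) ?T"
  proof -
    have "continuous_on {1 / D..1 / d} f"
      by (rule continuous_on_subset[OF f]) (use d in \<open>auto intro: less_le_trans[rotated]\<close>)
    then show ?thesis
      unfolding T'_calc using d
      by (intro fun_calc_compose[OF T inv T'b[unfolded T'_calc]]) (auto intro!: divide_left_mono)
  qed
  define F G where "F = fun_calc (\<lambda>t. f (1 / t)) ?T" and "G = fun_calc (\<lambda>t. 1 / f (1 / t)) ?T"
  have G_cont: "continuous_on {d..D} (\<lambda>t. 1 / f (1 / t))"
    using f'_nz by (intro continuous_intros f') auto
  have "fun_calc (\<lambda>t. 1) ?T = fun_calc (\<lambda>t. f (1 / t) * (1 / f (1 / t))) ?T"
    by (rule fun_calc_cong[OF T]) (use f'_nz in auto)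
  then have one: "fun_calc (\<lambda>t. f (1 / t) * (1 / f (1 / t))) ?T = id_blinfun"
    unfolding fun_calc_const[OF T] by simp
  have FG: "F o\<^sub>L G = id_blinfun" "G o\<^sub>L F = id_blinfun"
    using fun_calc_mult[OF T f' G_cont] fun_calc_mult[OF T G_cont f'] one
    unfolding F_def G_def mult.commute[of "1 / f (1 / _)"] by auto
  have FG': "F (G x) = x" "G (F x) = x" for x
    using FG by (metis blinfun_apply_blinfun_compose blinfun_apply_id_blinfun id_apply)+
  have "op_mean f (inverse_op X) (inverse_op Y) = ?Ri o\<^sub>L F o\<^sub>L ?Ri"
    using fT' by (simp add: op_mean_def F_def powr inverse_op_coercive[OF Y])
  moreover have "is_inverse_op (?Ri o\<^sub>L F o\<^sub>L ?Ri) (?R o\<^sub>L G o\<^sub>L ?R)"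
    unfolding is_inverse_op_def
    by (auto intro!: blinfun_eqI simp: op_powr_half_apply[OF X] FG')
  ultimately show ?thesis by (simp add: inverse_op_eqI op_mean_def G_def)
qed

section \<open>Strong limits\<close>

lemma tendsto_at_right_Cauchy:
  fixes v :: "real \<Rightarrow> 'b::complete_space"
  assumes "\<And>e. 0 < e \<Longrightarrow>
    \<exists>d0>0. \<forall>d d'. 0 < d \<and> d < d0 \<and> 0 < d' \<and> d' < d0 \<longrightarrow> dist (v d) (v d') < e"
  shows "\<exists>l. (v \<longlongrightarrow> l) (at_right 0)"
proof -
  have "cauchy_filter (filtermap v (at_right 0))"
    unfolding cauchy_filter_metric_filtermap
  proof (intro allI impI)
    fix e :: real assume "0 < e"
    then obtain d0 where "0 < d0"
      "\<forall>d d'. 0 < d \<and> d < d0 \<and> 0 < d' \<and> d' < d0 \<longrightarrow> dist (v d) (v d') < e"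
      using assms by blast
    then show "\<exists>P. eventually P (at_right 0) \<and> (\<forall>x y. P x \<and> P y \<longrightarrow> dist (v x) (v y) < e)"
      by (intro exI[of _ "\<lambda>d. 0 < d \<and> d < d0"]) (auto simp: eventually_at_right_field)
  qed
  then have "convergent_filter (filtermap v (at_right 0))"
    by (rule cauchy_filter_convergent)
  then show ?thesis by (auto simp: convergent_filter_iff filterlim_def)
qed

text \<open>As d decreases to 0, u increases to its supremum, and its increments dominate the
  squared increments of v, so v has the Cauchy property.\<close>

lemma tendsto_at_right_antitone:
  fixes v :: "real \<Rightarrow> 'b::complete_space"
  assumes dist: "\<And>d d'. 0 < d \<Longrightarrow> d \<le> d' \<Longrightarrow> (dist (v d) (v d'))\<^sup>2 \<le> u d - u d'"
    and U: "\<And>d. 0 < d \<Longrightarrow> u d \<le> U"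
  shows "\<exists>l. (v \<longlongrightarrow> l) (at_right 0)"
proof (rule tendsto_at_right_Cauchy)
  fix e :: real assume e: "0 < e"
  define s where "s = Sup (u ` {0<..})"
  have bdd: "bdd_above (u ` {0<..})" using U by (intro bdd_aboveI2[of _ _ U]) auto
  have "s - e\<^sup>2 < Sup (u ` {0<..})" using e by (simp add: s_def)
  then obtain d0 where d0: "0 < d0" "s - e\<^sup>2 < u d0"
    using less_cSup_iff[OF _ bdd] by fastforce
  have step: "dist (v d) (v d') < e" if "0 < d" "d \<le> d'" "d' < d0" for d d'
  proof -
    have "u d \<le> s" unfolding s_def using that by (intro cSup_upper bdd) auto
    moreover have "u d0 \<le> u d'"
      using dist[of d' d0] that zero_le_power2[of "dist (v d') (v d0)"] by linarith
    ultimately have "(dist (v d) (v d'))\<^sup>2 < e\<^sup>2" using dist[of d d'] that d0 by linarith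
    then show ?thesis using e by (simp add: power_less_imp_less_base)
  qed
  then have "dist (v d) (v d') < e" if "0 < d" "d < d0" "0 < d'" "d' < d0" for d d'
    using that step[of d d'] step[of d' d] by (cases "d \<le> d'") (auto simp: dist_commute)
  with d0 show "\<exists>d0>0. \<forall>d d'. 0 < d \<and> d < d0 \<and> 0 < d' \<and> d' < d0 \<longrightarrow> dist (v d) (v d') < e"
    by blast
qed

lemma norm_fun_calc_apply_sq:
  fixes A :: "'a::chilbert_space \<Rightarrow>\<^sub>L 'a"
  assumes A: "op_between m A M" and f: "continuous_on {m..M} f"
  shows "(norm (fun_calc f A y))\<^sup>2 = inner y (fun_calc (\<lambda>t. f t * f t) A y)"
  by (simp add: power2_norm_eq_inner symmetric_opD[OF symmetric_op_fun_calc[OF A f]]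
      fun_calc_mult[OF A f f])

text \<open>For 0 \<le> b \<le> a one has (a - b)^2 \<le> a^2 - b^2, so the squared norm of the
  vectors serves as the monotone quantity. A bound is asked for the single vector \<open>y\<close>
  only, because the operators themselves may blow up as d tends to 0.\<close>

lemma fun_calc_antitone_convergent:
  fixes A :: "'a::chilbert_space \<Rightarrow>\<^sub>L 'a" and F :: "real \<Rightarrow> real \<Rightarrow> real"
  assumes A: "op_between m A M" and F: "\<And>d. 0 < d \<Longrightarrow> continuous_on {m..M} (F d)"
    and anti: "\<And>d d' t. 0 < d \<Longrightarrow> d \<le> d' \<Longrightarrow> t \<in> {m..M} \<Longrightarrow> 0 \<le> F d' t \<and> F d' t \<le> F d t"
    and bound: "\<And>d. 0 < d \<Longrightarrow> norm (fun_calc (F d) A y) \<le> C"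
  shows "\<exists>l. ((\<lambda>d. fun_calc (F d) A y) \<longlongrightarrow> l) (at_right 0)"
proof (rule tendsto_at_right_antitone[where u = "\<lambda>d. (norm (fun_calc (F d) A y))\<^sup>2"])
  show "(norm (fun_calc (F d) A y))\<^sup>2 \<le> C\<^sup>2" if "0 < d" for d
    using bound[OF that] by (rule power_mono) simp
  fix d d' :: real assume d: "0 < d" "d \<le> d'"
  then have c: "continuous_on {m..M} (F d)" "continuous_on {m..M} (F d')" using F by auto
  have "(dist (fun_calc (F d) A y) (fun_calc (F d') A y))\<^sup>2
      = (norm (fun_calc (\<lambda>t. F d t - F d' t) A y))\<^sup>2"
    by (simp add: dist_norm fun_calc_diff[OF A c] blinfun.diff_left)
  also have "\<dots> = inner y (fun_calc (\<lambda>t. (F d t - F d' t) * (F d t - F d' t)) A y)"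
    by (rule norm_fun_calc_apply_sq[OF A]) (intro continuous_intros c)
  also have "\<dots> \<le> inner y (fun_calc (\<lambda>t. F d t * F d t - F d' t * F d' t) A y)"
  proof (rule fun_calc_mono[OF A])
    fix t assume "t \<in> {m..M}"
    then have "0 \<le> F d' t * (F d t - F d' t)" using anti[OF d, of t] by simp
    then show "(F d t - F d' t) * (F d t - F d' t) \<le> F d t * F d t - F d' t * F d' t"
      by (simp add: algebra_simps)
  qed (intro continuous_intros c)+
  also have "\<dots> = (norm (fun_calc (F d) A y))\<^sup>2 - (norm (fun_calc (F d') A y))\<^sup>2"
    by (simp add: norm_fun_calc_apply_sq[OF A] c fun_calc_diff[OF A] continuous_on_mult
        blinfun.diff_left inner_diff_right)
  finally show "(dist (fun_calc (F d) A y) (fun_calc (F d') A y))\<^sup>2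
      \<le> (norm (fun_calc (F d) A y))\<^sup>2 - (norm (fun_calc (F d') A y))\<^sup>2" .
qed

lemma strong_lim0_eqI:
  assumes "\<And>x. ((\<lambda>e. blinfun_apply (F e) x) \<longlongrightarrow> blinfun_apply T x) (at_right 0)"
  shows "strong_lim0 F = T"
  unfolding strong_lim0_def
proof (rule the_equality)
  show "\<forall>x. ((\<lambda>e. F e x) \<longlongrightarrow> T x) (at_right 0)" using assms by blast
  fix S assume S: "\<forall>x. ((\<lambda>e. F e x) \<longlongrightarrow> blinfun_apply S x) (at_right 0)"
  show "S = T"
    by (rule blinfun_eqI, rule tendsto_unique[OF trivial_limit_at_right_real S[rule_format] assms])
qed

text \<open>The pointwise limits form a linear map bounded by \<open>K\<close>, hence an operator to
  which the \<open>THE\<close> in \<open>strong_lim0\<close> can refer.\<close>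

lemma strong_lim0_tendsto:
  fixes F :: "real \<Rightarrow> ('a::real_normed_vector \<Rightarrow>\<^sub>L 'a)"
  assumes bound: "\<And>d. 0 < d \<Longrightarrow> norm (F d) \<le> K"
    and conv: "\<And>x. \<exists>l. ((\<lambda>d. F d x) \<longlongrightarrow> l) (at_right 0)"
  shows "((\<lambda>d. F d x) \<longlongrightarrow> strong_lim0 F x) (at_right 0)"
proof -
  obtain g where g: "\<And>x. ((\<lambda>d. F d x) \<longlongrightarrow> g x) (at_right 0)" using conv by metis
  have bl: "bounded_linear g"
  proof (rule bounded_linear_intro)
    fix x y and r :: real
    show "g (x + y) = g x + g y"
      using g[of "x + y"] tendsto_add[OF g[of x] g[of y]]
      by (intro tendsto_unique[OF trivial_limit_at_right_real, of "\<lambda>d. F d (x + y)"])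
        (simp_all add: blinfun.bilinear_simps)
    show "g (r *\<^sub>R x) = r *\<^sub>R g x"
      using g[of "r *\<^sub>R x"] tendsto_scaleR[OF tendsto_const[of r] g[of x]]
      by (intro tendsto_unique[OF trivial_limit_at_right_real, of "\<lambda>d. F d (r *\<^sub>R x)"])
        (simp_all add: blinfun.bilinear_simps)
    have "\<forall>\<^sub>F d in at_right 0. norm (F d x) \<le> norm x * K"
      using eventually_at_right_less[of "0::real"]
    proof eventually_elim
      case (elim d)
      show ?case using norm_blinfun[of "F d" x] mult_right_mono[OF bound[OF elim] norm_ge_zero[of x]]
        by (simp add: mult.commute)
    qed
    with tendsto_norm[OF g] show "norm (g x) \<le> norm x * K"
      by (rule tendsto_upperbound) (rule trivial_limit_at_right_real)
  qed
  have "strong_lim0 F = Blinfun g"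
    by (rule strong_lim0_eqI) (use g in \<open>simp add: bounded_linear_Blinfun_apply[OF bl]\<close>)
  then show ?thesis using g by (simp add: bounded_linear_Blinfun_apply[OF bl])
qed

lemma strong_convergent_dense:
  fixes F :: "real \<Rightarrow> ('a::real_normed_vector \<Rightarrow>\<^sub>L 'b::banach)"
  assumes bound: "\<And>d. 0 < d \<Longrightarrow> norm (F d) \<le> K"
    and dense: "\<And>e. 0 < e \<Longrightarrow> \<exists>y. norm (x - y) < e \<and> (\<exists>l. ((\<lambda>d. F d y) \<longlongrightarrow> l) (at_right 0))"
  shows "\<exists>l. ((\<lambda>d. F d x) \<longlongrightarrow> l) (at_right 0)"
proof (rule tendsto_at_right_Cauchy)
  fix e :: real assume e: "0 < e"
  have K: "0 \<le> K" using bound[of 1] norm_ge_zero order_trans by (metis zero_less_one)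
  obtain y l where y: "norm (x - y) < e / (4 * (K + 1))" and l: "((\<lambda>d. F d y) \<longlongrightarrow> l) (at_right 0)"
    using dense[of "e / (4 * (K + 1))"] e K by auto
  have "\<forall>\<^sub>F d in at_right 0. dist (F d y) l < e / 4" using tendstoD[OF l, of "e / 4"] e by simp
  then obtain d0 where d0: "0 < d0" "\<And>d. 0 < d \<Longrightarrow> d < d0 \<Longrightarrow> dist (F d y) l < e / 4"
    by (auto simp: eventually_at_right_field)
  have near: "dist (F d x) l < e / 2" if "0 < d" "d < d0" for d
  proof -
    have "norm (F d (x - y)) \<le> K * norm (x - y)"
      using norm_blinfun[of "F d" "x - y"] mult_right_mono[OF bound[OF that(1)] norm_ge_zero[of "x - y"]]
      by linarith
    also have "\<dots> \<le> (K + 1) * norm (x - y)" by (simp add: distrib_right)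
    also have "\<dots> < e / 4" using y K by (simp add: field_simps)
    finally have "dist (F d x) (F d y) < e / 4" by (simp add: dist_norm blinfun.diff_right)
    with d0(2)[OF that] dist_triangle[of "F d x" l "F d y"] show ?thesis by linarith
  qed
  have "dist (F d x) (F d' x) < e" if "0 < d" "d < d0" "0 < d'" "d' < d0" for d d'
    using near[of d] near[of d'] that dist_triangle2[of "F d x" "F d' x" l] by linarith
  with d0(1) show "\<exists>d0>0. \<forall>d d'. 0 < d \<and> d < d0 \<and> 0 < d' \<and> d' < d0 \<longrightarrow> dist (F d x) (F d' x) < e"
    by blast
qed

lemma strong_tendsto_apply:
  fixes F :: "'c \<Rightarrow> ('a::real_normed_vector \<Rightarrow>\<^sub>L 'b::real_normed_vector)"
  assumes bound: "\<forall>\<^sub>F d in net. norm (F d) \<le> K"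
    and F: "\<And>x. ((\<lambda>d. F d x) \<longlongrightarrow> blinfun_apply T x) net" and v: "(v \<longlongrightarrow> w) net"
  shows "((\<lambda>d. F d (v d)) \<longlongrightarrow> T w) net"
proof -
  have "((\<lambda>d. K * norm (v d - w)) \<longlongrightarrow> K * norm (w - w)) net" by (intro tendsto_intros v)
  then have 0: "((\<lambda>d. K * norm (v d - w)) \<longlongrightarrow> 0) net" by simp
  have "((\<lambda>d. F d (v d - w)) \<longlongrightarrow> 0) net"
  proof (rule Lim_null_comparison[OF _ 0])
    show "\<forall>\<^sub>F d in net. norm (F d (v d - w)) \<le> K * norm (v d - w)"
      using bound
    proof eventually_elim
      case (elim d)
      show ?case
        by (rule order_trans[OF norm_blinfun mult_right_mono[OF elim norm_ge_zero]])
    qed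
  qed
  from tendsto_add[OF this F[of w]] show ?thesis by (simp add: blinfun.bilinear_simps)
qed

lemma op_between_strong_limit:
  fixes T :: "'a::real_inner \<Rightarrow>\<^sub>L 'a"
  assumes lim: "\<And>x. ((\<lambda>d. blinfun_apply (F d) x) \<longlongrightarrow> blinfun_apply T x) net"
    and F: "\<forall>\<^sub>F d in net. op_between m (F d) M" and nontriv: "net \<noteq> bot"
  shows "op_between m T M"
  unfolding op_between_def symmetric_op_def
proof (intro conjI allI)
  fix x y
  have "\<forall>\<^sub>F d in net. inner (F d x) y = inner x (F d y)"
    using F by eventually_elim (rule symmetric_opD[OF op_betweenD(1)])
  then show "inner (T x) y = inner x (T y)"
    using tendsto_unique[OF nontriv tendsto_inner[OF lim[of x] tendsto_const[of y]]]
      tendsto_inner[OF tendsto_const[of x] lim[of y]]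
      tendsto_cong[of "\<lambda>d. inner (F d x) y" "\<lambda>d. inner x (F d y)" net] by simp
  show "m * inner x x \<le> inner x (T x)"
    by (rule tendsto_lowerbound[OF tendsto_inner[OF tendsto_const lim] _ nontriv])
      (rule eventually_mono[OF F op_betweenD(2)])
  show "inner x (T x) \<le> M * inner x x"
    by (rule tendsto_upperbound[OF tendsto_inner[OF tendsto_const lim] _ nontriv])
      (rule eventually_mono[OF F op_betweenD(3)])
qed

lemma strong_limit_commute:
  fixes T J :: "'a::real_normed_vector \<Rightarrow>\<^sub>L 'a"
  assumes lim: "\<And>x. ((\<lambda>d. blinfun_apply (F d) x) \<longlongrightarrow> blinfun_apply T x) net"
    and J: "\<forall>\<^sub>F d in net. F d o\<^sub>L J = J o\<^sub>L F d" and nontriv: "net \<noteq> bot"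
  shows "T o\<^sub>L J = J o\<^sub>L T"
proof (rule blinfun_eqI, rule tendsto_unique[OF nontriv])
  fix x
  show "((\<lambda>d. F d (J x)) \<longlongrightarrow> (T o\<^sub>L J) x) net" using lim[of "J x"] by simp
  have "\<forall>\<^sub>F d in net. F d (J x) = J (F d x)"
    using J by eventually_elim (metis blinfun_apply_blinfun_compose)
  moreover have "((\<lambda>d. J (F d x)) \<longlongrightarrow> (J o\<^sub>L T) x) net"
    unfolding blinfun_apply_blinfun_compose by (intro tendsto_intros lim)
  ultimately show "((\<lambda>d. F d (J x)) \<longlongrightarrow> (J o\<^sub>L T) x) net" by (simp add: tendsto_cong)
qed

lemma op_between_01_norm:
  fixes P :: "'a::real_inner \<Rightarrow>\<^sub>L 'a"
  shows "op_between 0 P 1 \<Longrightarrow> norm P \<le> 1"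
  by (rule norm_le_of_op_between) (simp_all add: op_between_mono[of 0 P 1 "-1" 1])

text \<open>One polynomial approximates \<phi> on [0, 1], hence in norm for all operators between 0
  and 1 at once; for polynomials the uniform bound on the operators suffices. The vector may move,
  since the regularized H^(1/2) x moves in the application.\<close>

lemma fun_calc_strong_limit:
  fixes T :: "'a::chilbert_space \<Rightarrow>\<^sub>L 'a"
  assumes lim: "\<And>x. ((\<lambda>d. blinfun_apply (F d) x) \<longlongrightarrow> blinfun_apply T x) net"
    and F: "\<forall>\<^sub>F d in net. op_between 0 (F d) 1" and T: "op_between 0 T 1"
    and \<phi>: "continuous_on {0..1} \<phi>" and v: "(v \<longlongrightarrow> w) net"
  shows "((\<lambda>d. fun_calc \<phi> (F d) (v d)) \<longlongrightarrow> fun_calc \<phi> T w) net"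
proof -
  have norm: "\<forall>\<^sub>F d in net. norm (F d) \<le> 1"
    using F by eventually_elim (rule op_between_01_norm)
  have poly: "((\<lambda>d. poly_op p (F d) (v d)) \<longlongrightarrow> poly_op p T w) net" for p
  proof (induction p)
    case (pCons a p)
    then show ?case
      by (simp add: poly_op_pCons blinfun.bilinear_simps)
        (intro tendsto_add tendsto_scaleR tendsto_const v strong_tendsto_apply[OF norm lim])
  qed simp
  show ?thesis
  proof (rule tendstoI)
    fix e :: real assume e: "0 < e"
    \<comment> \<open>Eventually |v d| < |w| + 1, so each of the two replacements of \<phi> by the
      polynomial costs at most e / 4, which leaves e / 2 for the polynomial.\<close>
    define \<delta> where "\<delta> = e / (4 * (norm w + 1))"
    have \<delta>: "0 < \<delta>" using e by (simp add: \<delta>_def add_nonneg_pos)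
    obtain p where p: "\<And>t. t \<in> {0..1} \<Longrightarrow> \<bar>poly p t - \<phi> t\<bar> < \<delta>"
      using Weierstrass_poly[OF \<phi> \<delta>] by blast
    have close: "norm (poly_op p S x - fun_calc \<phi> S x) \<le> \<delta> * norm x"
      if "op_between 0 S 1" for S :: "'a \<Rightarrow>\<^sub>L 'a" and x
    proof -
      have c: "continuous_on {0..1} (poly p)" by (intro continuous_intros)
      have "norm (fun_calc (\<lambda>t. poly p t - \<phi> t) S) \<le> \<delta>"
        using p \<delta> by (intro norm_fun_calc_le[OF that] continuous_intros c \<phi>) (auto intro: less_imp_le)
      then have "norm (poly_op p S - fun_calc \<phi> S) \<le> \<delta>"
        by (simp add: fun_calc_diff[OF that c \<phi>] fun_calc_poly[OF that])
      from order_trans[OF norm_blinfun mult_right_mono[OF this norm_ge_zero]]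
      show ?thesis by (simp add: blinfun.diff_left)
    qed
    have "\<forall>\<^sub>F d in net. norm (v d) < norm w + 1"
      by (rule order_tendstoD(2)[OF tendsto_norm[OF v]]) simp
    moreover have "\<forall>\<^sub>F d in net. dist (poly_op p (F d) (v d)) (poly_op p T w) < e / 2"
      using tendstoD[OF poly, of "e / 2" p] e by simp
    ultimately show "\<forall>\<^sub>F d in net. dist (fun_calc \<phi> (F d) (v d)) (fun_calc \<phi> T w) < e"
      using F
    proof eventually_elim
      case (elim d)
      have w4: "\<delta> * (norm w + 1) = e / 4"
      proof -
        have "e / (4 * n) * n = e / 4" if "0 < n" for n :: real using that by simp
        then show ?thesis unfolding \<delta>_def by (simp only: add_nonneg_pos norm_ge_zero zero_less_one)
      qed
      have "\<delta> * norm (v d) \<le> e / 4"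
        unfolding w4[symmetric] using elim(1) \<delta> by (intro mult_left_mono) auto
      moreover have "\<delta> * norm w \<le> e / 4"
        unfolding w4[symmetric] using \<delta> by (intro mult_left_mono) auto
      ultimately have "dist (poly_op p (F d) (v d)) (fun_calc \<phi> (F d) (v d)) \<le> e / 4"
        "dist (poly_op p T w) (fun_calc \<phi> T w) \<le> e / 4"
        using close[OF elim(3), of "v d"] close[OF T, of w] unfolding dist_norm by linarith+
      moreover have "dist (fun_calc \<phi> (F d) (v d)) (fun_calc \<phi> T w)
          \<le> dist (poly_op p (F d) (v d)) (fun_calc \<phi> (F d) (v d))
            + dist (poly_op p (F d) (v d)) (poly_op p T w) + dist (poly_op p T w) (fun_calc \<phi> T w)"
        using dist_triangle3[of "fun_calc \<phi> (F d) (v d)" "fun_calc \<phi> T w" "poly_op p (F d) (v d)"]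
          dist_triangle[of "poly_op p (F d) (v d)" "fun_calc \<phi> T w" "poly_op p T w"] by linarith
      ultimately show ?case using elim(2) by linarith
    qed
  qed
qed

section \<open>Limits of regularized means\<close>

locale positive_pair =
  fixes A B :: "'a::chilbert_space \<Rightarrow>\<^sub>L 'a"
  assumes A: "op_between 0 A (norm A)" and B: "op_between 0 B (norm B)"
begin

definition H :: "'a \<Rightarrow>\<^sub>L 'a" where "H = A + B"

definition W :: "'a \<Rightarrow>\<^sub>L 'a" where "W = fun_calc sqrt H"

definition K :: "real \<Rightarrow> 'a \<Rightarrow>\<^sub>L 'a" where "K d = fun_calc (\<lambda>t. 1 / sqrt (t + d)) H"

text \<open>This is d (H + d)^(-1) = d K(d)^2. It tends to the projection onto the kernel of
  \<open>H\<close>, and it is also, up to a factor, what a shift of \<open>A\<close> by a multiple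
  of the identity contributes to the regularized \<open>P\<close>.\<close>

definition G :: "real \<Rightarrow> 'a \<Rightarrow>\<^sub>L 'a" where "G d = fun_calc (\<lambda>t. d / (t + d)) H"

text \<open>\<open>P\<close> plays the role of \<open>A / (A + B)\<close> and vanishes on the kernel of \<open>A + B\<close>; \<open>Q\<close> is the projection
  onto that kernel.\<close>

definition P :: "'a \<Rightarrow>\<^sub>L 'a" where "P = strong_lim0 (\<lambda>d. K d o\<^sub>L A o\<^sub>L K d)"

definition Q :: "'a \<Rightarrow>\<^sub>L 'a" where "Q = strong_lim0 G"

section \<open>Regularized inverse square roots of \<open>H\<close>\<close>

lemma H: "op_between 0 H (norm H)"
  using op_between_norm_upper[OF op_between_add[OF A B]] by (simp add: H_def)

lemma continuous_K: "0 < d \<Longrightarrow> continuous_on {0..N} (\<lambda>t. 1 / sqrt (t + d))" for N :: real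
  by (auto intro!: continuous_intros)

lemma continuous_G: "0 < d \<Longrightarrow> continuous_on {0..N} (\<lambda>t. d / (t + d))" for N :: real
  by (auto intro!: continuous_intros)

lemma continuous_sqrt: "continuous_on {0..N} sqrt" for N :: real
  by (auto intro!: continuous_intros)

lemma symmetric_W: "symmetric_op W"
  unfolding W_def by (rule symmetric_op_fun_calc[OF H continuous_sqrt])

lemma symmetric_K: "0 < d \<Longrightarrow> symmetric_op (K d)"
  unfolding K_def by (rule symmetric_op_fun_calc[OF H continuous_K])

lemma K_K_scaled: "0 < d \<Longrightarrow> d *\<^sub>R (K d o\<^sub>L K d) = G d"
proof -
  assume d: "0 < d"
  have "K d o\<^sub>L K d = fun_calc (\<lambda>t. 1 / sqrt (t + d) * (1 / sqrt (t + d))) H"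
    unfolding K_def by (rule fun_calc_mult[OF H continuous_K continuous_K, symmetric]) (rule d)+
  then have "d *\<^sub>R (K d o\<^sub>L K d) = fun_calc (\<lambda>t. d * (1 / sqrt (t + d) * (1 / sqrt (t + d)))) H"
    using d by (simp only: fun_calc_scaleR[OF H] continuous_K continuous_on_mult)
  also have "\<dots> = fun_calc (\<lambda>t. d / (t + d)) H"
    by (rule fun_calc_cong[OF H]) (use d in \<open>auto intro!: continuous_intros\<close>)
  finally show "d *\<^sub>R (K d o\<^sub>L K d) = G d" by (simp add: G_def)
qed

lemma K_H: "0 < d \<Longrightarrow> K d o\<^sub>L H = fun_calc (\<lambda>t. t / sqrt (t + d)) H"
  using fun_calc_mult[OF H continuous_K continuous_on_id, of d]
  by (simp add: K_def fun_calc_ident[OF H])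

lemma K_H_K: "0 < d \<Longrightarrow> inner (K d x) (H (K d x)) \<le> inner x x"
proof -
  assume d: "0 < d"
  have c: "continuous_on {0..norm H} (\<lambda>t. t / sqrt (t + d))"
    using d by (auto intro!: continuous_intros)
  have "inner (K d x) (H (K d x)) = inner x ((K d o\<^sub>L H o\<^sub>L K d) x)"
    using symmetric_opD[OF symmetric_K[OF d]] by simp
  also have "K d o\<^sub>L H o\<^sub>L K d = fun_calc (\<lambda>t. t / sqrt (t + d) * (1 / sqrt (t + d))) H"
    using d by (simp only: K_H fun_calc_mult[OF H c continuous_K]) (simp add: K_def)
  also have "inner x (\<dots> x) \<le> 1 * inner x x"
    using d by (intro op_betweenD(3)[OF op_between_fun_calc[OF H, where a = 0]] continuous_intros c)
      (auto simp: divide_le_eq_1 abs_if)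
  finally show ?thesis by simp
qed

lemma A_le_H: "inner x (A x) \<le> inner x (H x)"
  using op_betweenD(2)[OF B, of x] by (simp add: H_def blinfun.bilinear_simps inner_add)

text \<open>As 0 \<le> A \<le> H, the form of \<open>A\<close> vanishes on the kernel of
  \<open>H\<close>, and a zero of the form of a positive operator lies in its kernel.\<close>

lemma H_kernel_A: "H x = 0 \<Longrightarrow> A x = 0"
proof -
  assume "H x = 0"
  then have "inner x (A x) \<le> 0" using A_le_H[of x] by simp
  moreover have "(norm (A x))\<^sup>2 \<le> norm A * inner x (A x)"
    by (rule norm_apply_le_of_positive[OF A]) simp
  ultimately have "(norm (A x))\<^sup>2 \<le> 0"
    by (meson mult_nonneg_nonpos norm_ge_zero order_trans)
  then show "A x = 0" by simp
qed

lemma K_A_K_between: "0 < d \<Longrightarrow> op_between 0 (K d o\<^sub>L A o\<^sub>L K d) 1"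
  unfolding op_between_def
proof (intro conjI allI)
  fix x assume d: "0 < d"
  show "symmetric_op (K d o\<^sub>L A o\<^sub>L K d)"
    by (intro symmetric_op_congruence symmetric_K d op_betweenD(1)[OF A])
  have eq: "inner x ((K d o\<^sub>L A o\<^sub>L K d) x) = inner (K d x) (A (K d x))"
    using symmetric_opD[OF symmetric_K[OF d]] by simp
  show "0 * inner x x \<le> inner x ((K d o\<^sub>L A o\<^sub>L K d) x)"
    unfolding eq using op_betweenD(2)[OF A, of "K d x"] by simp
  show "inner x ((K d o\<^sub>L A o\<^sub>L K d) x) \<le> 1 * inner x x"
    unfolding eq using A_le_H[of "K d x"] K_H_K[OF d, of x] by simp
qed

section \<open>Strong convergence to \<open>P\<close> and \<open>Q\<close>\<close>

definition sqrtA :: "'a \<Rightarrow>\<^sub>L 'a" where "sqrtA = fun_calc sqrt A"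

lemma symmetric_sqrtA: "symmetric_op sqrtA"
  unfolding sqrtA_def by (rule symmetric_op_fun_calc[OF A continuous_sqrt])

lemma sqrtA_sqrtA: "sqrtA (sqrtA x) = A x"
proof -
  have "sqrtA o\<^sub>L sqrtA = fun_calc (\<lambda>t. sqrt t * sqrt t) A"
    unfolding sqrtA_def by (rule fun_calc_mult[OF A continuous_sqrt continuous_sqrt, symmetric])
  also have "\<dots> = fun_calc (\<lambda>t. t) A"
    by (rule fun_calc_cong[OF A]) (auto intro!: continuous_intros)
  finally show ?thesis
    by (metis blinfun_apply_blinfun_compose fun_calc_ident[OF A])
qed

lemma norm_sqrtA_K: "0 < d \<Longrightarrow> norm (sqrtA (K d x)) \<le> norm x"
proof -
  assume d: "0 < d"
  have "inner (sqrtA (K d x)) (sqrtA (K d x)) = inner (K d x) (A (K d x))"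
    by (simp add: symmetric_opD[OF symmetric_sqrtA] sqrtA_sqrtA)
  also have "\<dots> \<le> inner x x" using A_le_H[of "K d x"] K_H_K[OF d, of x] by simp
  finally show ?thesis by (simp add: norm_le)
qed

text \<open>Duality: \<open>K d o\<^sub>L sqrtA\<close> is the adjoint of the contraction in
  \<open>norm_sqrtA_K\<close>. It supplies the bound, uniform in d, that monotone convergence needs,
  although \<open>K d\<close> alone may blow up.\<close>

lemma norm_K_sqrtA: "0 < d \<Longrightarrow> norm (K d (sqrtA x)) \<le> norm x"
proof -
  assume d: "0 < d"
  let ?y = "K d (sqrtA x)"
  have "norm ?y * norm ?y = inner ?y ?y" by (simp add: dot_square_norm power2_eq_square)
  also have "\<dots> = inner x (sqrtA (K d ?y))"
    by (simp add: symmetric_opD[OF symmetric_sqrtA] symmetric_opD[OF symmetric_K[OF d]])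
  also have "\<dots> \<le> norm x * norm ?y"
    using norm_cauchy_schwarz[of x "sqrtA (K d ?y)"] mult_left_mono[OF norm_sqrtA_K[OF d, of ?y] norm_ge_zero[of x]]
    by linarith
  finally show ?thesis by (cases "?y = 0") auto
qed

lemma norm_K_sqrtA_op: "0 < d \<Longrightarrow> norm (K d o\<^sub>L sqrtA) \<le> 1"
  by (rule norm_blinfun_bound) (use norm_K_sqrtA in auto)

lemma K_sqrtA_convergent: "\<exists>l. ((\<lambda>d. (K d o\<^sub>L sqrtA) x) \<longlongrightarrow> l) (at_right 0)"
  unfolding K_def blinfun_apply_blinfun_compose
proof (rule fun_calc_antitone_convergent[OF H continuous_K])
  show "norm (fun_calc (\<lambda>t. 1 / sqrt (t + d)) H (sqrtA x)) \<le> norm x" if "0 < d" for d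
    using norm_K_sqrtA[OF that, of x] by (simp add: K_def)
qed (auto intro!: divide_left_mono mult_pos_pos)

text \<open>Convergence even holds in norm: t / sqrt (t + d) and sqrt t differ by at most sqrt d,
  uniformly in t \<ge> 0.\<close>

lemma K_H_tendsto: "((\<lambda>d. K d (H x)) \<longlongrightarrow> W x) (at_right 0)"
proof -
  have "\<forall>\<^sub>F d in at_right 0. norm ((K d o\<^sub>L H) - W) \<le> sqrt d"
    using eventually_at_right_less[of "0::real"]
  proof eventually_elim
    case (elim d)
    have c: "continuous_on {0..norm H} (\<lambda>t. t / sqrt (t + d))"
      using elim by (auto intro!: continuous_intros)
    have "norm (fun_calc (\<lambda>t. t / sqrt (t + d) - sqrt t) H) \<le> sqrt d"
    proof (rule norm_fun_calc_le[OF H])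
      fix t assume "t \<in> {0..norm H}"
      then have t: "0 \<le> t" by simp
      have s: "sqrt t \<le> sqrt (t + d)" "0 < sqrt (t + d)" "sqrt (t + d) \<le> sqrt t + sqrt d"
        using t elim by (auto intro: sqrt_add_le_add_sqrt)
      have eq: "t / sqrt (t + d) - sqrt t = - (sqrt t * (sqrt (t + d) - sqrt t) / sqrt (t + d))"
        using s(2) t by (simp add: field_simps)
      have "sqrt t * (sqrt (t + d) - sqrt t) \<le> sqrt (t + d) * sqrt d"
        using s t by (intro mult_mono) auto
      then have "sqrt t * (sqrt (t + d) - sqrt t) / sqrt (t + d) \<le> sqrt d"
        using s(2) by (simp add: divide_le_eq mult.commute)
      moreover have "0 \<le> sqrt t * (sqrt (t + d) - sqrt t) / sqrt (t + d)"
        using s t by simp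
      ultimately show "\<bar>t / sqrt (t + d) - sqrt t\<bar> \<le> sqrt d" unfolding eq by simp
    qed (use elim c in \<open>auto intro!: continuous_on_diff continuous_sqrt\<close>)
    then show ?case
      unfolding K_H[OF elim] W_def by (simp add: fun_calc_diff[OF H c continuous_sqrt])
  qed
  moreover have "((\<lambda>d. sqrt d) \<longlongrightarrow> 0) (at_right 0)"
    using tendsto_real_sqrt[OF tendsto_ident_at, of 0 "{0<..}"] by simp
  ultimately have "((\<lambda>d. (K d o\<^sub>L H) - W) \<longlongrightarrow> 0) (at_right 0)"
    by (rule Lim_null_comparison)
  then have "((\<lambda>d. K d o\<^sub>L H) \<longlongrightarrow> W) (at_right 0)" by (simp add: LIM_zero_iff)
  from blinfun.tendsto[OF this tendsto_const] show ?thesis by simp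
qed

lemma G_between: "0 < d \<Longrightarrow> op_between 0 (G d) 1"
  unfolding G_def by (rule op_between_fun_calc[OF H continuous_G]) auto

text \<open>As d decreases, d / (t + d) decreases as well. Monotone convergence is available in the
  opposite direction, so it is applied to the complement t / (t + d).\<close>

lemma G_tendsto: "((\<lambda>d. G d x) \<longlongrightarrow> Q x) (at_right 0)"
  unfolding Q_def
proof (rule strong_lim0_tendsto)
  show "norm (G d) \<le> 1" if "0 < d" for d by (rule op_between_01_norm[OF G_between[OF that]])
  fix x
  have c: "continuous_on {0..norm H} (\<lambda>t. t / (t + d))" if "0 < d" for d
    using that by (auto intro!: continuous_intros)
  have "\<exists>l. ((\<lambda>d. fun_calc (\<lambda>t. t / (t + d)) H x) \<longlongrightarrow> l) (at_right 0)"
  proof (rule fun_calc_antitone_convergent[OF H c])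
    show "norm (fun_calc (\<lambda>t. t / (t + d)) H x) \<le> 1 * norm x" if "0 < d" for d
    proof (rule order_trans[OF norm_blinfun mult_right_mono[OF norm_fun_calc_le[OF H c]]])
    qed (use that in auto)
  qed (auto intro!: frac_le add_nonneg_pos)
  then obtain l where l: "((\<lambda>d. fun_calc (\<lambda>t. t / (t + d)) H x) \<longlongrightarrow> l) (at_right 0)" by blast
  have "\<forall>\<^sub>F d in at_right 0. G d x = x - fun_calc (\<lambda>t. t / (t + d)) H x"
    using eventually_at_right_less[of "0::real"]
  proof eventually_elim
    case (elim d)
    have "G d = fun_calc (\<lambda>t. 1 - t / (t + d)) H"
      unfolding G_def
      by (rule fun_calc_cong[OF H continuous_G[OF elim]]) (use elim in \<open>auto simp: field_simps\<close>)
    then show ?case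
      by (simp only: fun_calc_diff[OF H continuous_on_const c[OF elim]])
        (simp add: fun_calc_const[OF H, of 1, simplified] blinfun.diff_left)
  qed
  with tendsto_diff[OF tendsto_const[of x] l]
  show "\<exists>l. ((\<lambda>d. G d x) \<longlongrightarrow> l) (at_right 0)" by (auto simp: tendsto_cong)
qed

lemma H_G: "0 < d \<Longrightarrow> norm (H o\<^sub>L G d) \<le> d"
proof -
  assume d: "0 < d"
  have "H o\<^sub>L G d = fun_calc (\<lambda>t. t * (d / (t + d))) H"
    using fun_calc_mult[OF H continuous_on_id continuous_G[OF d]]
    by (simp add: G_def fun_calc_ident[OF H])
  also have "norm \<dots> \<le> d"
  proof (rule norm_fun_calc_le[OF H])
    fix t assume "t \<in> {0..norm H}"
    then have "0 \<le> t" by simp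
    then have "0 \<le> t * (d / (t + d))" "t * (d / (t + d)) \<le> d"
      using d by (auto simp: divide_le_eq distrib_left add_nonneg_pos)
    then show "\<bar>t * (d / (t + d))\<bar> \<le> d" by (simp only: abs_of_nonneg)
  qed (use d in \<open>auto intro!: continuous_intros simp: add_nonneg_eq_0_iff\<close>)
  finally show ?thesis .
qed

lemma H_Q: "H (Q x) = 0"
proof (rule tendsto_unique[OF trivial_limit_at_right_real])
  show "((\<lambda>d. H (G d x)) \<longlongrightarrow> H (Q x)) (at_right 0)"
    by (intro blinfun.tendsto tendsto_const G_tendsto)
  have "((\<lambda>d::real. d * norm x) \<longlongrightarrow> 0 * norm x) (at_right 0)"
    by (intro tendsto_mult tendsto_ident_at tendsto_const)
  then have "((\<lambda>d::real. d * norm x) \<longlongrightarrow> 0) (at_right 0)" by simp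
  moreover have "\<forall>\<^sub>F d in at_right 0. norm (H (G d x)) \<le> d * norm x"
    using eventually_at_right_less[of "0::real"]
  proof eventually_elim
    case (elim d)
    from order_trans[OF norm_blinfun mult_right_mono[OF H_G[OF elim] norm_ge_zero]]
    show ?case by simp
  qed
  ultimately show "((\<lambda>d. H (G d x)) \<longlongrightarrow> 0) (at_right 0)"
    by (rule Lim_null_comparison[rotated])
qed

text \<open>In the identity x = G_d x + H (H + d)^(-1) x the first term is close to Q x, which lies
  in the kernel.\<close>

lemma H_range_kernel_dense:
  assumes "0 < e" shows "\<exists>z u. H u = 0 \<and> norm (x - (H z + u)) < e"
proof -
  have "\<forall>\<^sub>F d in at_right 0. dist (G d x) (Q x) < e" using tendstoD[OF G_tendsto assms] .
  then obtain b where "0 < b" "\<And>d. 0 < d \<Longrightarrow> d < b \<Longrightarrow> dist (G d x) (Q x) < e"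
    by (auto simp: eventually_at_right_field)
  then obtain d where d: "0 < d" "dist (G d x) (Q x) < e" by (meson dense)
  have c: "continuous_on {0..norm H} (\<lambda>t. 1 / (t + d))"
    using d by (auto intro!: continuous_intros)
  define R where "R = fun_calc (\<lambda>t. 1 / (t + d)) H"
  have "fun_calc (\<lambda>t. t * (1 / (t + d))) H = H o\<^sub>L R"
    using fun_calc_mult[OF H continuous_on_id c] by (simp add: R_def fun_calc_ident[OF H])
  then have "G d + (H o\<^sub>L R) = fun_calc (\<lambda>t. d / (t + d) + t * (1 / (t + d))) H"
    using fun_calc_add[OF H continuous_G[OF d(1)] continuous_on_mult[OF continuous_on_id c]]
    by (simp add: G_def)
  also have "\<dots> = fun_calc (\<lambda>t. 1) H"
    by (rule fun_calc_cong[OF H continuous_on_const, symmetric])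
      (use d in \<open>simp add: add_divide_distrib[symmetric]\<close>)
  also have "\<dots> = id_blinfun" using fun_calc_const[OF H, of 1] by simp
  finally have "(G d + (H o\<^sub>L R)) x = id_blinfun x" by (rule arg_cong)
  then have "x = G d x + H (R x)" by (simp add: blinfun.add_left)
  then have "x - (H (R x) + Q x) = G d x - Q x"
    by (metis add_diff_cancel_right' diff_diff_add)
  then have "norm (x - (H (R x) + Q x)) = dist (G d x) (Q x)"
    unfolding dist_norm by (rule arg_cong)
  with d H_Q show ?thesis by (intro exI[of _ "R x"] exI[of _ "Q x"]) simp
qed

lemma K_A_K_kernel: "H x = 0 \<Longrightarrow> 0 < d \<Longrightarrow> K d (A (K d x)) = 0"
proof -
  assume x: "H x = 0" and d: "0 < d"
  have "K d x = (1 / sqrt (0 + d)) *\<^sub>R x"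
    unfolding K_def by (rule fun_calc_kernel[OF H continuous_K[OF d] _ x]) simp
  then show ?thesis by (simp add: blinfun.bilinear_simps H_kernel_A[OF x])
qed

text \<open>The operators are bounded by 1, so vectors H z + u with u in the kernel suffice. They
  annihilate u, and on H z they split into K A^(1/2) applied to A^(1/2) K H z, where the operator
  converges strongly and the vector in norm.\<close>

lemma K_A_K_tendsto: "((\<lambda>d. (K d o\<^sub>L A o\<^sub>L K d) x) \<longlongrightarrow> P x) (at_right 0)"
  unfolding P_def
proof (rule strong_lim0_tendsto)
  show bound: "norm (K d o\<^sub>L A o\<^sub>L K d) \<le> 1" if "0 < d" for d
    by (rule op_between_01_norm[OF K_A_K_between[OF that]])
  fix x
  show "\<exists>l. ((\<lambda>d. (K d o\<^sub>L A o\<^sub>L K d) x) \<longlongrightarrow> l) (at_right 0)"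
  proof (rule strong_convergent_dense[OF bound])
    fix e :: real assume "0 < e"
    then obtain z u where zu: "H u = 0" "norm (x - (H z + u)) < e"
      using H_range_kernel_dense by blast
    have bd: "\<forall>\<^sub>F d in at_right 0. norm (K d o\<^sub>L sqrtA) \<le> 1"
      using eventually_at_right_less[of "0::real"] by eventually_elim (rule norm_K_sqrtA_op)
    have conv: "((\<lambda>d. (K d o\<^sub>L sqrtA) x) \<longlongrightarrow> strong_lim0 (\<lambda>d. K d o\<^sub>L sqrtA) x) (at_right 0)" for x
      by (rule strong_lim0_tendsto[OF norm_K_sqrtA_op K_sqrtA_convergent])
    have v: "((\<lambda>d. sqrtA (K d (H z))) \<longlongrightarrow> sqrtA (W z)) (at_right 0)"
      by (intro blinfun.tendsto tendsto_const K_H_tendsto)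
    from strong_tendsto_apply[OF bd conv v]
    have "((\<lambda>d. (K d o\<^sub>L A o\<^sub>L K d) (H z))
        \<longlongrightarrow> strong_lim0 (\<lambda>d. K d o\<^sub>L sqrtA) (sqrtA (W z))) (at_right 0)"
      by (simp add: sqrtA_sqrtA)
    moreover have "\<forall>\<^sub>F d in at_right 0. (K d o\<^sub>L A o\<^sub>L K d) (H z + u) = (K d o\<^sub>L A o\<^sub>L K d) (H z)"
      using eventually_at_right_less[of "0::real"]
      by eventually_elim (simp add: blinfun.add_right K_A_K_kernel[OF zu(1)])
    ultimately show "\<exists>y. norm (x - y) < e \<and> (\<exists>l. ((\<lambda>d. (K d o\<^sub>L A o\<^sub>L K d) y) \<longlongrightarrow> l) (at_right 0))"
      using zu(2) by (intro exI[of _ "H z + u"]) (auto simp: tendsto_cong)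
  qed
qed

lemma P_between: "op_between 0 P 1"
  by (rule op_between_strong_limit[OF K_A_K_tendsto])
    (auto intro: eventually_mono[OF eventually_at_right_less[of "0::real"] K_A_K_between])

lemma Q_between: "op_between 0 Q 1"
  by (rule op_between_strong_limit[OF G_tendsto])
    (auto intro: eventually_mono[OF eventually_at_right_less[of "0::real"] G_between])

lemma P_kernel: "H x = 0 \<Longrightarrow> P x = 0"
proof (rule tendsto_unique[OF trivial_limit_at_right_real K_A_K_tendsto])
  assume x: "H x = 0"
  have "\<forall>\<^sub>F d in at_right 0. (K d o\<^sub>L A o\<^sub>L K d) x = 0"
    using eventually_at_right_less[of "0::real"] by eventually_elim (simp add: K_A_K_kernel x)
  then show "((\<lambda>d. (K d o\<^sub>L A o\<^sub>L K d) x) \<longlongrightarrow> 0) (at_right 0)" by (simp add: tendsto_cong)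
qed

lemma Q_kernel: "H x = 0 \<Longrightarrow> Q x = x"
proof (rule tendsto_unique[OF trivial_limit_at_right_real G_tendsto])
  assume x: "H x = 0"
  have "\<forall>\<^sub>F d in at_right 0. G d x = x"
    using eventually_at_right_less[of "0::real"]
  proof eventually_elim
    case (elim d)
    have "G d x = (d / (0 + d)) *\<^sub>R x"
      unfolding G_def by (rule fun_calc_kernel[OF H continuous_G[OF elim] _ x]) simp
    with elim show ?case by simp
  qed
  then show "((\<lambda>d. G d x) \<longlongrightarrow> x) (at_right 0)" by (simp add: tendsto_cong)
qed

section \<open>The limit functional calculus of the pair\<close>

lemma symmetric_compose_0:
  fixes S T :: "'a \<Rightarrow>\<^sub>L 'a"
  assumes "symmetric_op S" "symmetric_op T" "\<And>x. S (T x) = 0" shows "T (S x) = 0"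
proof -
  have "inner (T (S x)) (T (S x)) = inner x (S (T (T (S x))))"
    by (simp only: symmetric_opD[OF assms(1)] symmetric_opD[OF assms(2)])
  then show ?thesis using assms(3) by simp
qed

lemma Q_identities: "P (Q x) = 0" "Q (P x) = 0" "Q (Q x) = Q x" "W (Q x) = 0" "Q (W x) = 0"
proof -
  note sQ = op_betweenD(1)[OF Q_between]
  show PQ: "P (Q x) = 0" for x by (rule P_kernel[OF H_Q])
  show "Q (Q x) = Q x" by (rule Q_kernel[OF H_Q])
  show WQ: "W (Q x) = 0" for x
    unfolding W_def using fun_calc_kernel[OF H continuous_sqrt _ H_Q, of x] by simp
  show "Q (P x) = 0" by (rule symmetric_compose_0[OF op_betweenD(1)[OF P_between] sQ PQ])
  show "Q (W x) = 0" by (rule symmetric_compose_0[OF symmetric_W sQ WQ])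
qed

text \<open>1 - Q intertwines P + s Q with \<open>P\<close>, and \<open>W\<close> absorbs it on both
  sides. So what survives of the regularization on the kernel of \<open>H\<close> does not affect
  the limit.\<close>

lemma joint_calc_shift:
  assumes s: "op_between 0 (P + s *\<^sub>R Q) 1" and \<phi>: "continuous_on {0..1} \<phi>"
  shows "W (fun_calc \<phi> (P + s *\<^sub>R Q) (W x)) = W (fun_calc \<phi> P (W x))"
proof -
  define S where "S = id_blinfun - Q"
  have "(P + s *\<^sub>R Q) o\<^sub>L S = S o\<^sub>L P"
    by (rule blinfun_eqI) (simp add: S_def blinfun.bilinear_simps Q_identities)
  then have "fun_calc \<phi> (P + s *\<^sub>R Q) (S (W x)) = S (fun_calc \<phi> P (W x))"
    by (metis fun_calc_intertwine[OF s P_between \<phi>] blinfun_apply_blinfun_compose)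
  then show ?thesis by (simp add: S_def blinfun.bilinear_simps Q_identities)
qed

text \<open>The Pusz-Woronowicz calculus: \<phi> represents the homogeneous function (x, y)
  \<mapsto> (x + y) \<phi>(x / (x + y)) of the pair \<open>A\<close>, \<open>B\<close>.\<close>

definition joint_calc :: "(real \<Rightarrow> real) \<Rightarrow> 'a \<Rightarrow>\<^sub>L 'a" where
  "joint_calc \<phi> = W o\<^sub>L fun_calc \<phi> P o\<^sub>L W"

text \<open>\<open>J\<close> will be multiplication by a complex scalar, which makes
  \<open>joint_calc \<phi>\<close> complex-linear. Symmetry of \<open>J\<close> cannot be assumed,
  as multiplication by \<i> is antisymmetric for the real inner product.\<close>

lemma joint_calc_commute:
  assumes J: "J o\<^sub>L A = A o\<^sub>L J" "J o\<^sub>L B = B o\<^sub>L J" and \<phi>: "continuous_on {0..1} \<phi>"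
  shows "joint_calc \<phi> o\<^sub>L J = J o\<^sub>L joint_calc \<phi>"
proof -
  have HJ: "H o\<^sub>L J = J o\<^sub>L H"
    using J by (simp add: H_def blinfun_compose.add_left blinfun_compose.add_right)
  have WJ: "W (J x) = J (W x)" for x
    using fun_calc_intertwine[OF H H continuous_sqrt HJ] unfolding W_def
    by (metis blinfun_apply_blinfun_compose)
  have KJ: "K d (J x) = J (K d x)" if "0 < d" for d x
    using fun_calc_intertwine[OF H H continuous_K[OF that] HJ] unfolding K_def
    by (metis blinfun_apply_blinfun_compose)
  have AJ: "A (J x) = J (A x)" for x using J(1) by (metis blinfun_apply_blinfun_compose)
  have "P o\<^sub>L J = J o\<^sub>L P"
  proof (rule strong_limit_commute[OF K_A_K_tendsto _ trivial_limit_at_right_real])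
    show "\<forall>\<^sub>F d in at_right 0. (K d o\<^sub>L A o\<^sub>L K d) o\<^sub>L J = J o\<^sub>L (K d o\<^sub>L A o\<^sub>L K d)"
      using eventually_at_right_less[of "0::real"]
      by eventually_elim (auto intro!: blinfun_eqI simp: KJ AJ)
  qed
  from fun_calc_intertwine[OF P_between P_between \<phi> this]
  have "fun_calc \<phi> P (J x) = J (fun_calc \<phi> P x)" for x by (metis blinfun_apply_blinfun_compose)
  then show ?thesis by (intro blinfun_eqI) (simp add: joint_calc_def WJ)
qed

lemma joint_calc_algebra:
  assumes "continuous_on {0..1} \<phi>" "continuous_on {0..1} \<psi>"
  shows "joint_calc (\<lambda>x. \<phi> x + \<psi> x) = joint_calc \<phi> + joint_calc \<psi>" "joint_calc (\<lambda>x. \<phi> x - \<psi> x) = joint_calc \<phi> - joint_calc \<psi>"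
    "joint_calc (\<lambda>x. c * \<phi> x) = c *\<^sub>R joint_calc \<phi>"
  by (simp_all add: joint_calc_def assms fun_calc_add[OF P_between] fun_calc_diff[OF P_between]
      fun_calc_scaleR[OF P_between] blinfun_compose.add_left blinfun_compose.add_right
      blinfun_compose.diff_left blinfun_compose.diff_right
      blinfun_compose.scaleR_left blinfun_compose.scaleR_right)

lemma joint_calc_nonneg:
  assumes \<phi>: "continuous_on {0..1} \<phi>" "\<And>x. 0 \<le> x \<Longrightarrow> x \<le> 1 \<Longrightarrow> 0 \<le> \<phi> x"
  shows "symmetric_op (joint_calc \<phi>)" "0 \<le> inner x (joint_calc \<phi> x)"
proof -
  show "symmetric_op (joint_calc \<phi>)"
    unfolding joint_calc_def
    by (intro symmetric_op_congruence symmetric_W symmetric_op_fun_calc[OF P_between \<phi>(1)])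
  have "inner x (joint_calc \<phi> x) = inner (W x) (fun_calc \<phi> P (W x))"
    by (simp add: joint_calc_def symmetric_opD[OF symmetric_W])
  then show "0 \<le> inner x (joint_calc \<phi> x)" using fun_calc_nonneg[OF P_between \<phi>(1)] \<phi>(2) by simp
qed

section \<open>Convergence of the means of shifted operators\<close>

lemma coercive_shift:
  fixes S :: "'a \<Rightarrow>\<^sub>L 'a"
  assumes S: "op_between 0 S (norm S)" and "0 \<le> s" "0 < s \<or> invertible_op S"
  shows "\<exists>c M. 0 < c \<and> op_between c (S + s *\<^sub>R id_blinfun) M"
proof (cases "0 < s")
  case True
  then show ?thesis using op_between_add[OF S op_between_scaled_id[of s]] by auto
next
  case False
  then have "s = 0" "invertible_op S" using assms by auto
  then show ?thesis using invertible_op_lower_bound[OF S] by auto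
qed

lemma shift_between: "0 \<le> d \<Longrightarrow> op_between d (H + d *\<^sub>R id_blinfun) (norm H + d)"
  using op_between_add[OF H op_between_scaled_id[of d]] by simp

lemma op_powr_shift:
  assumes d: "0 < d"
  shows "op_powr (H + d *\<^sub>R id_blinfun) s = fun_calc (\<lambda>t. (t + d) powr s) H"
proof -
  have c: "continuous_on {0..norm H} (\<lambda>t. t + d)" by (intro continuous_intros)
  have shift: "H + d *\<^sub>R id_blinfun = fun_calc (\<lambda>t. t + d) H"
    using fun_calc_add[OF H continuous_on_id continuous_on_const, of d]
    by (simp add: fun_calc_ident[OF H] fun_calc_const[OF H])
  have "fun_calc (\<lambda>t. t powr s) (fun_calc (\<lambda>t. t + d) H) = fun_calc (\<lambda>t. (t + d) powr s) H"
    by (rule fun_calc_compose[OF H c shift_between[of d, unfolded shift]])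
      (use d in \<open>auto intro: continuous_on_powr_coercive[OF shift_between d]\<close>)
  then show ?thesis
    using op_powr_eq_fun_calc[OF shift_between[OF less_imp_le[OF d]] d, of s] unfolding shift by simp
qed

lemma op_powr_shift_inv_sqrt: "0 < d \<Longrightarrow> op_powr (H + d *\<^sub>R id_blinfun) (-1/2) = K d"
  unfolding op_powr_shift K_def
  by (rule fun_calc_cong[OF H continuous_K, symmetric])
    (auto simp: powr_minus_divide powr_half_sqrt add_nonneg_nonneg)

lemma op_powr_shift_sqrt_tendsto:
  "((\<lambda>d. op_powr (H + d *\<^sub>R id_blinfun) (1/2)) \<longlongrightarrow> W) (at_right 0)"
proof -
  have "\<forall>\<^sub>F d in at_right 0. norm (op_powr (H + d *\<^sub>R id_blinfun) (1/2) - W) \<le> sqrt d"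
    using eventually_at_right_less[of "0::real"]
  proof eventually_elim
    case (elim d)
    have c: "continuous_on {0..norm H} (\<lambda>t. (t + d) powr (1/2))"
      using elim by (auto intro!: continuous_intros)
    have "norm (fun_calc (\<lambda>t. (t + d) powr (1/2) - sqrt t) H) \<le> sqrt d"
    proof (rule norm_fun_calc_le[OF H])
      fix t assume "t \<in> {0..norm H}"
      then have t: "0 \<le> t" by simp
      then have "sqrt t \<le> sqrt (t + d)" "sqrt (t + d) \<le> sqrt t + sqrt d"
        using elim by (auto intro: sqrt_add_le_add_sqrt)
      then show "\<bar>(t + d) powr (1/2) - sqrt t\<bar> \<le> sqrt d"
        using t elim by (simp add: powr_half_sqrt)
    qed (use elim c in \<open>auto intro!: continuous_on_diff continuous_sqrt\<close>)
    then show ?case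
      by (simp only: op_powr_shift[OF elim] W_def fun_calc_diff[OF H c continuous_sqrt])
  qed
  moreover have "((\<lambda>d. sqrt d) \<longlongrightarrow> 0) (at_right 0)"
    using tendsto_real_sqrt[OF tendsto_ident_at, of 0 "{0<..}"] by simp
  ultimately have "((\<lambda>d. op_powr (H + d *\<^sub>R id_blinfun) (1/2) - W) \<longlongrightarrow> 0) (at_right 0)"
    by (rule Lim_null_comparison)
  then show ?thesis by (simp add: LIM_zero_iff)
qed

text \<open>This serves the case in which nothing is shifted and the family of means is constant.
  Since sqrt t sqrt (t + d) \<ge> c, the functions that define \<open>K d\<close> converge uniformly
  on \<open>{c..M}\<close>, so the strong limit \<open>P\<close> is given by the plain
  formula.\<close>

lemma W_P_coercive:
  assumes Hc: "op_between c H M" "0 < c"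
  shows "op_powr H (1/2) = W" "op_powr H (-1/2) o\<^sub>L A o\<^sub>L op_powr H (-1/2) = P"
proof -
  show "op_powr H (1/2) = W"
    unfolding op_powr_eq_fun_calc[OF Hc] W_def
    by (rule fun_calc_cong[OF Hc(1) continuous_on_powr_coercive[OF Hc]])
      (use Hc(2) in \<open>auto simp: powr_half_sqrt\<close>)
  let ?Ki = "op_powr H (-1/2)"
  have "\<forall>\<^sub>F d in at_right 0. norm (K d - ?Ki) \<le> sqrt d / c"
    using eventually_at_right_less[of "0::real"]
  proof eventually_elim
    case (elim d)
    have k1: "continuous_on {c..M} (\<lambda>t. 1 / sqrt (t + d))"
      using elim Hc(2) by (auto intro!: continuous_intros)
    have k2: "continuous_on {c..M} (\<lambda>t. t powr (-1/2))"
      by (rule continuous_on_powr_coercive[OF Hc])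
    have "norm (fun_calc (\<lambda>t. 1 / sqrt (t + d) - t powr (-1/2)) H) \<le> sqrt d / c"
    proof (rule norm_fun_calc_le[OF Hc(1)])
      fix t assume "t \<in> {c..M}"
      then have t: "c \<le> t" "0 < t" using Hc(2) by auto
      have s: "sqrt t \<le> sqrt (t + d)" "sqrt (t + d) \<le> sqrt t + sqrt d" "0 < sqrt t" "0 < sqrt (t + d)"
        using t elim by (auto intro: sqrt_add_le_add_sqrt)
      have "c \<le> sqrt t * sqrt t" using t by simp
      also have "\<dots> \<le> sqrt t * sqrt (t + d)" using s by (intro mult_left_mono) auto
      finally have c: "c \<le> sqrt t * sqrt (t + d)" .
      have "1 / sqrt (t + d) - t powr (-1/2) = - ((sqrt (t + d) - sqrt t) / (sqrt t * sqrt (t + d)))"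
        using t s by (simp add: powr_minus_divide powr_half_sqrt field_simps)
      moreover have "(sqrt (t + d) - sqrt t) / (sqrt t * sqrt (t + d)) \<le> sqrt d / c"
        using s c Hc(2) elim by (intro frac_le) auto
      moreover have "0 \<le> (sqrt (t + d) - sqrt t) / (sqrt t * sqrt (t + d))"
        using s by simp
      ultimately show "\<bar>1 / sqrt (t + d) - t powr (-1/2)\<bar> \<le> sqrt d / c" by simp
    qed (use elim Hc(2) k1 k2 in \<open>auto intro!: continuous_on_diff\<close>)
    then show ?case
      by (simp only: K_def op_powr_eq_fun_calc[OF Hc] fun_calc_diff[OF Hc(1) k1 k2])
  qed
  moreover have "((\<lambda>d. sqrt d / c) \<longlongrightarrow> 0) (at_right 0)"
    using tendsto_divide[OF tendsto_real_sqrt[OF tendsto_ident_at, of 0 "{0<..}"] tendsto_const[of c]] Hc(2)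
    by simp
  ultimately have "((\<lambda>d. K d - ?Ki) \<longlongrightarrow> 0) (at_right 0)"
    by (rule Lim_null_comparison)
  then have K: "((\<lambda>d. K d) \<longlongrightarrow> ?Ki) (at_right 0)" by (simp add: LIM_zero_iff)
  have "((\<lambda>d. (K d o\<^sub>L A o\<^sub>L K d) x) \<longlongrightarrow> (?Ki o\<^sub>L A o\<^sub>L ?Ki) x) (at_right 0)" for x
    by (intro blinfun.tendsto blinfun_compose.tendsto K tendsto_const)
  then show "?Ki o\<^sub>L A o\<^sub>L ?Ki = P"
    unfolding P_def by (intro strong_lim0_eqI[symmetric])
qed

lemma filterlim_mult_at_right_0:
  assumes "0 < (k::real)" shows "filterlim (\<lambda>e. k * e) (at_right 0) (at_right 0)"
proof -
  have "((\<lambda>e. k * e) \<longlongrightarrow> k * 0) (at_right 0)" by (intro tendsto_intros)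
  moreover have "\<forall>\<^sub>F e in at_right 0. k * e \<in> {0<..} \<and> k * e \<noteq> 0"
    using eventually_at_right_less[of "0::real"] by eventually_elim (use assms in simp)
  ultimately show ?thesis by (simp add: filterlim_at)
qed

text \<open>An operator that is left alone has shift coefficient 0. In the second alternative the
  shifted \<open>B\<close> is coercive and \<open>f\<close> is continuous on \<open>{0<..}\<close>
  only: this is for functions t \<mapsto> 1 / f (1 / t), whose value at 0 is an artefact of division
  by 0.\<close>

lemma op_mean_tendsto:
  assumes ab: "0 \<le> a" "0 \<le> b" and A_inv: "0 < a \<or> invertible_op A"
    and \<phi>: "continuous_on {0..1} \<phi>"
    and f: "continuous_on {0..} f \<and> (\<forall>x. 0 < x \<and> x \<le> 1 \<longrightarrow> \<phi> x = x * f ((1 - x) / x)) \<or>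
      (0 < b \<or> invertible_op B) \<and> continuous_on {0<..} f \<and>
        (\<forall>x. 0 < x \<and> x < 1 \<longrightarrow> \<phi> x = x * f ((1 - x) / x))"
  shows "((\<lambda>e. op_mean f (A + (a * e) *\<^sub>R id_blinfun) (B + (b * e) *\<^sub>R id_blinfun) x)
    \<longlongrightarrow> joint_calc \<phi> x) (at_right 0)"
proof -
  define k where "k = a + b"
  let ?X = "\<lambda>e. A + (a * e) *\<^sub>R id_blinfun" and ?Y = "\<lambda>e. B + (b * e) *\<^sub>R id_blinfun"
  let ?H = "\<lambda>e. H + (k * e) *\<^sub>R id_blinfun"
  let ?P = "\<lambda>e. op_powr (?H e) (-1/2) o\<^sub>L ?X e o\<^sub>L op_powr (?H e) (-1/2)"
  have XY: "?X e + ?Y e = ?H e" for e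
    by (simp add: H_def k_def algebra_simps)
  have mean: "op_mean f (?X e) (?Y e) = op_powr (?H e) (1/2) o\<^sub>L fun_calc \<phi> (?P e) o\<^sub>L op_powr (?H e) (1/2)
      \<and> op_between 0 (?P e) 1" if e: "0 < e" for e
  proof -
    obtain c M where X: "0 < c" "op_between c (?X e) M"
      using coercive_shift[OF A, of "a * e"] ab A_inv e by (auto simp: zero_less_mult_iff)
    \<comment> \<open>y = 0 belongs to the alternative in which \<open>f\<close> is continuous at 0;
      otherwise y is a coercivity constant of the shifted \<open>B\<close>.\<close>
    obtain y N where Y: "0 \<le> y" "op_between y (?Y e) N"
      "continuous_on (if y = 0 then {0..} else {0<..}) f"
      "\<And>x. 0 < x \<Longrightarrow> x \<le> 1 \<Longrightarrow> y = 0 \<or> x < 1 \<Longrightarrow> \<phi> x = x * f ((1 - x) / x)"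
    proof (cases "continuous_on {0..} f \<and> (\<forall>x. 0 < x \<and> x \<le> 1 \<longrightarrow> \<phi> x = x * f ((1 - x) / x))")
      case True
      have "op_between 0 (?Y e) (norm B + b * e)"
        by (rule op_between_mono[OF op_between_add[OF B op_between_scaled_id]]) (use ab e in auto)
      with True that[of 0] show ?thesis by auto
    next
      case False
      then obtain y N where "0 < y" "op_between y (?Y e) N"
        using f coercive_shift[OF B, of "b * e"] ab e by (auto simp: zero_less_mult_iff)
      with False f that[of y] show ?thesis by auto
    qed
    show ?thesis
      using op_mean_homogeneous[OF X(2,1) Y(2,1,3) \<phi> Y(4)] unfolding XY by blast
  qed
  show ?thesis
  proof (cases "k = 0")
    case True
    then have 0: "a = 0" "b = 0" using ab by (auto simp: k_def)
    then obtain c M where "0 < c" "op_between c A M" using coercive_shift[OF A, of 0] A_inv by auto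
    then have "op_between c H (M + norm B)" using op_between_add[OF _ B] by (fastforce simp: H_def)
    note WP = W_P_coercive[OF this \<open>0 < c\<close>]
    have "op_mean f A B = joint_calc \<phi>"
      using mean[of 1] unfolding 0 k_def joint_calc_def by (simp add: WP[unfolded minus_divide_left[symmetric]])
    then show ?thesis by (simp add: 0)
  next
    case False
    then have k: "0 < k" using ab by (simp add: k_def)
    \<comment> \<open>H + k e has the inverse square root K(k e). So \<open>?P e\<close> is K A K
      plus a e K^2 = (a / k) G(k e), and the two parts tend to \<open>P\<close> and (a / k)
      Q.\<close>
    have "((\<lambda>e. ?P e x) \<longlongrightarrow> (P + (a / k) *\<^sub>R Q) x) (at_right 0)" for x
    proof -
      have "((\<lambda>d. (K d o\<^sub>L A o\<^sub>L K d) x + (a / k) *\<^sub>R G d x) \<longlongrightarrow> P x + (a / k) *\<^sub>R Q x) (at_right 0)"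
        by (intro tendsto_add tendsto_scaleR tendsto_const K_A_K_tendsto G_tendsto)
      from filterlim_compose[OF this filterlim_mult_at_right_0[OF k]]
      have "((\<lambda>e. (K (k * e) o\<^sub>L A o\<^sub>L K (k * e)) x + (a / k) *\<^sub>R G (k * e) x)
          \<longlongrightarrow> P x + (a / k) *\<^sub>R Q x) (at_right 0)" by simp
      moreover have "\<forall>\<^sub>F e in at_right 0.
          ?P e x = (K (k * e) o\<^sub>L A o\<^sub>L K (k * e)) x + (a / k) *\<^sub>R G (k * e) x"
        using eventually_at_right_less[of "0::real"]
      proof eventually_elim
        case (elim e)
        then have ke: "0 < k * e" using k by simp
        have "(a / k) *\<^sub>R G (k * e) x = (a * e) *\<^sub>R K (k * e) (K (k * e) x)"
          using k by (simp add: K_K_scaled[OF ke, symmetric] blinfun.scaleR_left)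
        then show ?case
          unfolding op_powr_shift_inv_sqrt[OF ke]
          by (simp add: blinfun.add_left blinfun.add_right blinfun.scaleR_left blinfun.scaleR_right)
      qed
      ultimately show ?thesis by (simp add: tendsto_cong blinfun.add_left blinfun.scaleR_left)
    qed
    note lim = this
    have ev: "\<forall>\<^sub>F e in at_right 0. op_between 0 (?P e) 1"
      using eventually_at_right_less[of "0::real"] by eventually_elim (use mean in blast)
    have PQ: "op_between 0 (P + (a / k) *\<^sub>R Q) 1"
      by (rule op_between_strong_limit[OF lim ev trivial_limit_at_right_real])
    have R: "((\<lambda>e. op_powr (?H e) (1/2)) \<longlongrightarrow> W) (at_right 0)"
      by (rule filterlim_compose[OF op_powr_shift_sqrt_tendsto filterlim_mult_at_right_0[OF k]])
    have "((\<lambda>e. op_powr (?H e) (1/2) (fun_calc \<phi> (?P e) (op_powr (?H e) (1/2) x)))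
        \<longlongrightarrow> W (fun_calc \<phi> (P + (a / k) *\<^sub>R Q) (W x))) (at_right 0)"
      by (intro blinfun.tendsto R fun_calc_strong_limit[OF lim ev PQ \<phi>] tendsto_const)
    moreover have "\<forall>\<^sub>F e in at_right 0. op_mean f (?X e) (?Y e) x
        = op_powr (?H e) (1/2) (fun_calc \<phi> (?P e) (op_powr (?H e) (1/2) x))"
      using eventually_at_right_less[of "0::real"]
    proof eventually_elim
      case (elim e)
      have "op_mean f (?X e) (?Y e)
          = op_powr (?H e) (1/2) o\<^sub>L fun_calc \<phi> (?P e) o\<^sub>L op_powr (?H e) (1/2)"
        using mean[OF elim] by blast
      then show ?case by (simp only: blinfun_apply_blinfun_compose)
    qed
    ultimately show ?thesis
      by (simp only: tendsto_cong joint_calc_shift[OF PQ \<phi>] joint_calc_def blinfun_apply_blinfun_compose)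
  qed
qed

end

section \<open>Complex-linear operators\<close>

lemma cinner_scaleC_left: "cinner (c *\<^sub>C x) y = cnj c * cinner x y"
  by (metis cinner_commute cinner_scaleC_right complex_cnj_mult)

lemma Im_cinner: "Im (cinner x y) = inner x ((- \<i>) *\<^sub>C y)"
  by (simp add: Re_cinner[symmetric] cinner_scaleC_right)

lemma scaleC_blinfun_apply: "blinfun_apply (Blinfun ((*\<^sub>C) c)) x = c *\<^sub>C (x :: 'a::complex_inner)"
proof -
  have "bounded_linear ((*\<^sub>C) c :: 'a \<Rightarrow> 'a)"
  proof (rule bounded_linear_intro)
    show "c *\<^sub>C (r *\<^sub>R y) = r *\<^sub>R (c *\<^sub>C y)" for r and y :: 'a
      by (simp add: scaleR_scaleC scaleC_scaleC mult.commute)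
    show "norm (c *\<^sub>C y) \<le> norm y * cmod c" for y :: 'a
    proof -
      have "(norm (c *\<^sub>C y))\<^sup>2 = Re (cinner (c *\<^sub>C y) (c *\<^sub>C y))"
        by (simp add: Re_cinner power2_norm_eq_inner)
      also have "\<dots> = (cmod c)\<^sup>2 * Re (cinner y y)"
        by (simp add: cinner_scaleC_left cinner_scaleC_right cmod_power2)
          (simp add: power2_eq_square algebra_simps)
      also have "Re (cinner y y) = (norm y)\<^sup>2"
        by (simp add: Re_cinner power2_norm_eq_inner)
      finally have "(norm (c *\<^sub>C y))\<^sup>2 = (cmod c)\<^sup>2 * (norm y)\<^sup>2" .
      then show ?thesis
        by (metis power_mult_distrib mult.commute norm_ge_zero order_refl power2_le_imp_le
            mult_nonneg_nonneg)
    qed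
  qed (rule scaleC_add_right)
  then show ?thesis by (simp add: bounded_linear_Blinfun_apply)
qed

lemma complex_linear_iff_commute:
  "complex_linear A \<longleftrightarrow> (\<forall>c. Blinfun ((*\<^sub>C) c) o\<^sub>L A = A o\<^sub>L Blinfun ((*\<^sub>C) c))"
  unfolding complex_linear_def
  by (metis (mono_tags) blinfun_apply_blinfun_compose blinfun_eqI scaleC_blinfun_apply)

text \<open>The complex inner product is recovered from its real part: its imaginary part is the
  real inner product with -\<i> y, and \<open>A\<close> commutes with -\<i>.\<close>

lemma positive_opI:
  assumes "complex_linear A" "symmetric_op A" "\<And>x. 0 \<le> inner x (A x)"
  shows "positive_op A"
proof -
  have adj: "cinner (A x) y = cinner x (A y)" for x y
    using symmetric_opD[OF assms(2), of x y] symmetric_opD[OF assms(2), of x "(- \<i>) *\<^sub>C y"] assms(1)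
    by (simp add: complex_eq_iff Re_cinner Im_cinner complex_linear_def)
  then have "Im (cinner x (A x)) = 0" for x
    by (metis cinner_commute complex_cnj_cancel_iff Reals_cnj_iff complex_is_Real_iff)
  with adj assms show ?thesis
    by (simp add: positive_op_def self_adjoint_def is_adjoint_def complex_nonneg_Reals_iff Re_cinner)
qed

lemma positive_opD:
  assumes "positive_op A"
  shows "complex_linear A" "op_between 0 A (norm A)"
proof -
  show "complex_linear A" using assms by (simp add: positive_op_def self_adjoint_def)
  have sym: "symmetric_op A"
    using assms by (simp add: positive_op_def self_adjoint_def is_adjoint_def symmetric_op_def
        Re_cinner[symmetric])
  have "0 \<le> inner x (A x)" for x
    using assms by (simp add: positive_op_def Re_cinner[symmetric] complex_nonneg_Reals_iff)
  then show "op_between 0 A (norm A)"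
    using sym op_betweenD(3)[OF op_between_norm[OF sym]] by (simp add: op_between_def)
qed

section \<open>The scalar functions\<close>

text \<open>The case distinction is that of \<open>op_powr\<close>. The value 1 for s = 0 makes
  \<open>pw 0\<close> continuous at 0.\<close>

definition pw :: "real \<Rightarrow> real \<Rightarrow> real" where
  "pw s t = (if s = 0 then 1 else t powr s)"

lemma pw_nonneg: "0 \<le> pw s t"
  by (simp add: pw_def)

lemma pw_pos: "0 < t \<Longrightarrow> 0 < pw s t"
  by (simp add: pw_def)

lemma pw_eq_powr: "0 < t \<Longrightarrow> pw s t = t powr s"
  by (simp add: pw_def)

lemma pw_half: "0 \<le> t \<Longrightarrow> pw (1/2) t = sqrt t"
  by (simp add: pw_def powr_half_sqrt)

lemma continuous_on_pw:
  assumes "0 \<le> s" shows "continuous_on {0..} (pw s)"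
proof (cases "s = 0")
  case False
  then have "continuous_on {0..} (\<lambda>t::real. t powr s)"
    using assms by (intro continuous_on_powr' continuous_intros) auto
  then show ?thesis using False by (simp add: pw_def[abs_def])
qed (simp add: pw_def[abs_def])

definition pw_mean :: "real \<Rightarrow> real \<Rightarrow> real \<Rightarrow> real" where
  "pw_mean s x y = pw (1 - s) x * pw s y"

lemma pw_mean_eq_powr: "0 < x \<Longrightarrow> 0 < y \<Longrightarrow> pw_mean s x y = x powr (1 - s) * y powr s"
  by (simp add: pw_mean_def pw_eq_powr)

lemma pw_mean_half: "0 \<le> x \<Longrightarrow> 0 \<le> y \<Longrightarrow> pw_mean (1/2) x y = sqrt x * sqrt y"
  using pw_half by (simp add: pw_mean_def)

lemma pw_mean_homogeneous:
  assumes "0 < x" "0 \<le> y" shows "pw_mean s x y = x * pw s (y / x)"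
proof -
  have "x powr (1 - s) = x / x powr s" using assms by (simp add: powr_diff)
  then show ?thesis using assms by (simp add: pw_mean_def pw_def powr_divide)
qed

lemma pw_mean_commute: "pw_mean s x y = pw_mean (1 - s) y x"
  by (simp add: pw_mean_def mult.commute)

lemma continuous_on_pw_mean:
  assumes "0 \<le> s" "s \<le> 1"
  shows "continuous_on {0..1} (\<lambda>x. pw_mean s x (1 - x))" "continuous_on {0..1} (\<lambda>x. pw_mean s (1 - x) x)"
  unfolding pw_mean_def using assms
  by (auto intro!: continuous_on_mult continuous_on_compose2[OF continuous_on_pw] continuous_intros)

text \<open>The ordinary Young inequality for x and sqrt x sqrt y with weights 1 - 2 s and 2 s: the
  weighted product is x^(1 - s) y^s, and the weighted sum is (1 - s) x + s y - s (sqrt x - sqrt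
  y)^2.\<close>

lemma refined_Young_aux:
  assumes x: "0 < x" and y: "0 < y" and s: "0 \<le> s" "s \<le> 1/2"
  shows "pw_mean s x y + s * (sqrt x - sqrt y)\<^sup>2 \<le> (1 - s) * x + s * y"
proof -
  have "x powr (1 - 2 * s) * (sqrt x * sqrt y) powr (2 * s)
      \<le> (1 - 2 * s) * x + (2 * s) * (sqrt x * sqrt y)"
    using assms by (intro Youngs_inequality_0) auto
  moreover have "x powr (1 - 2 * s) * (sqrt x * sqrt y) powr (2 * s) = pw_mean s x y"
  proof -
    have "(sqrt x * sqrt y) powr (2 * s) = x powr s * y powr s"
      using x y by (simp add: powr_mult powr_half_sqrt[symmetric] powr_powr)
    then show ?thesis using x y
      by (simp add: pw_mean_eq_powr powr_add[symmetric] flip: mult.assoc)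
  qed
  moreover have "s * (sqrt x - sqrt y)\<^sup>2 = s * x + s * y - 2 * s * (sqrt x * sqrt y)"
    using x y by (simp add: power2_diff algebra_simps)
  ultimately show ?thesis by (simp add: left_diff_distrib)
qed

lemma refined_Young:
  assumes x: "0 \<le> x" and y: "0 \<le> y" and s: "0 \<le> s" "s \<le> 1"
  shows "pw_mean s x y + min s (1 - s) * (sqrt x - sqrt y)\<^sup>2 \<le> (1 - s) * x + s * y"
proof (cases "x = 0 \<or> y = 0")
  case True
  have "min s (1 - s) * y \<le> s * y" "min s (1 - s) * x \<le> (1 - s) * x"
    using x y by (intro mult_right_mono; simp)+
  then show ?thesis using True x y s by (auto simp: pw_mean_def pw_def)
next
  case False
  then have xy: "0 < x" "0 < y" using x y by auto
  show ?thesis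
  proof (cases "s \<le> 1/2")
    case True
    then show ?thesis using refined_Young_aux[OF xy s(1)] by (simp add: min_def)
  next
    case False
    then show ?thesis
      using refined_Young_aux[OF xy(2,1), of "1 - s"] s pw_mean_commute[of s x y]
      by (simp add: min_def power2_commute[of "sqrt y"] algebra_simps)
  qed
qed

text \<open>In the homogeneous variables \<open>x + y = 1\<close>, the harmonic means of the theorem have the form
  \<open>x y / D(x, y)\<close>, which is \<open>0 / 0\<close> at an end point if \<open>\<nu>\<close> is \<open>0\<close> or \<open>1\<close>.\<close>

definition harmonic_profile :: "real \<Rightarrow> (real \<Rightarrow> real) \<Rightarrow> real \<Rightarrow> real" where
  "harmonic_profile \<nu> D x = (if \<nu> = 0 then x else if \<nu> = 1 then 1 - x else x * (1 - x) / D x)"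

lemma continuous_on_harmonic_profile:
  assumes "continuous_on {0..1} D"
    and "\<And>x. \<nu> \<noteq> 0 \<Longrightarrow> \<nu> \<noteq> 1 \<Longrightarrow> 0 \<le> x \<Longrightarrow> x \<le> 1 \<Longrightarrow> D x \<noteq> 0"
  shows "continuous_on {0..1} (harmonic_profile \<nu> D)"
  using assms
  by (cases "\<nu> = 0"; cases "\<nu> = 1")
    (auto simp: harmonic_profile_def[abs_def] intro!: continuous_intros)

lemma regularize_eq:
  "regularize e S = S + ((if invertible_op S then 0 else 1) * e) *\<^sub>R id_blinfun"
  by (simp add: regularize_def)

lemma geom_mean_eq: "geom_mean S s T = by_continuity (\<lambda>X. op_mean (pw s) X T) S"
  by (simp only: geom_mean_def op_mean_def pw_def[abs_def] op_powr_def)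

lemma op_between_invertible:
  assumes "op_between c S M" "0 < c"
  shows "invertible_op (S :: 'a::chilbert_space \<Rightarrow>\<^sub>L 'a)"
  using inverse_op_coercive(1)[OF assms] by (auto simp: invertible_op_def)

text \<open>The geometric means inside \<open>by_continuity2\<close> have coercive arguments, so
  their own limits are constant and no iterated limit arises.\<close>

lemma geom_mean_coercive:
  fixes S T :: "'a::chilbert_space \<Rightarrow>\<^sub>L 'a"
  assumes "op_between c S M" "0 < c"
  shows "geom_mean S s T = op_mean (pw s) S T"
  unfolding geom_mean_eq by_continuity_def
  by (rule strong_lim0_eqI) (simp add: regularize_def op_between_invertible[OF assms])

context positive_pair
begin

lemma regularize_coercive:
  assumes "op_between 0 S (norm S)" "0 < e"
  shows "\<exists>c M. 0 < c \<and> 0 < M \<and> op_between c (regularize e S :: 'a \<Rightarrow>\<^sub>L 'a) M"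
proof -
  obtain c M where "0 < c" "op_between c (regularize e S) M"
    using coercive_shift[OF assms(1), of 0] coercive_shift[OF assms(1), of e] assms(2)
    by (cases "invertible_op S") (auto simp: regularize_def)
  moreover from this(2) have "op_between c (regularize e S) (max M 1)"
    by (rule op_between_mono) auto
  ultimately show ?thesis by (intro exI[of _ c] exI[of _ "max M 1"]) auto
qed

lemma geom_mean_eq_joint_calc:
  assumes s: "0 \<le> s" "s \<le> 1"
  shows "geom_mean A s B = joint_calc (\<lambda>x. pw_mean s x (1 - x))"
  unfolding geom_mean_eq by_continuity_def
proof (rule strong_lim0_eqI)
  fix x
  \<comment> \<open>Only \<open>A\<close> is regularized, so the shift of \<open>B\<close> has
    coefficient 0; this is possible because \<open>pw s\<close> is continuous at 0.\<close>
  have "((\<lambda>e. op_mean (pw s) (A + ((if invertible_op A then 0 else 1) * e) *\<^sub>R id_blinfun)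
      (B + (0 * e) *\<^sub>R id_blinfun) x) \<longlongrightarrow> joint_calc (\<lambda>x. pw_mean s x (1 - x)) x) (at_right 0)"
    by (rule op_mean_tendsto)
      (use s in \<open>auto simp: continuous_on_pw continuous_on_pw_mean pw_mean_homogeneous\<close>)
  then show "((\<lambda>e. op_mean (pw s) (regularize e A) B x)
      \<longlongrightarrow> joint_calc (\<lambda>x. pw_mean s x (1 - x)) x) (at_right 0)"
    unfolding regularize_eq by simp
qed

text \<open>The arithmetic mean contains no inverse, but it is brought into the common form through
  a limit: for A + e and B it is the mean of 1 - \<nu> + \<nu> t, and e tends to 0.\<close>

lemma arithmetic_mean_eq_joint_calc:
  "(1 - \<nu>) *\<^sub>R A + \<nu> *\<^sub>R B = joint_calc (\<lambda>x. (1 - \<nu>) * x + \<nu> * (1 - x))"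
proof (rule blinfun_eqI, rule tendsto_unique[OF trivial_limit_at_right_real])
  fix x
  let ?f = "\<lambda>t. (1 - \<nu>) * 1 + \<nu> * t" and ?X = "\<lambda>e. A + (1 * e) *\<^sub>R id_blinfun"
  show "((\<lambda>e. op_mean ?f (?X e) (B + (0 * e) *\<^sub>R id_blinfun) x)
      \<longlongrightarrow> joint_calc (\<lambda>x. (1 - \<nu>) * x + \<nu> * (1 - x)) x) (at_right 0)"
    by (rule op_mean_tendsto) (auto simp: field_simps intro!: continuous_intros)
  have "\<forall>\<^sub>F e in at_right 0. op_mean ?f (?X e) (B + (0 * e) *\<^sub>R id_blinfun) x
      = ((1 - \<nu>) *\<^sub>R ?X e + \<nu> *\<^sub>R B) x"
    using eventually_at_right_less[of "0::real"]
  proof eventually_elim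
    case (elim e)
    then obtain c M where X: "0 < c" "op_between c (?X e) M"
      using coercive_shift[OF A, of "1 * e"] by auto
    note alg = op_mean_algebra[OF X(2,1) B]
    have "op_mean ?f (?X e) B = op_mean (\<lambda>t. (1 - \<nu>) * 1) (?X e) B + op_mean (\<lambda>t. \<nu> * t) (?X e) B"
      by (rule alg(3)) (intro continuous_intros)+
    also have "op_mean (\<lambda>t. (1 - \<nu>) * 1) (?X e) B = (1 - \<nu>) *\<^sub>R ?X e"
      by (subst alg(5)) (intro continuous_intros, simp only: alg(1))
    also have "op_mean (\<lambda>t. \<nu> * t) (?X e) B = \<nu> *\<^sub>R B"
      by (subst alg(5)) (intro continuous_intros, simp only: alg(2))
    finally show ?case by simp
  qed
  moreover have "((\<lambda>e. ((1 - \<nu>) *\<^sub>R ?X e + \<nu> *\<^sub>R B) x) \<longlongrightarrow> ((1 - \<nu>) *\<^sub>R (A + (1 * 0) *\<^sub>R id_blinfun) + \<nu> *\<^sub>R B) x) (at_right 0)"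
    by (intro tendsto_intros)
  ultimately show "((\<lambda>e. op_mean ?f (?X e) (B + (0 * e) *\<^sub>R id_blinfun) x)
      \<longlongrightarrow> ((1 - \<nu>) *\<^sub>R A + \<nu> *\<^sub>R B) x) (at_right 0)"
    by (simp add: tendsto_cong)
qed

text \<open>\<open>E\<close> is the expression in braces, \<open>f\<close> its function on coercive
  operators. Passing to inverses exchanges the weights x and 1 - x, so \<open>D\<close> is the value
  of \<open>E\<close> at (1 - x, x), and x / f(x / (1 - x)) = x (1 - x) / D x.\<close>

lemma inverse_mean_eq_joint_calc:
  assumes f: "continuous_on {0..} f" "\<And>t. 0 < t \<Longrightarrow> 0 < f t"
    and E: "\<And>c c' M M' (X::'a \<Rightarrow>\<^sub>L 'a) Y. 0 < c \<Longrightarrow> 0 < c' \<Longrightarrow> op_between c X M \<Longrightarrow> op_between c' Y M' \<Longrightarrow>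
      E X Y = op_mean f X Y"
    and \<nu>: "0 \<le> \<nu>" "\<nu> \<le> 1"
    and D: "continuous_on {0..1} D" "\<And>x. 0 < \<nu> \<Longrightarrow> \<nu> < 1 \<Longrightarrow> 0 \<le> x \<Longrightarrow> x \<le> 1 \<Longrightarrow> 0 < D x"
      "\<And>x. 0 < x \<Longrightarrow> x < 1 \<Longrightarrow> f (x / (1 - x)) = D x / (1 - x)"
      "\<And>x. 0 < x \<Longrightarrow> x < 1 \<Longrightarrow> \<nu> = 0 \<Longrightarrow> D x = 1 - x" "\<And>x. 0 < x \<Longrightarrow> x < 1 \<Longrightarrow> \<nu> = 1 \<Longrightarrow> D x = x"
  shows "by_continuity2 (\<lambda>X Y. inverse_op (E (inverse_op X) (inverse_op Y))) A B
    = joint_calc (harmonic_profile \<nu> D)"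
  unfolding by_continuity2_def
proof (rule strong_lim0_eqI)
  fix x
  let ?g = "\<lambda>t. 1 / f (1 / t)"
  have f0: "continuous_on {0<..} f" by (rule continuous_on_subset[OF f(1)]) auto
  have g: "continuous_on {0<..} ?g"
  proof (intro continuous_on_divide continuous_on_const)
    show "continuous_on {0<..} (\<lambda>t. f (1 / t))"
      by (rule continuous_on_compose2[OF f0]) (auto intro!: continuous_intros)
    show "\<forall>t\<in>{0<..}. f (1 / t) \<noteq> 0" using f(2) by (metis divide_pos_pos greaterThan_iff less_irrefl zero_less_one)
  qed
  have prof: "harmonic_profile \<nu> D x = x * ?g ((1 - x) / x)" if "0 < x" "x < 1" for x
  proof -
    have "?g ((1 - x) / x) = (1 - x) / D x" using that by (simp add: D(3))
    then show ?thesis using that D(4,5)[OF that] by (simp add: harmonic_profile_def)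
  qed
  have "((\<lambda>e. op_mean ?g (A + ((if invertible_op A then 0 else 1) * e) *\<^sub>R id_blinfun)
      (B + ((if invertible_op B then 0 else 1) * e) *\<^sub>R id_blinfun) x)
      \<longlongrightarrow> joint_calc (harmonic_profile \<nu> D) x) (at_right 0)"
  proof (rule op_mean_tendsto)
    have "D x \<noteq> 0" if "\<nu> \<noteq> 0" "\<nu> \<noteq> 1" "0 \<le> x" "x \<le> 1" for x
      using D(2)[of x] that \<nu> by force
    then show "continuous_on {0..1} (harmonic_profile \<nu> D)"
      by (intro continuous_on_harmonic_profile D(1))
  qed (use g prof in auto)
  moreover have "\<forall>\<^sub>F e in at_right 0.
      inverse_op (E (inverse_op (regularize e A)) (inverse_op (regularize e B))) x
      = op_mean ?g (regularize e A) (regularize e B) x"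
    using eventually_at_right_less[of "0::real"]
  proof eventually_elim
    case (elim e)
    obtain c M where X: "0 < c" "0 < M" "op_between c (regularize e A) M"
      using regularize_coercive[OF A elim] by blast
    obtain c' M' where Y: "0 < c'" "0 < M'" "op_between c' (regularize e B) M'"
      using regularize_coercive[OF B elim] by blast
    have "E (inverse_op (regularize e A)) (inverse_op (regularize e B))
        = op_mean f (inverse_op (regularize e A)) (inverse_op (regularize e B))"
      by (rule E[of "1 / M" "1 / M'" _ "1 / c" _ "1 / c'"])
        (use X Y in \<open>auto simp: inverse_op_coercive(2)[OF X(3,1)] inverse_op_coercive(2)[OF Y(3,1)]
          intro: op_between_inverse\<close>)
    then show ?case by (simp only: inverse_op_mean[OF X(3,1) Y(3,1) f0 f(2)])
  qed
  ultimately show "((\<lambda>e. inverse_op (E (inverse_op (regularize e A)) (inverse_op (regularize e B))) x)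
      \<longlongrightarrow> joint_calc (harmonic_profile \<nu> D) x) (at_right 0)"
    unfolding regularize_eq by (simp only: tendsto_cong)
qed

lemma op_ge_joint_calc:
  assumes "complex_linear A" "complex_linear B"
    and \<phi>: "continuous_on {0..1} \<phi>" "continuous_on {0..1} \<psi>"
    and le: "\<And>x. 0 \<le> x \<Longrightarrow> x \<le> 1 \<Longrightarrow> \<psi> x \<le> \<phi> x"
  shows "joint_calc \<phi> \<succeq> joint_calc \<psi>"
proof -
  have c: "continuous_on {0..1} (\<lambda>x. \<phi> x - \<psi> x)" by (intro continuous_intros \<phi>)
  have "positive_op (joint_calc (\<lambda>x. \<phi> x - \<psi> x))"
  proof (rule positive_opI)
    show "complex_linear (joint_calc (\<lambda>x. \<phi> x - \<psi> x))"
      using assms(1,2) joint_calc_commute[OF _ _ c] by (simp add: complex_linear_iff_commute)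
  qed (use joint_calc_nonneg[OF c] le in auto)
  then show ?thesis by (simp add: op_ge_def joint_calc_algebra(2)[OF \<phi>])
qed

end

theorem theorem2p1:
  fixes A B :: "'a::chilbert_space \<Rightarrow>\<^sub>L 'a" and \<nu> r :: real
  assumes "positive_op A" and "positive_op B"
    and "0 \<le> \<nu>" and "\<nu> \<le> 1"
    and "r = min \<nu> (1 - \<nu>)"
  shows "((1 - \<nu>) *\<^sub>R A + \<nu> *\<^sub>R B
           \<succeq> A \<sharp>\<^bsub>\<nu>\<^esub> B + (2 * r) *\<^sub>R ((1/2) *\<^sub>R (A + B) - A \<sharp>\<^bsub>1/2\<^esub> B))
    \<and> (A \<sharp>\<^bsub>\<nu>\<^esub> B + (2 * r) *\<^sub>R ((1/2) *\<^sub>R (A + B) - A \<sharp>\<^bsub>1/2\<^esub> B)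
           \<succeq> A \<sharp>\<^bsub>\<nu>\<^esub> B)
    \<and> (A \<sharp>\<^bsub>\<nu>\<^esub> B
           \<succeq> by_continuity2 (\<lambda>X Y. inverse_op
                (inverse_op X \<sharp>\<^bsub>\<nu>\<^esub> inverse_op Y
                 + (2 * r) *\<^sub>R ((1/2) *\<^sub>R (inverse_op X + inverse_op Y)
                               - inverse_op X \<sharp>\<^bsub>1/2\<^esub> inverse_op Y))) A B)
    \<and> (by_continuity2 (\<lambda>X Y. inverse_op
                (inverse_op X \<sharp>\<^bsub>\<nu>\<^esub> inverse_op Y
                 + (2 * r) *\<^sub>R ((1/2) *\<^sub>R (inverse_op X + inverse_op Y)
                               - inverse_op X \<sharp>\<^bsub>1/2\<^esub> inverse_op Y))) A B
           \<succeq> by_continuity2 (\<lambda>X Y. inverse_op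
                ((1 - \<nu>) *\<^sub>R inverse_op X + \<nu> *\<^sub>R inverse_op Y)) A B)"
proof -
  interpret positive_pair A B
    by standard (use assms positive_opD in auto)
  note lin = positive_opD(1)[OF assms(1)] positive_opD(1)[OF assms(2)]
  note \<nu> = assms(3,4)
  have r: "0 \<le> r" "0 < \<nu> \<Longrightarrow> \<nu> < 1 \<Longrightarrow> 0 < r" using assms(3-5) by auto
  define G\<nu> G2 where "G\<nu> x = pw_mean \<nu> x (1 - x)" and "G2 x = pw_mean (1/2) x (1 - x)" for x
  \<comment> \<open>The sum x + (1 - x) is left unreduced, to match the term that the algebra of
    \<open>joint_calc\<close> produces.\<close>
  define U where "U x = G\<nu> x + (2 * r) * ((1/2) * (x + (1 - x)) - G2 x)" for x
  \<comment> \<open>The two expressions in braces, evaluated at the exchanged weights (1 - x,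
    x).\<close>
  define D3 D4 where "D3 x = pw_mean \<nu> (1 - x) x + r * (sqrt (1 - x) - sqrt x)\<^sup>2"
    and "D4 x = (1 - \<nu>) * (1 - x) + \<nu> * x" for x
  have cG: "continuous_on {0..1} G\<nu>" "continuous_on {0..1} G2"
    unfolding G\<nu>_def G2_def using \<nu> by (auto intro: continuous_on_pw_mean)
  have cU: "continuous_on {0..1} U" unfolding U_def by (intro continuous_intros cG)
  have cD: "continuous_on {0..1} D3" "continuous_on {0..1} D4"
    unfolding D3_def D4_def using \<nu> by (auto intro!: continuous_intros continuous_on_pw_mean)
  have sq: "(sqrt x - sqrt y)\<^sup>2 = x + y - 2 * (sqrt x * sqrt y)" if "0 \<le> x" "0 \<le> y" for x y
    using that by (simp add: power2_diff)
  have U_sq: "U x = G\<nu> x + r * (sqrt x - sqrt (1 - x))\<^sup>2" if "0 \<le> x" "x \<le> 1" for x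
    using that by (simp only: U_def G2_def pw_mean_half sq diff_ge_0_iff_ge) (simp add: algebra_simps)
  \<comment> \<open>At the end points the geometric mean vanishes and the value is r > 0; inside,
    the geometric mean is positive.\<close>
  have D3_pos: "0 < D3 x" if "0 < \<nu>" "\<nu> < 1" "0 \<le> x" "x \<le> 1" for x
  proof (cases "x = 0 \<or> x = 1")
    case True
    then show ?thesis using r(2)[OF that(1,2)] that by (auto simp: D3_def pw_mean_def pw_def)
  next
    case False
    then have "0 < pw_mean \<nu> (1 - x) x" using that by (simp add: pw_mean_def pw_pos)
    then show ?thesis using r(1) by (simp add: D3_def add_pos_nonneg)
  qed
  have D4_pos: "0 < D4 x" if "0 < \<nu>" "\<nu> < 1" "0 \<le> x" "x \<le> 1" for x
    using that by (cases "x = 0") (auto simp: D4_def add_nonneg_pos)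
  have D34: "D3 x \<le> D4 x" if "0 \<le> x" "x \<le> 1" for x
    unfolding D3_def D4_def assms(5) using refined_Young[of "1 - x" x \<nu>] that \<nu> by simp
  have arith: "(1/2) *\<^sub>R (A + B) = joint_calc (\<lambda>x. (1/2) * (x + (1 - x)))"
  proof -
    have "joint_calc (\<lambda>x. (1/2) * (x + (1 - x))) = joint_calc (\<lambda>x. (1 - 1/2) * x + 1/2 * (1 - x))"
      by (rule arg_cong[of _ _ joint_calc]) (simp add: fun_eq_iff field_simps)
    then show ?thesis
      using arithmetic_mean_eq_joint_calc[of "1/2"] by (simp add: scaleR_add_right)
  qed
  have E1: "(1 - \<nu>) *\<^sub>R A + \<nu> *\<^sub>R B = joint_calc (\<lambda>x. (1 - \<nu>) * x + \<nu> * (1 - x))"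
    by (rule arithmetic_mean_eq_joint_calc)
  have geom: "A \<sharp>\<^bsub>\<nu>\<^esub> B = joint_calc G\<nu>" "A \<sharp>\<^bsub>1/2\<^esub> B = joint_calc G2"
    unfolding G\<nu>_def G2_def using \<nu> by (auto intro: geom_mean_eq_joint_calc)
  have E2: "A \<sharp>\<^bsub>\<nu>\<^esub> B + (2 * r) *\<^sub>R ((1/2) *\<^sub>R (A + B) - A \<sharp>\<^bsub>1/2\<^esub> B) = joint_calc U"
  proof -
    have c: "continuous_on {0..1} (\<lambda>x::real. (1/2) * (x + (1 - x)))" by (intro continuous_intros)
    show ?thesis
      unfolding U_def geom arith
      by (simp only: joint_calc_algebra(1)[OF cG(1) continuous_on_mult[OF continuous_on_const continuous_on_diff[OF c cG(2)]]]
          joint_calc_algebra(3)[OF continuous_on_diff[OF c cG(2)] cG(1)] joint_calc_algebra(2)[OF c cG(2)])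
  qed
  \<comment> \<open>The third expression at the scalar pair (1, t).\<close>
  let ?f3 = "\<lambda>t. pw \<nu> t + (2 * r) * ((1/2) * (1 + t) - pw (1/2) t)"
  have cpw: "continuous_on {0..} (pw \<nu>)" "continuous_on {0..} (pw (1/2))"
    using \<nu> by (auto intro: continuous_on_pw)
  have f3_eq: "?f3 t = pw \<nu> t + r * (1 - sqrt t)\<^sup>2" if "0 \<le> t" for t
  proof -
    have "(1 - sqrt t)\<^sup>2 = 1 + t - 2 * sqrt t" using sq[of 1 t] that by simp
    then show ?thesis by (simp only: pw_half[OF that]) (simp add: algebra_simps)
  qed
  have E3: "by_continuity2 (\<lambda>X Y. inverse_op
                (inverse_op X \<sharp>\<^bsub>\<nu>\<^esub> inverse_op Y
                 + (2 * r) *\<^sub>R ((1/2) *\<^sub>R (inverse_op X + inverse_op Y)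
                               - inverse_op X \<sharp>\<^bsub>1/2\<^esub> inverse_op Y))) A B = joint_calc (harmonic_profile \<nu> D3)"
  proof (rule inverse_mean_eq_joint_calc[where f = ?f3 and E = "\<lambda>X Y. X \<sharp>\<^bsub>\<nu>\<^esub> Y
      + (2 * r) *\<^sub>R ((1/2) *\<^sub>R (X + Y) - X \<sharp>\<^bsub>1/2\<^esub> Y)"])
    show "continuous_on {0..} ?f3" by (intro continuous_intros cpw)
    show "0 < ?f3 t" if "0 < t" for t
      unfolding f3_eq[OF less_imp_le[OF that]] using that r(1) by (simp add: pw_pos add_pos_nonneg)
    show "?f3 (x / (1 - x)) = D3 x / (1 - x)" if "0 < x" "x < 1" for x
    proof -
      have "pw \<nu> (x / (1 - x)) = pw_mean \<nu> (1 - x) x / (1 - x)"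
        using that by (simp add: pw_mean_homogeneous)
      moreover have "(1 - sqrt (x / (1 - x)))\<^sup>2 = (sqrt (1 - x) - sqrt x)\<^sup>2 / (1 - x)"
      proof -
        have "1 - sqrt (x / (1 - x)) = (sqrt (1 - x) - sqrt x) / sqrt (1 - x)"
          using that by (simp add: real_sqrt_divide diff_divide_distrib)
        then show ?thesis using that by (simp add: power_divide)
      qed
      ultimately show ?thesis
        using that by (subst f3_eq) (simp_all add: D3_def add_divide_distrib)
    qed
    show "D3 x = 1 - x" if "0 < x" "x < 1" "\<nu> = 0" for x
      using that assms(5) by (simp add: D3_def pw_mean_def pw_def)
    show "D3 x = x" if "0 < x" "x < 1" "\<nu> = 1" for x
      using that assms(5) by (simp add: D3_def pw_mean_def pw_def)
    fix c c' M M' :: real and X Y :: "'a \<Rightarrow>\<^sub>L 'a"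
    assume c: "0 < c" "0 < c'" and X: "op_between c X M" and "op_between c' Y M'"
    then have Y: "op_between 0 Y M'" using op_between_mono[of c' Y M' 0 M'] by simp
    note alg = op_mean_algebra[OF X c(1) Y]
    have half: "op_mean (\<lambda>t. (1/2) * (1 + t)) X Y = (1/2) *\<^sub>R (X + Y)"
      by (subst alg(5), intro continuous_intros, subst alg(3))
        (auto intro!: continuous_intros simp: alg(1,2))
    show "X \<sharp>\<^bsub>\<nu>\<^esub> Y + (2 * r) *\<^sub>R ((1/2) *\<^sub>R (X + Y) - X \<sharp>\<^bsub>1/2\<^esub> Y) = op_mean ?f3 X Y"
      unfolding geom_mean_coercive[OF X c(1)]
      by (subst alg(3), rule cpw, intro continuous_intros cpw, subst alg(5), intro continuous_intros cpw,
          subst alg(4), intro continuous_intros, rule cpw, simp only: half)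
  qed (use \<nu> cD D3_pos in auto)
  have E4: "by_continuity2 (\<lambda>X Y. inverse_op
                ((1 - \<nu>) *\<^sub>R inverse_op X + \<nu> *\<^sub>R inverse_op Y)) A B = joint_calc (harmonic_profile \<nu> D4)"
  proof (rule inverse_mean_eq_joint_calc[where f = "\<lambda>t. (1 - \<nu>) * 1 + \<nu> * t"
        and E = "\<lambda>X Y. (1 - \<nu>) *\<^sub>R X + \<nu> *\<^sub>R Y"])
    show "continuous_on {0..} (\<lambda>t. (1 - \<nu>) * 1 + \<nu> * t)" by (intro continuous_intros)
    show "0 < (1 - \<nu>) * 1 + \<nu> * t" if "0 < t" for t
      using that \<nu> by (cases "\<nu> = 0") (auto simp: add_nonneg_pos)
    show "(1 - \<nu>) * 1 + \<nu> * (x / (1 - x)) = D4 x / (1 - x)" if "0 < x" "x < 1" for x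
      using that by (simp add: D4_def add_divide_distrib)
    fix c c' M M' :: real and X Y :: "'a \<Rightarrow>\<^sub>L 'a"
    assume c: "0 < c" "0 < c'" and X: "op_between c X M" and "op_between c' Y M'"
    then have Y: "op_between 0 Y M'" using op_between_mono[of c' Y M' 0 M'] by simp
    note alg = op_mean_algebra[OF X c(1) Y]
    show "(1 - \<nu>) *\<^sub>R X + \<nu> *\<^sub>R Y = op_mean (\<lambda>t. (1 - \<nu>) * 1 + \<nu> * t) X Y"
      by (subst alg(3), intro continuous_intros, intro continuous_intros, subst alg(5),
          intro continuous_intros, subst alg(5), intro continuous_intros, simp only: alg(1,2))
  qed (use \<nu> cD D4_pos in \<open>auto simp: D4_def\<close>)
  have c1: "continuous_on {0..1} (\<lambda>x. (1 - \<nu>) * x + \<nu> * (1 - x))" by (intro continuous_intros)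
  have c3: "continuous_on {0..1} (harmonic_profile \<nu> D3)"
    using D3_pos \<nu> by (intro continuous_on_harmonic_profile cD) force
  have c4: "continuous_on {0..1} (harmonic_profile \<nu> D4)"
    using D4_pos \<nu> by (intro continuous_on_harmonic_profile cD) force
  have I1: "U x \<le> (1 - \<nu>) * x + \<nu> * (1 - x)" if "0 \<le> x" "x \<le> 1" for x
    unfolding U_sq[OF that] G\<nu>_def assms(5) using refined_Young[of x "1 - x" \<nu>] that \<nu> by simp
  have I2: "G\<nu> x \<le> U x" if "0 \<le> x" "x \<le> 1" for x
    unfolding U_sq[OF that] using r(1) by simp
  \<comment> \<open>The geometric means at (x, 1 - x) and (1 - x, x) have the product x (1 - x), and
    \<open>D3\<close> is at least the second of them.\<close>
  have I3: "harmonic_profile \<nu> D3 x \<le> G\<nu> x" if x: "0 \<le> x" "x \<le> 1" for x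
  proof (cases "\<nu> = 0 \<or> \<nu> = 1 \<or> x = 0 \<or> x = 1")
    case True
    then show ?thesis
      using x by (auto simp: harmonic_profile_def G\<nu>_def pw_mean_def pw_def)
  next
    case False
    then have *: "0 < x" "x < 1" "0 < \<nu>" "\<nu> < 1" using x \<nu> by auto
    let ?G' = "pw_mean \<nu> (1 - x) x"
    have "G\<nu> x * ?G' = (x powr (1 - \<nu>) * x powr \<nu>) * ((1 - x) powr (1 - \<nu>) * (1 - x) powr \<nu>)"
      using * by (simp add: G\<nu>_def pw_mean_eq_powr)
    also have "\<dots> = x * (1 - x)" using * by (simp add: powr_add[symmetric])
    finally have "x * (1 - x) = G\<nu> x * ?G'" by simp
    also have "\<dots> \<le> G\<nu> x * D3 x"
      using r(1) by (intro mult_left_mono) (auto simp: D3_def G\<nu>_def pw_mean_def pw_nonneg)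
    finally show ?thesis
      using D3_pos[OF *(3,4) x] * by (simp add: harmonic_profile_def pos_divide_le_eq)
  qed
  \<comment> \<open>The profile decreases when its denominator grows, so this is the refined Young
    inequality \<open>D34\<close> at the exchanged weights.\<close>
  have I4: "harmonic_profile \<nu> D4 x \<le> harmonic_profile \<nu> D3 x" if x: "0 \<le> x" "x \<le> 1" for x
    using D3_pos[OF _ _ x] D4_pos[OF _ _ x] D34[OF x] x \<nu>
    by (auto simp: harmonic_profile_def intro!: divide_left_mono mult_pos_pos)
  show ?thesis
    unfolding E1 E2 E3 E4 unfolding geom(1)
    by (intro conjI op_ge_joint_calc lin c1 cU cG c3 c4 I1 I2 I3 I4)
qed

end
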